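(* Let $k \geq 0$ be an integer, let $G$ be a mop of order $n \geq k+3$, and let $n_2$ be the number of vertices of $G$ of degree $2$. Then \[\iota_k(G) \leq \frac{n+n_2}{k+5}.\] Moreover, the bound is sharp: for each $k\ge 0$ there are infinitely many values of $n$ for which there is an $n$-vertex mop $G$ attaining equality.
   Context: All graphs are finite and simple. The order of $G$ is $|V(G)|$. A triangulated disc is a plane graph whose interior faces are triangles and whose exterior (unbounded) face is bounded by a simple cycle. A maximal outerplanar graph, or mop, is a triangulated disc $G$ such that the boundary of the exterior face of $G$ contains all the vertices of $G$ (so a mop has at least 3 vertices). For $S\subseteq V(G)$, $N_G[S]$ is the closed neighborhood of $S$, i.e. $S$ together with all vertices adjacent to a vertex of $S$; $G-N_G[S]$ is the subgraph induced by the remaining vertices. A set $S\subseteq V(G)$ is a $K_{1,k+1}$-isolating set of $G$ if $G-N_G[S]$ contains no copy of the star $K_{1,k+1}$ (equivalently for $k\ge 0$, every vertex of $G-N_G[S]$ has degree at most $k$ in $G-N_G[S]$). $\iota_k(G)$ denotes the minimum size of a $K_{1,k+1}$-isolating set of $G$. *)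

theory Defs
  imports "HOL-Analysis.Analysis"
begin

text \<open>Finite simple graphs: edges are two-element sets of vertices.\<close>

record 'a graph =
  verts :: "'a set"
  edges :: "'a set set"

definition neighbors :: "'a graph \<Rightarrow> 'a \<Rightarrow> 'a set" where
  "neighbors G v = {u \<in> verts G. {u, v} \<in> edges G}"

definition degree :: "'a graph \<Rightarrow> 'a \<Rightarrow> nat" where
  "degree G v = card (neighbors G v)"

definition closed_nbhd :: "'a graph \<Rightarrow> 'a set \<Rightarrow> 'a set" where
  "closed_nbhd G S = S \<union> (\<Union>v\<in>S. neighbors G v)"

definition delete_verts :: "'a graph \<Rightarrow> 'a set \<Rightarrow> 'a graph" where
  "delete_verts G X =
     \<lparr>verts = verts G - X, edges = {e \<in> edges G. e \<subseteq> verts G - X}\<rparr>"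

text \<open>A copy of \<open>H\<close> in \<open>G\<close> is a (not necessarily induced) subgraph of \<open>G\<close> isomorphic to \<open>H\<close>.\<close>

definition contains_copy :: "'a graph \<Rightarrow> 'b graph \<Rightarrow> bool" where
  "contains_copy G H \<longleftrightarrow>
     (\<exists>f. inj_on f (verts H) \<and> f ` verts H \<subseteq> verts G \<and> (\<forall>e\<in>edges H. f ` e \<in> edges G))"

definition star :: "nat \<Rightarrow> nat graph" where
  "star m = \<lparr>verts = {0..m}, edges = {{0, i} | i. i \<in> {1..m}}\<rparr>"

definition isolating_set :: "'a graph \<Rightarrow> 'b graph \<Rightarrow> 'a set \<Rightarrow> bool" where
  "isolating_set G H S \<longleftrightarrow>
     S \<subseteq> verts G \<and> \<not> contains_copy (delete_verts G (closed_nbhd G S)) H"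

text \<open>The minimum is attained for finite \<open>G\<close>, since the full vertex set is star-isolating.\<close>

definition iota :: "nat \<Rightarrow> 'a graph \<Rightarrow> nat" where
  "iota k G = (LEAST m. \<exists>S. isolating_set G (star (k + 1)) S \<and> card S = m)"

definition cycle_edges :: "'a list \<Rightarrow> 'a set set" where
  "cycle_edges xs = {{xs ! i, xs ! (Suc i mod length xs)} | i. i < length xs}"

definition is_cycle :: "'a graph \<Rightarrow> 'a list \<Rightarrow> bool" where
  "is_cycle G xs \<longleftrightarrow>
     3 \<le> length xs \<and> distinct xs \<and> set xs \<subseteq> verts G \<and> cycle_edges xs \<subseteq> edges G"

text \<open>
  Simple plane graphs, drawn in the complex plane: \<open>V\<close> is a finite set of points and \<open>A\<close> is the
  set of edges, each edge being (the image of) an arc that joins two distinct points of \<open>V\<close>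
  and has no vertex in its interior.  Thus \<open>e \<inter> V\<close> is the set of the two ends of the edge \<open>e\<close>.
  Distinct edges have different end sets and meet at most in common ends.
\<close>

definition plane_graph :: "complex set \<Rightarrow> complex set set \<Rightarrow> bool" where
  "plane_graph V A \<longleftrightarrow>
     finite V \<and>
     (\<forall>e\<in>A. \<exists>g. arc g \<and> path_image g = e \<and> e \<inter> V = {pathstart g, pathfinish g}) \<and>
     (\<forall>e\<in>A. \<forall>e'\<in>A. e \<noteq> e' \<longrightarrow> e \<inter> V \<noteq> e' \<inter> V \<and> e \<inter> e' \<subseteq> V)"

definition graph_of :: "complex set \<Rightarrow> complex set set \<Rightarrow> complex graph" where
  "graph_of V A = \<lparr>verts = V, edges = (\<lambda>e. e \<inter> V) ` A\<rparr>"

text \<open>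
  Faces are the connected components of the complement of the drawing.  The drawing of a plane
  graph is compact, so exactly one face is unbounded: the exterior one.
\<close>

definition faces :: "complex set \<Rightarrow> complex set set \<Rightarrow> complex set set" where
  "faces V A = components (- (V \<union> \<Union>A))"

definition bounded_by_cycle ::
    "complex set \<Rightarrow> complex set set \<Rightarrow> complex set \<Rightarrow> complex list \<Rightarrow> bool" where
  "bounded_by_cycle V A F xs \<longleftrightarrow>
     is_cycle (graph_of V A) xs \<and> frontier F = \<Union>{e \<in> A. e \<inter> V \<in> cycle_edges xs}"

definition triangulated_disc :: "complex set \<Rightarrow> complex set set \<Rightarrow> bool" where
  "triangulated_disc V A \<longleftrightarrow>
     plane_graph V A \<and>
     (\<forall>F\<in>faces V A. bounded F \<longrightarrow> (\<exists>xs. length xs = 3 \<and> bounded_by_cycle V A F xs)) \<and>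
     (\<forall>F\<in>faces V A. \<not> bounded F \<longrightarrow> (\<exists>xs. bounded_by_cycle V A F xs))"

definition mop :: "complex set \<Rightarrow> complex set set \<Rightarrow> bool" where
  "mop V A \<longleftrightarrow>
     triangulated_disc V A \<and> (\<forall>F\<in>faces V A. \<not> bounded F \<longrightarrow> V \<subseteq> frontier F)"

definition num_deg2 :: "'a graph \<Rightarrow> nat" where
  "num_deg2 G = card {v \<in> verts G. degree G v = 2}"

end

theory Submission
  imports Defs "HOL-Library.Tree"
begin

text \<open>
The upper bound. Fix an edge \<open>u v\<close> of the boundary cycle of a mop. The triangle at \<open>u v\<close> has an
apex \<open>w\<close>, and the rest of the mop hangs at \<open>u w\<close> and at \<open>w v\<close>; so a mop rooted at \<open>u v\<close> is a
binary tree whose nodes are labelled by apexes (\<open>tri_edges\<close>, \<open>mop_tree\<close>). A tree with \<open>m\<close> nodes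
encodes \<open>m + 2\<close> vertices, and every cherry (a node with two leaves) contributes a vertex of
degree 2. If \<open>u\<close> is chosen to be a vertex of degree 2 as well, then \<open>n\<^sub>2\<close> is at least the number of
cherries plus one, and it suffices to find an isolating set \<open>S\<close> with
\<open>(k + 5) |S| \<le> nodes + cherries + 3\<close> (\<open>tree_isolation\<close>).

This is an induction on the tree. Take a lowest subtree with at least \<open>k + 3\<close> nodes, the pocket,
hanging at an edge \<open>y z\<close>; the two halves below its root \<open>w\<close> have at most \<open>k + 2\<close> nodes each. A
guard at \<open>w\<close> dominates \<open>y\<close>, \<open>z\<close> and the top apex of each half. So at most \<open>k + 1\<close> vertices of a half
stay undominated; they are cut off from the rest, and \<open>k + 1\<close> vertices carry no \<open>K\<^bsub>1,k+1\<^esub>\<close>. Removing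
the pocket and contracting \<open>y z\<close> leaves the tree in which the parent of the pocket is replaced by
its sibling. A guard that the induction hypothesis puts on the contracted vertex is replaced by
guards on \<open>y\<close> and \<open>z\<close>, which do the work of \<open>w\<close> too; otherwise \<open>w\<close> is added (\<open>contraction\<close>).
At least \<open>k + 4\<close> nodes and one cherry disappear, and a cherry is created only if the sibling and
the uncle of the pocket are leaves. Hence the measure drops by \<open>k + 5\<close> unless, in addition, the
pocket has exactly \<open>k + 3\<close> nodes and a single cherry. Then one half of the pocket is empty, a guard
at the end of \<open>y z\<close> next to the other half dominates the triangle above the pocket as well,
and one more vertex can be deleted (\<open>deletion\<close>, \<open>tight_step\<close>).

From the drawing to the tree. Consider a disc bounded by a chain of edges from \<open>a\<close> to \<open>b\<close> and by the
edge \<open>a b\<close>, without vertices in its interior. The face on the inner side of \<open>a b\<close> is bounded by a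
triangle \<open>a w b\<close>, and \<open>w\<close> must lie on the chain. By the theta curve theorem the edges \<open>a w\<close> and
\<open>w b\<close> cut the disc into this triangle and two smaller discs, which yield the two subtrees
(\<open>disc_tree\<close>).

Sharpness. String together at least two blocks of \<open>k + 4\<close> consecutive boundary vertices each, where
a block contains a \<open>K\<^bsub>1,k+1\<^esub>\<close> without neighbours outside the block and has exactly one vertex of
degree 2. Every block needs its own guard, whereas a block contributes \<open>k + 5\<close> to \<open>n + n\<^sub>2\<close>
(\<open>extremal_mop\<close>). The graph is drawn with straight chords between points of a parabola
(\<open>drawn_tree\<close>).
\<close>

section \<open>Triangulated polygons as binary trees\<close>

text \<open>
The tree describes the part of a triangulated polygon beyond the edge \<open>u v\<close>: a leaf is a boundary
edge, and a node is the triangle \<open>u w v\<close> together with what lies beyond its two other sides.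
\<close>

fun tri_edges :: "'a \<Rightarrow> 'a \<Rightarrow> 'a tree \<Rightarrow> 'a set set" where
  "tri_edges u v \<langle>\<rangle> = {{u, v}}"
| "tri_edges u v \<langle>l, w, r\<rangle> = insert {u, v} (tri_edges u w l \<union> tri_edges w v r)"

fun cherries :: "'a tree \<Rightarrow> nat" where
  "cherries \<langle>\<rangle> = 0"
| "cherries \<langle>l, w, r\<rangle> = (if l = \<langle>\<rangle> \<and> r = \<langle>\<rangle> then 1 else cherries l + cherries r)"

lemma root_edge: "{u, v} \<in> tri_edges u v T"
  by (cases T) auto

lemma finite_tri_edges: "finite (tri_edges u v T)"
  by (induction u v T rule: tri_edges.induct) auto

lemma tri_edges_subset: "e \<in> tri_edges u v T \<Longrightarrow> e \<subseteq> {u, v} \<union> set_tree T"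
  by (induction u v T rule: tri_edges.induct) auto

lemma tri_edges_card:
  "distinct (u # v # inorder T) \<Longrightarrow> e \<in> tri_edges u v T \<Longrightarrow> card e = 2"
  by (induction u v T rule: tri_edges.induct) (auto simp: card_insert_if)

text \<open>
Reversing the root edge mirrors the tree. This makes the arguments for a left and for a right
subtree instances of each other.
\<close>

lemma tri_edges_mirror: "tri_edges v u (mirror T) = tri_edges u v T"
  by (induction u v T rule: tri_edges.induct) (auto simp: insert_commute)

lemma tri_edges_map: "tri_edges (f u) (f v) (map_tree f T) = image f ` tri_edges u v T"
  by (induction u v T rule: tri_edges.induct) auto

lemma cherries_mirror: "cherries (mirror T) = cherries T"
  by (induction T) (auto simp: add.commute)

lemma cherries_pos: "T \<noteq> \<langle>\<rangle> \<Longrightarrow> 1 \<le> cherries T"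
proof (induction T)
  case (Node l w r)
  then show ?case by (cases "l = \<langle>\<rangle>"; cases "r = \<langle>\<rangle>") auto
qed simp

lemma card_set_tree: "distinct (inorder T) \<Longrightarrow> card (set_tree T) = size T"
  by (metis distinct_card length_inorder set_inorder)

section \<open>Guarding a pocket\<close>

definition nbhd :: "'a set set \<Rightarrow> 'a set \<Rightarrow> 'a set" where
  "nbhd E S = S \<union> {y. \<exists>x\<in>S. {x, y} \<in> E}"

text \<open>
Isolation expressed by edges alone: vertices without an edge satisfy the condition anyway, so the
vertex set need not be carried along.
\<close>

definition isolates :: "nat \<Rightarrow> 'a set set \<Rightarrow> 'a set \<Rightarrow> bool" where
  "isolates k E S \<longleftrightarrow> (\<forall>x. x \<notin> nbhd E S \<longrightarrow> card {y. {x, y} \<in> E \<and> y \<notin> nbhd E S} \<le> k)"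

lemma finite_adjacent: "finite E \<Longrightarrow> \<forall>e\<in>E. finite e \<Longrightarrow> finite {y. {x, y} \<in> E \<and> P y}"
  by (rule finite_subset[of _ "\<Union>E"]) auto

lemma few_left_over:
  assumes "finite B" "card B \<le> k + 1" "x \<in> B" "{y. {x, y} \<in> E \<and> y \<notin> N} \<subseteq> B"
    and "{x} \<notin> E"
  shows "card {y. {x, y} \<in> E \<and> y \<notin> N} \<le> k"
proof -
  have "{y. {x, y} \<in> E \<and> y \<notin> N} \<subseteq> B - {x}" using assms(4,5) by auto
  then have "card {y. {x, y} \<in> E \<and> y \<notin> N} \<le> card (B - {x})"
    using assms(1) by (intro card_mono) auto
  also have "\<dots> \<le> k" using assms(1-3) by auto
  finally show ?thesis .
qed

text \<open>
Half of a pocket, hanging at \<open>p q\<close>. As \<open>p\<close> and \<open>q\<close> are dominated, no undominated vertex outside can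
be adjacent to the half; as the top apex is dominated, at most \<open>k + 1\<close> vertices are left.
\<close>

lemma half_guarded:
  assumes dist: "distinct (p # q # inorder t)" and size: "size t \<le> k + 2"
    and E: "\<And>e. e \<in> E \<Longrightarrow> x \<in> e \<Longrightarrow> e \<in> tri_edges p q t"
    and N: "p \<in> N" "q \<in> N" "\<And>l c r. t = \<langle>l, c, r\<rangle> \<Longrightarrow> c \<in> N"
    and x: "x \<in> set_tree t" "x \<notin> N"
  shows "card {y. {x, y} \<in> E \<and> y \<notin> N} \<le> k"
proof -
  obtain l c r where t: "t = \<langle>l, c, r\<rangle>" using x by (cases t) auto
  have c: "c \<in> N" "c \<in> set_tree t" using N t by auto
  have "card (set_tree t) = size t" using dist card_set_tree by auto
  with size c(2) have "card (set_tree t - {c}) \<le> k + 1" by simp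
  moreover have "{y. {x, y} \<in> E \<and> y \<notin> N} \<subseteq> set_tree t - {c}"
  proof
    fix y assume y: "y \<in> {y. {x, y} \<in> E \<and> y \<notin> N}"
    then have "{x, y} \<in> tri_edges p q t" using E by auto
    then have "{x, y} \<subseteq> {p, q} \<union> set_tree t" using tri_edges_subset by metis
    then show "y \<in> set_tree t - {c}" using y N c by auto
  qed
  moreover have "{x} \<notin> E"
    using E[of "{x}"] tri_edges_card[OF dist, of "{x}"] by auto
  ultimately show ?thesis
    using x c by (intro few_left_over[of "set_tree t - {c}"]) auto
qed

lemma pocket_guarded:
  assumes dist: "distinct (p # q # inorder \<langle>l, w, r\<rangle>)"
    and size: "size l \<le> k + 2" "size r \<le> k + 2"
    and E: "\<And>e. e \<in> E \<Longrightarrow> e \<inter> set_tree \<langle>l, w, r\<rangle> \<noteq> {} \<Longrightarrow> e \<in> tri_edges p q \<langle>l, w, r\<rangle>"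
    and N: "p \<in> N" "q \<in> N" "w \<in> N"
      "\<And>l1 c l2. l = \<langle>l1, c, l2\<rangle> \<Longrightarrow> c \<in> N" "\<And>r1 c r2. r = \<langle>r1, c, r2\<rangle> \<Longrightarrow> c \<in> N"
    and x: "x \<in> set_tree \<langle>l, w, r\<rangle>" "x \<notin> N"
  shows "card {y. {x, y} \<in> E \<and> y \<notin> N} \<le> k"
proof -
  consider "x \<in> set_tree l" | "x \<in> set_tree r" using x N by auto
  then show ?thesis
  proof cases
    case 1
    have "e \<in> tri_edges p w l" if "e \<in> E" "x \<in> e" for e
    proof -
      have "e \<in> tri_edges p q \<langle>l, w, r\<rangle>" using E that x by blast
      moreover have "e \<noteq> {p, q}" using that 1 dist by auto
      moreover have "e \<notin> tri_edges w q r" using that 1 dist tri_edges_subset[of e w q r] by auto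
      ultimately show ?thesis by auto
    qed
    then show ?thesis using 1 dist size N x
      by (intro half_guarded[of p w l]) auto
  next
    case 2
    have "e \<in> tri_edges w q r" if "e \<in> E" "x \<in> e" for e
    proof -
      have "e \<in> tri_edges p q \<langle>l, w, r\<rangle>" using E that x by blast
      moreover have "e \<noteq> {p, q}" using that 2 dist by auto
      moreover have "e \<notin> tri_edges p w l" using that 2 dist tri_edges_subset[of e p w l] by auto
      ultimately show ?thesis by auto
    qed
    then show ?thesis using 2 dist size N x
      by (intro half_guarded[of w q r]) auto
  qed
qed

lemma side_apex_edges:
  "l = \<langle>l1, c, l2\<rangle> \<Longrightarrow> {p, c} \<in> tri_edges p q \<langle>l, w, r\<rangle> \<and> {c, w} \<in> tri_edges p q \<langle>l, w, r\<rangle>"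
  "r = \<langle>r1, c, r2\<rangle> \<Longrightarrow> {w, c} \<in> tri_edges p q \<langle>l, w, r\<rangle> \<and> {c, q} \<in> tri_edges p q \<langle>l, w, r\<rangle>"
  using root_edge[of p c l1] root_edge[of c w l2] root_edge[of w c r1] root_edge[of c q r2] by auto

lemma nbhdI: "s \<in> S \<Longrightarrow> {s, x} \<in> E \<Longrightarrow> x \<in> nbhd E S" "s \<in> S \<Longrightarrow> s \<in> nbhd E S"
  by (auto simp: nbhd_def)

lemma nbhdI': "s \<in> S \<Longrightarrow> {x, s} \<in> E \<Longrightarrow> x \<in> nbhd E S"
  by (auto simp: nbhd_def insert_commute)

lemma nbhd_mono: "E \<subseteq> E' \<Longrightarrow> S \<subseteq> S' \<Longrightarrow> nbhd E S \<subseteq> nbhd E' S'"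
  unfolding nbhd_def by blast

text \<open>
Three ways to guard a pocket: a guard on its root apex, guards on both ends of the base, or,
if one half is empty, a guard on the end of the base that belongs to the other half. In each case
the guards see the ends of the base, the root apex and the top apex of every nonempty half.
\<close>

lemma guard_apex:
  assumes dist: "distinct (p # q # inorder \<langle>l, w, r\<rangle>)"
    and size: "size l \<le> k + 2" "size r \<le> k + 2"
    and E: "E = E0 \<union> tri_edges p q \<langle>l, w, r\<rangle>" "\<Union>E0 \<inter> set_tree \<langle>l, w, r\<rangle> = {}"
    and S: "w \<in> S \<or> p \<in> S \<and> q \<in> S \<or> p \<in> S \<and> r = \<langle>\<rangle> \<or> q \<in> S \<and> l = \<langle>\<rangle>"
  shows "p \<in> nbhd E S" "q \<in> nbhd E S" "w \<in> nbhd E S"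
    and "x \<in> set_tree \<langle>l, w, r\<rangle> \<Longrightarrow> x \<notin> nbhd E S \<Longrightarrow>
           card {y. {x, y} \<in> E \<and> y \<notin> nbhd E S} \<le> k"
proof -
  let ?N = "nbhd E S"
  have e: "{p, w} \<in> E" "{w, q} \<in> E" "{p, q} \<in> E" unfolding E(1) by (auto simp: root_edge)
  show N: "p \<in> ?N" "q \<in> ?N" "w \<in> ?N"
    using S e by (auto intro: nbhdI nbhdI')
  have l: "c \<in> ?N" if "l = \<langle>l1, c, l2\<rangle>" for l1 c l2
  proof -
    have "{p, c} \<in> E \<and> {c, w} \<in> E" using side_apex_edges(1)[OF that] E by blast
    then show ?thesis using S that by (auto intro: nbhdI nbhdI')
  qed
  have r: "c \<in> ?N" if "r = \<langle>r1, c, r2\<rangle>" for r1 c r2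
  proof -
    have "{w, c} \<in> E \<and> {c, q} \<in> E" using side_apex_edges(2)[OF that] E by blast
    then show ?thesis using S that by (auto intro: nbhdI nbhdI')
  qed
  show "card {y. {x, y} \<in> E \<and> y \<notin> ?N} \<le> k" if "x \<in> set_tree \<langle>l, w, r\<rangle>" "x \<notin> ?N"
    by (rule pocket_guarded[OF dist size _ N l r that]) (use E in blast)+
qed

text \<open>
Here \<open>E0\<close> is the graph outside the pocket, and the image of \<open>E0\<close> arises by contracting the base
\<open>y z\<close> of the pocket to \<open>y\<close>. Nothing is lost by the contraction because \<open>y\<close> and \<open>z\<close> end up
dominated: the remaining vertices keep their neighbours.
\<close>

lemma contraction:
  assumes dist: "distinct (y # z # inorder \<langle>l, w, r\<rangle>)"
    and size: "size l \<le> k + 2" "size r \<le> k + 2"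
    and E: "E = E0 \<union> tri_edges y z \<langle>l, w, r\<rangle>" "\<Union>E0 \<inter> set_tree \<langle>l, w, r\<rangle> = {}"
    and fin: "finite E0" "\<And>e. e \<in> E0 \<Longrightarrow> \<exists>a b. e = {a, b}"
    and S': "isolates k (image (id(z := y)) ` E0) S'" "z \<notin> S'"
  shows "\<exists>s\<in>{z, w}. isolates k E (insert s S')"
proof -
  let ?f = "id(z := y)" and ?E' = "image (id(z := y)) ` E0"
  let ?D = "set_tree \<langle>l, w, r\<rangle>"
  \<comment> \<open>A guard on the contracted vertex stands for guards on both \<open>y\<close> and \<open>z\<close>.\<close>
  define s where "s = (if y \<in> S' then z else w)"
  let ?S = "insert s S'" and ?N = "nbhd E (insert s S')"
  have yz: "y \<noteq> z" using dist by auto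
  have "w \<in> ?S \<or> y \<in> ?S \<and> z \<in> ?S \<or> y \<in> ?S \<and> r = \<langle>\<rangle> \<or> z \<in> ?S \<and> l = \<langle>\<rangle>"
    by (auto simp: s_def)
  note g = guard_apex[OF dist size E this]
  have step: "x \<in> ?N" if ab: "{a, b} \<in> E0" "?f a \<in> S'" "x = ?f b" "x \<noteq> y" for x a b
  proof -
    have "b = x" using ab yz by (auto split: if_splits)
    moreover have "a \<in> ?S" using ab(2) by (auto simp: s_def split: if_splits)
    ultimately show ?thesis using ab E(1) by (intro nbhdI(1)[of a]) auto
  qed
  have N': "x \<in> ?N" if "x \<in> nbhd ?E' S'" for x
  proof (cases "x \<in> insert y S'")
    case True then show ?thesis using g(1) nbhdI(2)[of x ?S E] by auto
  next
    case False
    then obtain t where t: "t \<in> S'" "{t, x} \<in> ?E'" using \<open>x \<in> nbhd ?E' S'\<close> by (auto simp: nbhd_def)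
    then obtain e where e: "e \<in> E0" "?f ` e = {t, x}" by blast
    then obtain a b where ab: "e = {a, b}" using fin(2) by blast
    have "{?f a, ?f b} = ?f ` e" by (simp only: ab image_insert image_empty)
    then have "{?f a, ?f b} = {t, x}" using e(2) by (simp only:)
    then consider "?f a = t" "?f b = x" | "?f b = t" "?f a = x" by (auto simp: doubleton_eq_iff)
    then show ?thesis
      by cases (use step[of a b x] step[of b a x] e ab t False in \<open>auto simp: insert_commute\<close>)
  qed
  have "card {t. {x, t} \<in> E \<and> t \<notin> ?N} \<le> k" if x: "x \<notin> ?N" for x
  proof (cases "x \<in> ?D")
    case True then show ?thesis using g(4) x by blast
  next
    case False
    have xyz: "x \<noteq> y" "x \<noteq> z" using x g by auto
    have "{t. {x, t} \<in> E \<and> t \<notin> ?N} \<subseteq> {t. {x, t} \<in> ?E' \<and> t \<notin> nbhd ?E' S'}"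
    proof
      fix t assume t: "t \<in> {t. {x, t} \<in> E \<and> t \<notin> ?N}"
      then have "t \<noteq> y" "t \<noteq> z" using g by auto
      have "{x, t} \<notin> tri_edges y z \<langle>l, w, r\<rangle>"
        using tri_edges_subset[of "{x, t}" y z "\<langle>l, w, r\<rangle>"] False xyz by blast
      then have "{x, t} \<in> E0" using t E by auto
      then have "?f ` {x, t} \<in> ?E'" by blast
      then show "t \<in> {t. {x, t} \<in> ?E' \<and> t \<notin> nbhd ?E' S'}"
        using N' t xyz \<open>t \<noteq> y\<close> \<open>t \<noteq> z\<close> by auto
    qed
    moreover have "finite {t. {x, t} \<in> ?E' \<and> t \<notin> nbhd ?E' S'}"
      using fin by (intro finite_adjacent) auto
    moreover have "card {t. {x, t} \<in> ?E' \<and> t \<notin> nbhd ?E' S'} \<le> k"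
      using S'(1) x N' unfolding isolates_def by blast
    ultimately show ?thesis by (meson card_mono le_trans)
  qed
  then show ?thesis unfolding isolates_def s_def by (cases "y \<in> S'") auto
qed


text \<open>
The tight situation: \<open>y z x\<close> is the triangle above the pocket and \<open>b c\<close> is the uncle, where \<open>b\<close> is
an end of the edge \<open>y x\<close> at which that triangle hangs. The single guard dominates \<open>y\<close>, \<open>z\<close> and \<open>x\<close>,
hence also \<open>b\<close>; so every edge that gets lost with \<open>z\<close> and \<open>b\<close> has a dominated end.
\<close>

lemma deletion:
  assumes dist: "distinct (y # z # inorder \<langle>l, w, r\<rangle>)"
    and size: "size l \<le> k + 2" "size r \<le> k + 2" and lr: "l = \<langle>\<rangle> \<or> r = \<langle>\<rangle>"
    and E: "E = (E' \<union> {{y, x}, {z, x}, {b, c}}) \<union> tri_edges y z \<langle>l, w, r\<rangle>"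
    and disj: "\<Union>(E' \<union> {{y, x}, {z, x}, {b, c}}) \<inter> set_tree \<langle>l, w, r\<rangle> = {}"
    and b: "b \<in> {y, x}"
    and fin: "finite E'" "\<And>e. e \<in> E' \<Longrightarrow> finite e"
    and S': "isolates k E' S'"
  shows "\<exists>g\<in>{y, z}. isolates k E (insert g S')"
proof -
  let ?D = "set_tree \<langle>l, w, r\<rangle>"
  \<comment> \<open>the end of the base from which the only nonempty half of the pocket hangs\<close>
  define g where "g = (if r = \<langle>\<rangle> then y else z)"
  let ?S = "insert g S'" and ?N = "nbhd E (insert g S')"
  have "w \<in> ?S \<or> y \<in> ?S \<and> z \<in> ?S \<or> y \<in> ?S \<and> r = \<langle>\<rangle> \<or> z \<in> ?S \<and> l = \<langle>\<rangle>"
    using lr by (auto simp: g_def)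
  note g = guard_apex[OF dist size E disj this]
  have "x \<in> ?N" using E by (intro nbhdI(1)[of g]) (auto simp: g_def)
  then have bzN: "b \<in> ?N" "z \<in> ?N" using g b by auto
  have mono: "nbhd E' S' \<subseteq> ?N" by (rule nbhd_mono) (auto simp: E)
  have "card {t. {s, t} \<in> E \<and> t \<notin> ?N} \<le> k" if s: "s \<notin> ?N" for s
  proof (cases "s \<in> ?D")
    case True then show ?thesis using g(4) s by blast
  next
    case False
    have "{t. {s, t} \<in> E \<and> t \<notin> ?N} \<subseteq> {t. {s, t} \<in> E' \<and> t \<notin> nbhd E' S'}"
    proof
      fix t assume t: "t \<in> {t. {s, t} \<in> E \<and> t \<notin> ?N}"
      have "s \<notin> {y, z, b}" "t \<notin> {y, z, b}" using t s g bzN by auto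
      moreover have "{s, t} \<notin> tri_edges y z \<langle>l, w, r\<rangle>"
        using tri_edges_subset[of "{s, t}" y z "\<langle>l, w, r\<rangle>"] False \<open>s \<notin> {y, z, b}\<close> by blast
      ultimately have "{s, t} \<in> E'" using t E by (auto simp: doubleton_eq_iff)
      then show "t \<in> {t. {s, t} \<in> E' \<and> t \<notin> nbhd E' S'}" using t mono by auto
    qed
    moreover have "finite {t. {s, t} \<in> E' \<and> t \<notin> nbhd E' S'}"
      using fin by (intro finite_adjacent) auto
    moreover have "card {t. {s, t} \<in> E' \<and> t \<notin> nbhd E' S'} \<le> k"
      using S' s mono unfolding isolates_def by blast
    ultimately show ?thesis by (meson card_mono le_trans)
  qed
  then show ?thesis unfolding isolates_def g_def by (cases "r = \<langle>\<rangle>") auto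
qed

text \<open>
The final step of the induction: outside the pocket so few vertices are undominated that they
cannot carry a \<open>K\<^bsub>1,k+1\<^esub>\<close>.
\<close>

lemma one_guard:
  assumes dist: "distinct (y # z # inorder \<langle>l, w, r\<rangle>)"
    and size: "size l \<le> k + 2" "size r \<le> k + 2"
    and E: "E = E0 \<union> tri_edges y z \<langle>l, w, r\<rangle>" "\<Union>E0 \<inter> set_tree \<langle>l, w, r\<rangle> = {}"
    and s: "s = w \<or> s = y \<and> r = \<langle>\<rangle> \<or> s = z \<and> l = \<langle>\<rangle>"
    and B: "finite B" "card B \<le> k + 1" "\<Union>E0 \<subseteq> B \<union> nbhd E {s}" "\<And>t. {t} \<notin> E"
  shows "isolates k E {s}"
proof -
  let ?D = "set_tree \<langle>l, w, r\<rangle>"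
  let ?N = "nbhd E {s}"
  have "w \<in> {s} \<or> y \<in> {s} \<and> z \<in> {s} \<or> y \<in> {s} \<and> r = \<langle>\<rangle> \<or> z \<in> {s} \<and> l = \<langle>\<rangle>"
    using s by auto
  note g = guard_apex[OF dist size E this]
  have "card {t. {x, t} \<in> E \<and> t \<notin> ?N} \<le> k" if x: "x \<notin> ?N" for x
  proof (cases "x \<in> ?D")
    case True then show ?thesis using g(4) x by blast
  next
    case False
    have "x \<noteq> y" "x \<noteq> z" using x g by auto
    then have e: "{x, t} \<in> E0" if "{x, t} \<in> E" for t
      using that E tri_edges_subset[of "{x, t}" y z "\<langle>l, w, r\<rangle>"] False by auto
    show ?thesis
    proof (cases "x \<in> \<Union>E0")
      case True
      show ?thesis
        by (rule few_left_over[of B]) (use B True x e in auto)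
    next
      case False
      then have "{t. {x, t} \<in> E \<and> t \<notin> ?N} = {}" using e by auto
      then show ?thesis by (simp only: card.empty)
    qed
  qed
  then show ?thesis unfolding isolates_def by blast
qed

section \<open>The induction over pockets\<close>

text \<open>
A tree with a hole: \<open>ctx u v c p q\<close> says that filling the hole of \<open>c\<close> puts a subtree onto the edge
\<open>p q\<close> of the triangulation rooted at \<open>u v\<close>.
\<close>

inductive ctx :: "'a \<Rightarrow> 'a \<Rightarrow> ('a tree \<Rightarrow> 'a tree) \<Rightarrow> 'a \<Rightarrow> 'a \<Rightarrow> bool" where
  hole: "ctx u v (\<lambda>s. s) u v"
| in_left: "ctx u w c p q \<Longrightarrow> ctx u v (\<lambda>s. \<langle>c s, w, r\<rangle>) p q"
| in_right: "ctx w v c p q \<Longrightarrow> ctx u v (\<lambda>s. \<langle>l, w, c s\<rangle>) p q"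

text \<open>
The contribution of the surroundings of a hole: the edges \<open>X\<close>, the vertices \<open>xs\<close> and \<open>ys\<close> before and
after the hole, \<open>m\<close> nodes and \<open>d\<close> cherries. A leaf in the hole may create one more cherry.
\<close>

definition ctx_data ::
  "'a \<Rightarrow> 'a \<Rightarrow> ('a tree \<Rightarrow> 'a tree) \<Rightarrow> 'a \<Rightarrow> 'a \<Rightarrow> 'a set set \<Rightarrow> 'a list \<Rightarrow> 'a list \<Rightarrow> nat \<Rightarrow> nat \<Rightarrow> bool" where
  "ctx_data u v c p q X xs ys m d \<longleftrightarrow>
     finite X \<and> {p, q} \<union> \<Union>X \<subseteq> {u, v} \<union> set xs \<union> set ys \<and>
     (\<forall>s. tri_edges u v (c s) = X \<union> tri_edges p q s) \<and>
     (\<forall>s. inorder (c s) = xs @ inorder s @ ys) \<and>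
     (\<forall>s. size (c s) = m + size s) \<and>
     (\<forall>s. s \<noteq> \<langle>\<rangle> \<longrightarrow> cherries (c s) = d + cherries s) \<and> cherries (c \<langle>\<rangle>) \<le> d + 1"

lemma ctx_dataD:
  assumes "ctx_data u v c p q X xs ys m d"
  shows "finite X" "p \<in> {u, v} \<union> set xs \<union> set ys" "q \<in> {u, v} \<union> set xs \<union> set ys"
    "\<Union>X \<subseteq> {u, v} \<union> set xs \<union> set ys"
    "tri_edges u v (c s) = X \<union> tri_edges p q s" "inorder (c s) = xs @ inorder s @ ys"
    "size (c s) = m + size s" "s \<noteq> \<langle>\<rangle> \<Longrightarrow> cherries (c s) = d + cherries s"
    "cherries (c \<langle>\<rangle>) \<le> d + 1"
  using assms unfolding ctx_data_def by auto

lemma ctx_nonempty: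
  assumes "ctx_data u v c p q X xs ys m d" "s \<noteq> \<langle>\<rangle>"
  shows "c s \<noteq> \<langle>\<rangle>"
  using ctx_dataD(7)[OF assms(1), of s] assms(2) by (cases s) auto

lemma ctx_shape:
  "ctx u v c p q \<Longrightarrow> \<exists>X xs ys m d. ctx_data u v c p q X xs ys m d"
proof (induction rule: ctx.induct)
  case (hole u v)
  have "ctx_data u v (\<lambda>s. s) u v {} [] [] 0 0" by (simp add: ctx_data_def)
  then show ?case by blast
next
  case (in_left u w c p q v r)
  then obtain X xs ys m d where *: "ctx_data u w c p q X xs ys m d" by blast
  note D = ctx_dataD[OF *]
  have "ctx_data u v (\<lambda>s. \<langle>c s, w, r\<rangle>) p q (insert {u, v} (X \<union> tri_edges w v r)) xs
          (ys @ w # inorder r) (m + size r + 1) (d + cherries r)"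
    unfolding ctx_data_def
  proof (intro conjI allI impI)
    show "{p, q} \<union> \<Union>(insert {u, v} (X \<union> tri_edges w v r))
       \<subseteq> {u, v} \<union> set xs \<union> set (ys @ w # inorder r)"
      using D(2-4) tri_edges_subset[of _ w v r] by fastforce
  qed (use D ctx_nonempty[OF *] in \<open>auto simp: finite_tri_edges\<close>)
  then show ?case by blast
next
  case (in_right w v c p q u l)
  then obtain X xs ys m d where *: "ctx_data w v c p q X xs ys m d" by blast
  note D = ctx_dataD[OF *]
  have "ctx_data u v (\<lambda>s. \<langle>l, w, c s\<rangle>) p q (insert {u, v} (X \<union> tri_edges u w l))
          (inorder l @ w # xs) ys (m + size l + 1) (d + cherries l)"
    unfolding ctx_data_def
  proof (intro conjI allI impI)
    show "{p, q} \<union> \<Union>(insert {u, v} (X \<union> tri_edges u w l))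
       \<subseteq> {u, v} \<union> set (inorder l @ w # xs) \<union> set ys"
      using D(2-4) tri_edges_subset[of _ u w l] by fastforce
  qed (use D ctx_nonempty[OF *] in \<open>auto simp: finite_tri_edges\<close>)
  then show ?case by blast
qed

text \<open>
Induction over \<open>ctx\<close> starts at the root of the tree; the arguments about the parent and
the grandparent of a pocket need the last step down to the hole instead.
\<close>

lemma ctx_peel:
  "ctx u v c p' q' \<Longrightarrow> (c = (\<lambda>s. s) \<and> p' = u \<and> q' = v) \<or>
     (\<exists>c1 p q z t. ctx u v c1 p q \<and>
        (c = (\<lambda>s. c1 \<langle>s, z, t\<rangle>) \<and> p' = p \<and> q' = z \<or> c = (\<lambda>s. c1 \<langle>t, z, s\<rangle>) \<and> p' = z \<and> q' = q))"
proof (induction rule: ctx.induct)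
  case (in_left u w c p' q' v r)
  from in_left.IH show ?case
  proof (elim disjE exE conjE)
    assume "c = (\<lambda>s. s)" "p' = u" "q' = w"
    then show ?thesis using ctx.hole[of u v] by blast
  next
    fix c1 p q z t
    assume "ctx u w c1 p q" "c = (\<lambda>s. c1 \<langle>s, z, t\<rangle>)" "p' = p" "q' = z"
    then show ?thesis using ctx.in_left[of u w c1 p q v r] by blast
  next
    fix c1 p q z t
    assume "ctx u w c1 p q" "c = (\<lambda>s. c1 \<langle>t, z, s\<rangle>)" "p' = z" "q' = q"
    then show ?thesis using ctx.in_left[of u w c1 p q v r] by blast
  qed
next
  case (in_right w v c p' q' u l)
  from in_right.IH show ?case
  proof (elim disjE exE conjE)
    assume "c = (\<lambda>s. s)" "p' = w" "q' = v"
    then show ?thesis using ctx.hole[of u v] by blast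
  next
    fix c1 p q z t
    assume "ctx w v c1 p q" "c = (\<lambda>s. c1 \<langle>s, z, t\<rangle>)" "p' = p" "q' = z"
    then show ?thesis using ctx.in_right[of w v c1 p q u l] by blast
  next
    fix c1 p q z t
    assume "ctx w v c1 p q" "c = (\<lambda>s. c1 \<langle>t, z, s\<rangle>)" "p' = z" "q' = q"
    then show ?thesis using ctx.in_right[of w v c1 p q u l] by blast
  qed
qed auto

lemma ctx_mirror: "ctx u v c p q \<Longrightarrow> ctx v u (\<lambda>s. mirror (c (mirror s))) q p"
  by (induction rule: ctx.induct) (auto intro: ctx.intros)

text \<open>
Descend into a subtree with at least \<open>k + 3\<close> nodes as long as there is one.
\<close>

lemma ctx_find:
  "k + 3 \<le> size T \<Longrightarrow> \<exists>c p q l w r. ctx u v c p q \<and> T = c \<langle>l, w, r\<rangle> \<and>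
     size l \<le> k + 2 \<and> size r \<le> k + 2 \<and> k + 2 \<le> size l + size r"
proof (induction T arbitrary: u v)
  case (Node l w r)
  consider "k + 3 \<le> size l" | "k + 3 \<le> size r" | "size l \<le> k + 2" "size r \<le> k + 2" by linarith
  then show ?case
  proof cases
    case 1
    from Node.IH(1)[OF 1, of u w] obtain c p q l' w' r' where
      "ctx u w c p q" "l = c \<langle>l', w', r'\<rangle>" "size l' \<le> k + 2" "size r' \<le> k + 2" "k + 2 \<le> size l' + size r'"
      by blast
    with ctx.in_left[of u w c p q v r] show ?thesis by metis
  next
    case 2
    from Node.IH(2)[OF 2, of w v] obtain c p q l' w' r' where
      "ctx w v c p q" "r = c \<langle>l', w', r'\<rangle>" "size l' \<le> k + 2" "size r' \<le> k + 2" "k + 2 \<le> size l' + size r'"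
      by blast
    with ctx.in_right[of w v c p q u l] show ?thesis by metis
  next
    case 3
    then show ?thesis using Node.prems ctx.hole[of u v]
      by (intro exI[of _ "\<lambda>s. s"] exI[of _ u] exI[of _ v]) auto
  qed
qed simp

text \<open>
The measure \<open>size + cherries + 3\<close> is a lower bound for \<open>n + n\<^sub>2\<close> if the root edge starts at a vertex of
degree 2. Unlike \<open>n + n\<^sub>2\<close> itself it does not depend on the degrees of \<open>u\<close> and \<open>v\<close>, which
change when parts of the tree are removed.
\<close>

definition guardable :: "nat \<Rightarrow> 'a \<Rightarrow> 'a \<Rightarrow> 'a tree \<Rightarrow> bool" where
  "guardable k u v T \<longleftrightarrow> (\<exists>S \<subseteq> {u, v} \<union> set_tree T. isolates k (tri_edges u v T) S \<and>
     (k + 5) * card S \<le> size T + cherries T + 3)"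

lemma guardable_mirror: "guardable k v u (mirror T) \<longleftrightarrow> guardable k u v T"
  unfolding guardable_def tri_edges_mirror cherries_mirror 
  using set_inorder[of T] set_inorder[of "mirror T"] inorder_mirror[of T]
  by (simp add: insert_commute)

lemma distinct_insertion:
  assumes "distinct (u # v # xs @ (ds @ [z, z2]) @ ys) \<or> distinct (u # v # xs @ (z2 # ds @ [z]) @ ys)"
  shows "z2 \<notin> {u, v} \<union> set xs \<union> set ys \<union> set ds \<union> {z}"
    "({u, v} \<union> set xs \<union> set ys) \<inter> set ds = {}" "distinct (u # v # xs @ ys)"
  using assms by auto

text \<open>
Here \<open>T'\<close> is the tree with the grandparent of the pocket replaced by a leaf. The guard sees all
three vertices \<open>p\<close>, \<open>q\<close>, \<open>z\<close> of the triangle above the pocket, so it is enough on its own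
whenever \<open>T'\<close> has at most \<open>k\<close> nodes.
\<close>

lemma tight_step:
  assumes dist: "distinct (u # v # inorder T)" "distinct (p # z # inorder \<langle>l, w, r\<rangle>)"
    and size: "size l \<le> k + 2" "size r \<le> k + 2" and lr: "l = \<langle>\<rangle> \<or> r = \<langle>\<rangle>"
    and E: "tri_edges u v T =
      (tri_edges u v T' \<union> {{p, q}, {z, q}, {b, c}}) \<union> tri_edges p z \<langle>l, w, r\<rangle>"
    and b: "b \<in> {p, q}" and pqz: "p \<noteq> q" "p \<noteq> z" "q \<noteq> z"
    and V: "{p, q, z, c} \<union> ({u, v} \<union> set_tree T') \<subseteq> ({u, v} \<union> set_tree T) - set_tree \<langle>l, w, r\<rangle>"
    and D: "set_tree \<langle>l, w, r\<rangle> \<subseteq> set_tree T"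
    and sizes: "size T = size T' + (k + 5)" "size \<langle>l, w, r\<rangle> = k + 3"
    and cher: "cherries T' \<le> cherries T"
    and IH: "k + 1 \<le> size T' \<Longrightarrow> guardable k u v T'"
  shows "guardable k u v T"
proof -
  let ?E = "tri_edges u v T" and ?E' = "tri_edges u v T'" and ?sub = "\<langle>l, w, r\<rangle>"
  let ?R = "{{p, q}, {z, q}, {b, c}}"
  define V where "V = {u, v} \<union> set_tree T"
  define D where "D = set_tree \<langle>l, w, r\<rangle>"
  have VD: "p \<in> V - D" "q \<in> V - D" "z \<in> V - D" "c \<in> V - D" "{u, v} \<union> set_tree T' \<subseteq> V - D"
    using V dist(1) D unfolding V_def D_def by auto
  have DV: "D \<subseteq> V" using D unfolding V_def D_def by blast
  have finV: "finite V" unfolding V_def by simp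
  have cardV: "card V = size T + 2"
    using dist(1) card_set_tree[of T] unfolding V_def by (auto simp: card_insert_if)
  have cardD: "card D = k + 3" using dist(2) card_set_tree[of ?sub] sizes(2) unfolding D_def by simp
  have two: "{t} \<notin> ?E" for t using tri_edges_card[OF dist(1), of "{t}"] by auto
  have "\<Union>?R \<subseteq> V - D" using VD b by auto
  moreover have "\<Union>?E' \<subseteq> {u, v} \<union> set_tree T'"
    by (rule Union_least) (rule tri_edges_subset)
  ultimately have E'V: "\<Union>(?E' \<union> ?R) \<subseteq> V - D" using VD(5) by (simp only: Union_Un_distrib) blast
  then have E'D: "\<Union>(?E' \<union> ?R) \<inter> set_tree ?sub = {}" unfolding D_def by blast
  show ?thesis
  proof (cases "size T' \<le> k")
    case True
    define g where "g = (if r = \<langle>\<rangle> then p else z)"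
    let ?B = "V - (D \<union> {p, z, q})"
    have "p \<notin> D" "z \<notin> D" "q \<notin> D" using VD by blast+
    moreover have "p \<noteq> q" using pqz by simp
    moreover have finD: "finite D" unfolding D_def by simp
    ultimately have "card (D \<union> {p, z, q}) = card D + 3"
      using pqz by (simp add: card_insert_if)
    moreover have "D \<union> {p, z, q} \<subseteq> V" using VD(1-3) DV by blast
    ultimately have "card ?B = size T + 2 - (k + 3 + 3)"
      using finD by (subst card_Diff_subset) (simp_all add: cardV cardD)
    then have B: "card ?B \<le> k + 1" using sizes True by simp
    have "isolates k ?E {g}"
    proof (rule one_guard[OF dist(2) size E E'D])
      have "{p, z} \<in> ?E" "{p, q} \<in> ?E" "{z, q} \<in> ?E"
        unfolding E by (auto simp: root_edge)
      then have "{p, z, q} \<subseteq> nbhd ?E {g}"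
        unfolding g_def by (auto intro: nbhdI nbhdI')
      then show "\<Union>(?E' \<union> ?R) \<subseteq> ?B \<union> nbhd ?E {g}" using E'V by blast
    qed (use B two lr finV in \<open>auto simp: g_def\<close>)
    moreover have "g \<in> V" using VD(1-3) by (simp add: g_def)
    moreover have "k + 5 \<le> size T + cherries T + 3" using sizes by simp
    ultimately show ?thesis unfolding guardable_def V_def by (intro exI[of _ "{g}"]) auto
  next
    case False
    with sizes have "guardable k u v T'" by (intro IH) auto
    then obtain S2 where S2: "S2 \<subseteq> {u, v} \<union> set_tree T'" "isolates k ?E' S2"
      "(k + 5) * card S2 \<le> size T' + cherries T' + 3" unfolding guardable_def by blast
    have finS2: "finite S2" using S2(1) finite_subset by fastforce
    have "finite e" if "e \<in> ?E'" for e
      using tri_edges_subset[OF that] finite_subset by fastforce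
    with deletion[OF dist(2) size lr E E'D b finite_tri_edges _ S2(2)]
    obtain g where g: "g \<in> {p, z}" "isolates k ?E (insert g S2)" by blast
    have "card (insert g S2) \<le> card S2 + 1" by (simp add: finS2 card_insert_if)
    then have "(k + 5) * card (insert g S2) \<le> (k + 5) * card S2 + (k + 5)"
      by (metis add_mult_distrib2 mult.right_neutral mult_le_mono2)
    also have "\<dots> \<le> size T + cherries T + 3" using S2(3) sizes cher by linarith
    finally have "(k + 5) * card (insert g S2) \<le> size T + cherries T + 3" .
    moreover have "insert g S2 \<subseteq> V" using g(1) VD(1,3) S2(1) VD(5) by blast
    ultimately show ?thesis using g(2) unfolding guardable_def V_def by blast
  qed
qed

text \<open>
The pocket is the left child of its parent; mirroring covers the other case. A context
\<open>c\<close> of the parent gives the contracted tree \<open>c sib\<close>.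
\<close>

lemma pocket_step:
  assumes IH: "\<And>T'. size T' < size T \<Longrightarrow> distinct (u # v # inorder T') \<Longrightarrow> k + 1 \<le> size T' \<Longrightarrow>
      guardable k u v T'"
    and dist: "distinct (u # v # inorder T)"
    and c: "ctx u v c p q" and T: "T = c \<langle>\<langle>l, w, r\<rangle>, z, sib\<rangle>"
    and size: "size l \<le> k + 2" "size r \<le> k + 2" "k + 2 \<le> size l + size r"
  shows "guardable k u v T"
proof -
  let ?sub = "\<langle>l, w, r\<rangle>" and ?E = "tri_edges u v T"
  let ?D = "set_tree \<langle>l, w, r\<rangle>" and ?V = "{u, v} \<union> set_tree T"
  obtain X xs ys m d where data: "ctx_data u v c p q X xs ys m d" using ctx_shape[OF c] by blast
  note D = ctx_dataD[OF data]
  have cardV: "card ?V = size T + 2" using dist card_set_tree[of T] by (auto simp: card_insert_if)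
  have io: "inorder T = xs @ (inorder ?sub @ z # inorder sib) @ ys" using D(6) T by simp
  have dist_sub: "distinct (p # z # inorder \<langle>l, w, r\<rangle>)" using dist D(2) unfolding io by auto
  have Veq: "?V = {u, v, z} \<union> set xs \<union> set ys \<union> ?D \<union> set_tree sib"
    by (subst set_inorder[of T, symmetric]) (auto simp: io)
  have Ddisj: "?D \<inter> ({u, v, z} \<union> set xs \<union> set ys \<union> set_tree sib) = {}"
    using dist unfolding io by auto
  have cardD: "card ?D = size ?sub" using dist_sub card_set_tree[of ?sub] by simp
  have pq: "p \<in> ?V - ?D" "q \<in> ?V - ?D" "z \<in> ?V - ?D" "p \<noteq> z" "q \<noteq> z"
    using D(2,3) Veq Ddisj dist unfolding io by auto
  have two: "{t} \<notin> ?E" for t using tri_edges_card[OF dist, of "{t}"] by auto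
  have cherT: "cherries T = d + cherries ?sub + cherries sib" using D(8) T by simp
  have sizeT: "size T = m + size ?sub + 1 + size sib" using D(7) T by simp
  define E0 where "E0 = X \<union> {{p, q}} \<union> tri_edges z q sib"
  have E: "?E = E0 \<union> tri_edges p z ?sub" unfolding E0_def T D(5) by auto
  have E0V: "\<Union>E0 \<subseteq> ?V - ?D"
  proof -
    have "\<Union>X \<subseteq> ?V - ?D" using D(4) Ddisj unfolding Veq by blast
    moreover have "\<Union>(tri_edges z q sib) \<subseteq> {z, q} \<union> set_tree sib"
      by (rule Union_least) (rule tri_edges_subset)
    moreover have "set_tree sib \<subseteq> ?V - ?D" using Ddisj unfolding Veq by blast
    ultimately show ?thesis using pq(1-3) unfolding E0_def by auto
  qed
  then have E0D: "\<Union>E0 \<inter> ?D = {}" by blast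
  have finE0: "finite E0" unfolding E0_def using D(1) finite_tri_edges by auto
  have pair: "\<exists>a b. e = {a, b}" if "e \<in> E0" for e
    using tri_edges_card[OF dist, of e] that E by (auto simp: card_2_iff)
  show ?thesis
  proof (cases "size (c sib) \<le> k")
    case True
    let ?B = "?V - (?D \<union> {p, z})"
    have "p \<notin> ?D" "z \<notin> ?D" using pq by blast+
    then have "card (?D \<union> {p, z}) = card ?D + 2" using pq(4) by (simp add: card_insert_if)
    moreover have "?D \<union> {p, z} \<subseteq> ?V" using pq(1,3) unfolding Veq by blast
    ultimately have "card ?B = size T + 2 - (size ?sub + 2)"
      by (subst card_Diff_subset) (simp_all only: cardV cardD, simp)
    then have B: "card ?B \<le> k + 1" using sizeT True D(7)[of sib] by simp
    \<comment> \<open>All but at most \<open>k + 1\<close> vertices outside the pocket are ends of its base.\<close>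
    have "isolates k ?E {w}"
    proof (rule one_guard[OF dist_sub size(1,2) E E0D])
      have "{p, w} \<in> ?E" "{w, z} \<in> ?E" unfolding E by (auto simp: root_edge)
      then have "p \<in> nbhd ?E {w}" "z \<in> nbhd ?E {w}" by (auto intro: nbhdI nbhdI')
      then show "\<Union>E0 \<subseteq> ?B \<union> nbhd ?E {w}" using E0V by blast
    qed (use B two in auto)
    moreover have "w \<in> ?V" using Veq by auto
    moreover have "k + 5 \<le> size T + cherries T + 3" using sizeT size by simp
    ultimately show ?thesis unfolding guardable_def by (intro exI[of _ "{w}"]) auto
  next
    case False
    have "distinct (u # v # inorder (c sib))" using dist unfolding io D(6) by auto
    with False sizeT D(7)[of sib] have "guardable k u v (c sib)" by (intro IH) auto
    then obtain S' where S': "S' \<subseteq> {u, v} \<union> set_tree (c sib)" "isolates k (tri_edges u v (c sib)) S'"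
      "(k + 5) * card S' \<le> size (c sib) + cherries (c sib) + 3" unfolding guardable_def by blast
    have finS': "finite S'" using S'(1) finite_subset by fastforce
    have V': "{u, v} \<union> set_tree (c sib) = ?V - ?D - {z}"
      using dist Ddisj Veq unfolding set_inorder[symmetric] io D(6) by auto
    show ?thesis
    proof (cases "cherries (c sib) + k + 5 \<le> size ?sub + 1 + cherries T")
      case True
      have "image (id(z := p)) ` E0 = tri_edges u v (c sib)"
      proof -
        have "z \<notin> \<Union>X" using D(4) dist unfolding io by auto
        then have "id(z := p) ` e = id ` e" if "e \<in> X" for e
          using that by (intro image_cong) auto
        then have "image (id(z := p)) ` X = id ` X" by (intro image_cong) auto
        then have "image (id(z := p)) ` X = X" by simp
        moreover have "image (id(z := p)) ` tri_edges z q sib = tri_edges p q sib"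
        proof -
          have "map_tree (id(z := p)) sib = map_tree id sib"
            using dist unfolding io by (intro tree.map_cong0) auto
          then show ?thesis
            using tri_edges_map[of "id(z := p)" z q sib] pq by (simp add: tree.map_id)
        qed
        ultimately show ?thesis using pq D(5) root_edge[of p q sib] unfolding E0_def
          by (auto simp: image_Un)
      qed
      then have "\<exists>s\<in>{z, w}. isolates k ?E (insert s S')"
        using contraction[OF dist_sub size(1,2) E E0D finE0 pair] S'(1,2) V' by auto
      then obtain s where s: "s \<in> {z, w}" "isolates k ?E (insert s S')" by blast
      have "card (insert s S') \<le> card S' + 1" by (simp add: card_insert_le_m1 finS' card_insert_if)
      then have "(k + 5) * card (insert s S') \<le> (k + 5) * card S' + (k + 5)"
        by (metis add_mult_distrib2 mult.right_neutral mult_le_mono2)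
      also have "\<dots> \<le> size T + cherries T + 3" using S'(3) True sizeT D(7)[of sib] by linarith
      finally show ?thesis using s S'(1) V' Veq unfolding guardable_def
        by (intro exI[of _ "insert s S'"]) auto
    next
      \<comment> \<open>The measure drops by less than \<open>k + 5\<close>: this forces sibling and uncle to be leaves.\<close>
      case tight: False
      have sub1: "1 \<le> cherries ?sub" by (rule cherries_pos) simp
      have sib: "sib = \<langle>\<rangle>"
      proof (rule ccontr)
        assume "sib \<noteq> \<langle>\<rangle>"
        from D(8)[OF this] show False using tight cherT sub1 size by simp
      qed
      have sub2: "size ?sub = k + 3" "cherries ?sub = 1"
        using tight cherT sub1 size D(9) unfolding sib by simp_all
      have lr: "l = \<langle>\<rangle> \<or> r = \<langle>\<rangle>"
      proof (rule ccontr)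
        assume "\<not> ?thesis"
        then have "1 \<le> cherries l" "1 \<le> cherries r" "l \<noteq> \<langle>\<rangle>" by (simp_all only: cherries_pos de_Morgan_disj not_False_eq_True)
        then show False using sub2(2) by simp
      qed
      obtain c2 p2 q2 z2 t where c2: "ctx u v c2 p2 q2"
        and cases: "c = (\<lambda>s. c2 \<langle>s, z2, t\<rangle>) \<and> p = p2 \<and> q = z2 \<or>
                    c = (\<lambda>s. c2 \<langle>t, z2, s\<rangle>) \<and> p = z2 \<and> q = q2"
      proof -
        have "c \<noteq> (\<lambda>s. s)" using False sib by auto
        then show ?thesis using ctx_peel[OF c] that by blast
      qed
      obtain X2 xs2 ys2 m2 d2 where data2: "ctx_data u v c2 p2 q2 X2 xs2 ys2 m2 d2"
        using ctx_shape[OF c2] by blast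
      note D2 = ctx_dataD[OF data2]
      have t: "t = \<langle>\<rangle>"
      proof (rule ccontr)
        assume t: "t \<noteq> \<langle>\<rangle>"
        have "cherries (c sib) = d2 + cherries t" "cherries T = d2 + 1 + cherries t"
          using cases t sub2(2) unfolding T sib by (auto simp: D2(8))
        then show False using tight sub2(1) by simp
      qed
      have io2: "inorder T = xs2 @ (inorder ?sub @ [z, z2]) @ ys2 \<or>
                 inorder T = xs2 @ (z2 # inorder ?sub @ [z]) @ ys2"
        using cases unfolding T sib t by (auto simp: D2(6))
      have setT: "set_tree T = set xs2 \<union> set ys2 \<union> {z, z2} \<union> ?D"
        by (subst (1 2) set_inorder[symmetric]) (use io2 in \<open>elim disjE; simp; blast\<close>)
      have z2: "z2 \<notin> {u, v} \<union> set xs2 \<union> set ys2 \<union> ?D \<union> {z}"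
        and V2: "({u, v} \<union> set xs2 \<union> set ys2) \<inter> ?D = {}"
        and dist2: "distinct (u # v # inorder (c2 \<langle>\<rangle>))"
        using io2 dist distinct_insertion[of u v xs2 "inorder ?sub" z z2 ys2] D2(6)[of "\<langle>\<rangle>"]
        by (metis append_Nil inorder.simps(1) set_inorder)+
      have V2': "{u, v} \<union> set xs2 \<union> set ys2 \<union> {z2} \<subseteq> ?V" unfolding setT by blast
      have p2q2: "p2 \<in> ?V - ?D" "q2 \<in> ?V - ?D" "z2 \<in> ?V - ?D" "p2 \<noteq> z2" "q2 \<noteq> z2"
        using D2(2,3) z2 V2 V2' by blast+
      have V2'': "{u, v} \<union> set_tree (c2 \<langle>\<rangle>) \<subseteq> ?V - ?D"
        using V2 V2' unfolding set_inorder[symmetric] D2(6) by auto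
      have DT: "?D \<subseteq> set_tree T" unfolding set_inorder[symmetric] io by auto
      have IH2: "k + 1 \<le> size (c2 \<langle>\<rangle>) \<Longrightarrow> size (c2 \<langle>\<rangle>) < size T \<Longrightarrow> guardable k u v (c2 \<langle>\<rangle>)"
        using IH dist2 by blast
      from cases show ?thesis
      proof (elim disjE conjE)
        assume c': "c = (\<lambda>s. c2 \<langle>s, z2, t\<rangle>)" "p = p2" "q = z2"
        have T': "T = c2 \<langle>\<langle>?sub, z, \<langle>\<rangle>\<rangle>, z2, \<langle>\<rangle>\<rangle>" using T c' sib t by simp
        show ?thesis
        proof (rule tight_step[OF dist dist_sub size(1,2) lr, of "c2 \<langle>\<rangle>" q z2 q2])
          show "tri_edges u v T = tri_edges u v (c2 \<langle>\<rangle>) \<union> {{p, q}, {z, q}, {z2, q2}} \<union> tri_edges p z ?sub"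
            unfolding T' D2(5) c' by auto
          show sT: "size T = size (c2 \<langle>\<rangle>) + (k + 5)" using sub2(1) unfolding T' D2(7) by simp
          show "cherries (c2 \<langle>\<rangle>) \<le> cherries T" using sub2(2) D2(8,9) unfolding T' by simp
          show "k + 1 \<le> size (c2 \<langle>\<rangle>) \<Longrightarrow> guardable k u v (c2 \<langle>\<rangle>)" using IH2 sT by simp
        qed (use c' p2q2 pq V2'' DT sub2(1) in \<open>blast | simp\<close>)+
      next
        assume c': "c = (\<lambda>s. c2 \<langle>t, z2, s\<rangle>)" "p = z2" "q = q2"
        have T': "T = c2 \<langle>\<langle>\<rangle>, z2, \<langle>?sub, z, \<langle>\<rangle>\<rangle>\<rangle>" using T c' sib t by simp
        show ?thesis
        proof (rule tight_step[OF dist dist_sub size(1,2) lr, of "c2 \<langle>\<rangle>" q z2 p2])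
          show "tri_edges u v T = tri_edges u v (c2 \<langle>\<rangle>) \<union> {{p, q}, {z, q}, {z2, p2}} \<union> tri_edges p z ?sub"
            unfolding T' D2(5) c' by (auto simp: insert_commute)
          show sT: "size T = size (c2 \<langle>\<rangle>) + (k + 5)" using sub2(1) unfolding T' D2(7) by simp
          show "cherries (c2 \<langle>\<rangle>) \<le> cherries T" using sub2(2) D2(8,9) unfolding T' by simp
          show "k + 1 \<le> size (c2 \<langle>\<rangle>) \<Longrightarrow> guardable k u v (c2 \<langle>\<rangle>)" using IH2 sT by simp
        qed (use c' p2q2 pq V2'' DT sub2(1) in \<open>blast | simp\<close>)+
      qed
    qed
  qed
qed


theorem tree_isolation:
  "distinct (u # v # inorder T) \<Longrightarrow> k + 1 \<le> size T \<Longrightarrow> guardable k u v T"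
proof (induction "size T" arbitrary: T u v rule: less_induct)
  case less
  show ?case
  proof (cases "\<exists>l w r. T = \<langle>l, w, r\<rangle> \<and> size l \<le> k + 2 \<and> size r \<le> k + 2")
    case True
    then obtain l w r where T: "T = \<langle>l, w, r\<rangle>" and size: "size l \<le> k + 2" "size r \<le> k + 2" by blast
    have dist: "distinct (u # v # inorder \<langle>l, w, r\<rangle>)" using less.prems(1) T by simp
    have two: "{t} \<notin> tri_edges u v T" for t using tri_edges_card[OF less.prems(1), of "{t}"] by auto
    have "isolates k (tri_edges u v T) {w}"
      by (rule one_guard[OF dist size, of _ "{}" _ "{}"]) (use T two in auto)
    moreover have "k + 5 \<le> size T + cherries T + 3"
      using less.prems(2) cherries_pos[of T] T by simp
    ultimately show ?thesis unfolding guardable_def T by (intro exI[of _ "{w}"]) auto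
  next
    case False
    have "k + 3 \<le> size T"
    proof (rule ccontr)
      assume *: "\<not> k + 3 \<le> size T"
      then have "\<exists>l w r. T = \<langle>l, w, r\<rangle>" using less.prems(2) by (cases T) auto
      then show False using False * by auto
    qed
    from ctx_find[OF this, of u v] obtain c p q l w r where c: "ctx u v c p q"
      and T: "T = c \<langle>l, w, r\<rangle>" and size: "size l \<le> k + 2" "size r \<le> k + 2" "k + 2 \<le> size l + size r"
      by blast
    have "c \<noteq> (\<lambda>s. s)" using False T size by auto
    then obtain c1 p1 q1 z t where c1: "ctx u v c1 p1 q1"
        and cases: "c = (\<lambda>s. c1 \<langle>s, z, t\<rangle>) \<or> c = (\<lambda>s. c1 \<langle>t, z, s\<rangle>)"
      using ctx_peel[OF c] by blast
    from cases show ?thesis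
    proof
      assume "c = (\<lambda>s. c1 \<langle>s, z, t\<rangle>)"
      then have "T = c1 \<langle>\<langle>l, w, r\<rangle>, z, t\<rangle>" using T by simp
      from pocket_step[OF less.hyps less.prems(1) c1 this size] show ?thesis by blast
    next
      assume "c = (\<lambda>s. c1 \<langle>t, z, s\<rangle>)"
      then have m: "mirror T = mirror (c1 (mirror \<langle>\<langle>mirror r, w, mirror l\<rangle>, z, mirror t\<rangle>))"
        using T by simp
      have dist: "distinct (v # u # inorder (mirror T))"
        using less.prems(1) by (auto simp: inorder_mirror)
      have "guardable k v u (mirror T)"
        by (rule pocket_step[OF _ dist ctx_mirror[OF c1] m])
           (use less.hyps size in \<open>auto simp: add.commute\<close>)
      then show ?thesis by (simp only: guardable_mirror)
    qed
  qed
qed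

section \<open>Jordan curves in a plane drawing\<close>

text \<open>
The Jordan curve theorem in the form in which the boundaries of discs occur below: an edge and a
chain of edges with the same ends.
\<close>

lemma Jordan_two_arcs:
  fixes c1 c2 :: "real \<Rightarrow> complex"
  assumes "arc c1" "arc c2" "pathstart c1 = pathstart c2" "pathfinish c1 = pathfinish c2"
    and "path_image c1 \<inter> path_image c2 = {pathstart c1, pathfinish c1}"
    and J: "J = path_image c1 \<union> path_image c2"
  shows "open (inside J)" "connected (inside J)" "bounded (inside J)" "frontier (inside J) = J"
    "open (outside J)" "connected (outside J)" "\<not> bounded (outside J)" "frontier (outside J) = J"
    "inside J \<noteq> {}" "closed J"
proof -
  have "simple_path (c1 +++ reversepath c2)"
    using assms by (intro simple_path_join_loop) (auto simp: arc_reversepath)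
  moreover have "pathfinish (c1 +++ reversepath c2) = pathstart (c1 +++ reversepath c2)"
    using assms by simp
  moreover have "path_image (c1 +++ reversepath c2) = J"
    using assms by (simp add: path_image_join)
  ultimately have *: "inside J \<noteq> {} \<and> open (inside J) \<and> connected (inside J) \<and>
      outside J \<noteq> {} \<and> open (outside J) \<and> connected (outside J) \<and>
      bounded (inside J) \<and> \<not> bounded (outside J) \<and> inside J \<inter> outside J = {} \<and>
      inside J \<union> outside J = - J \<and> frontier (inside J) = J \<and> frontier (outside J) = J"
    using Jordan_inside_outside by metis
  then show "open (inside J)" "connected (inside J)" "bounded (inside J)" "frontier (inside J) = J"
    "open (outside J)" "connected (outside J)" "\<not> bounded (outside J)" "frontier (outside J) = J"
    "inside J \<noteq> {}" by auto
  show "closed J" using * frontier_closed by metis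
qed

text \<open>
For a Jordan curve this is the closed disc that it bounds; for a single arc it is the arc itself,
which is what makes a lone boundary edge a degenerate disc.
\<close>

definition filled :: "complex set \<Rightarrow> complex set" where
  "filled J = J \<union> inside J"

lemma connected_inside_or_outside:
  fixes S J :: "complex set"
  assumes "connected S" "S \<inter> J = {}" "closed J"
  shows "S \<subseteq> inside J \<or> S \<subseteq> outside J"
proof -
  have "S \<subseteq> inside J \<union> outside J" using assms(2) by (simp add: inside_Un_outside) blast
  with assms(1) show ?thesis
    using connectedD[OF assms(1) open_inside[OF assms(3)] open_outside[OF assms(3)]]
      inside_Int_outside[of J] by blast
qed

lemma open_subset_eqI:
  fixes F S :: "complex set"
  assumes "connected S" "F \<subseteq> S" "F \<noteq> {}" "frontier F \<inter> S = {}"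
  shows "F = S"
  using connected_Int_frontier[OF assms(1), of F] assms(2-4) by blast

text \<open>
A region with its frontier on a Jordan curve, and disjoint from it, cannot be a proper part of
either side of the curve.
\<close>

lemma face_eq_side:
  fixes F J :: "complex set"
  assumes F: "connected F" "F \<noteq> {}" "F \<inter> J = {}" "frontier F \<subseteq> J" and J: "closed J"
    and "connected (inside J)" "connected (outside J)" "bounded (inside J)" "\<not> bounded (outside J)"
  shows "F = (if bounded F then inside J else outside J)"
proof -
  have "inside J \<inter> J = {}" "outside J \<inter> J = {}" using inside_Un_outside[of J] by auto
  then have "F = inside J \<or> F = outside J"
    using connected_inside_or_outside[OF F(1,3) J] open_subset_eqI[OF assms(6) _ F(2)]
      open_subset_eqI[OF assms(7) _ F(2)] F(4) by blast
  then show ?thesis using assms(8,9) by auto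
qed

locale plane_drawing =
  fixes V :: "complex set" and A :: "complex set set"
  assumes plane: "plane_graph V A"
begin

definition adj :: "complex \<Rightarrow> complex \<Rightarrow> bool" where
  "adj u v \<longleftrightarrow> (\<exists>e\<in>A. e \<inter> V = {u, v})"

definition edge_between :: "complex \<Rightarrow> complex \<Rightarrow> complex set" where
  "edge_between u v = (THE e. e \<in> A \<and> e \<inter> V = {u, v})"

definition drawing :: "complex set" where
  "drawing = V \<union> \<Union>A"

lemma finite_V: "finite V"
  using plane by (simp add: plane_graph_def)

lemma edge_arc: "e \<in> A \<Longrightarrow> \<exists>g. arc g \<and> path_image g = e \<and> e \<inter> V = {pathstart g, pathfinish g}"
  using plane by (simp add: plane_graph_def)

lemma edges_meet: "e \<in> A \<Longrightarrow> e' \<in> A \<Longrightarrow> e \<noteq> e' \<Longrightarrow> e \<inter> e' \<subseteq> V"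
  using plane by (simp add: plane_graph_def)

lemma edge_ends_inj: "e \<in> A \<Longrightarrow> e' \<in> A \<Longrightarrow> e \<inter> V = e' \<inter> V \<Longrightarrow> e = e'"
  using plane by (auto simp: plane_graph_def)

lemma finite_A: "finite A"
proof (rule finite_imageD)
  show "finite ((\<lambda>e. e \<inter> V) ` A)" by (rule finite_subset[of _ "Pow V"]) (auto simp: finite_V)
  show "inj_on (\<lambda>e. e \<inter> V) A" by (rule inj_onI) (rule edge_ends_inj)
qed

lemma compact_edge: "e \<in> A \<Longrightarrow> compact e"
  using edge_arc[of e] compact_path_image arc_imp_path by metis

lemma closed_edge: "e \<in> A \<Longrightarrow> closed e"
  using compact_edge compact_imp_closed by blast

lemma closed_edges: "P \<subseteq> A \<Longrightarrow> closed (\<Union>P)"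
  using finite_A closed_edge finite_subset by (intro closed_Union) auto

lemma compact_drawing: "compact drawing"
  unfolding drawing_def
  by (intro compact_Un compact_Union) (auto simp: finite_V finite_A compact_edge finite_imp_compact)

lemma edge_between_eqI: "e \<in> A \<Longrightarrow> e \<inter> V = {u, v} \<Longrightarrow> edge_between u v = e"
  unfolding edge_between_def by (rule the_equality) (simp, metis edge_ends_inj)

lemma edge_between_in: "adj u v \<Longrightarrow> edge_between u v \<in> A" and edge_between_ends: "adj u v \<Longrightarrow> edge_between u v \<inter> V = {u, v}"
proof -
  assume "adj u v"
  then obtain e where e: "e \<in> A" "e \<inter> V = {u, v}" unfolding adj_def by (elim bexE)
  then show "edge_between u v \<in> A" "edge_between u v \<inter> V = {u, v}" using edge_between_eqI[OF e] by simp_all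
qed

lemma adj_commute: "adj u v \<longleftrightarrow> adj v u"
  unfolding adj_def by (simp add: insert_commute)

lemma edge_between_path:
  assumes "adj u v"
  obtains g where "arc g" "path_image g = edge_between u v" "pathstart g = u" "pathfinish g = v"
proof -
  obtain g where g: "arc g" "path_image g = edge_between u v" "{u, v} = {pathstart g, pathfinish g}"
    using edge_arc[OF edge_between_in[OF assms]] edge_between_ends[OF assms] by metis
  then consider "pathstart g = u" "pathfinish g = v" | "pathstart g = v" "pathfinish g = u"
    by (auto simp: doubleton_eq_iff)
  then show ?thesis
    by cases (use that[of g] that[of "reversepath g"] g in \<open>auto simp: arc_reversepath\<close>)
qed

lemma adj_neq: "adj u v \<Longrightarrow> u \<noteq> v"
  using edge_between_path arc_distinct_ends by metis

lemma edge_connected: "e \<in> A \<Longrightarrow> connected (e - V)"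
proof -
  assume "e \<in> A"
  then obtain g where g: "arc g" "path_image g = e" "e \<inter> V = {pathstart g, pathfinish g}"
    using edge_arc by blast
  then have "e - V = path_image g - {pathstart g, pathfinish g}" by blast
  then show ?thesis using connected_simple_path_endless[OF arc_imp_simple_path[OF g(1)]] by simp
qed

text \<open>
An arc is connected and has more than one point, so none of its points is isolated, and removing
the finitely many vertices does not change the closure. This passes statements about the inner
points of an edge on to its ends.
\<close>

lemma edge_closure: "e \<in> A \<Longrightarrow> e \<subseteq> closure (e - V)"
proof
  fix x assume e: "e \<in> A" and x: "x \<in> e"
  obtain g where g: "arc g" "path_image g = e" "e \<inter> V = {pathstart g, pathfinish g}"
    using edge_arc[OF e] by blast
  have "pathstart g \<in> e" "pathfinish g \<in> e" "pathstart g \<noteq> pathfinish g"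
    using g arc_distinct_ends[OF g(1)] pathstart_in_path_image pathfinish_in_path_image by metis+
  then have "\<nexists>a. e = {a}" by auto
  moreover have "connected e" using g(1,2) by (metis arc_imp_path connected_path_image)
  ultimately have "x islimpt e" using x connected_imp_perfect by blast
  moreover have "e = (e \<inter> V) \<union> (e - V)" by blast
  ultimately have "x islimpt (e - V)" using islimpt_Un_finite[of "e \<inter> V" x "e - V"] finite_V by auto
  then show "x \<in> closure (e - V)" by (simp add: closure_def)
qed

lemma edge_inner_point: "e \<in> A \<Longrightarrow> \<exists>p. p \<in> e - V"
proof -
  assume e: "e \<in> A"
  then have "e \<noteq> {}" using edge_arc[OF e] by auto
  then show ?thesis using edge_closure[OF e] closure_empty by (metis all_not_in_conv subset_empty)
qed

lemma edge_meets_edges: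
  assumes "e \<in> A" "P \<subseteq> A" "p \<in> e - V" "p \<in> \<Union>P" shows "e \<in> P"
proof -
  obtain e' where "e' \<in> P" "p \<in> e'" using assms(4) by blast
  then show ?thesis using edges_meet[of e e'] assms by blast
qed

text \<open>
An edge cannot leave a disc bounded by other edges: its inner part is connected and avoids them.
\<close>

lemma edge_in_filled:
  assumes e: "e \<in> A" and P: "P \<subseteq> A" and p: "p \<in> e - V" "p \<in> filled (\<Union>P)"
  shows "e \<subseteq> filled (\<Union>P)"
proof (cases "e \<in> P")
  case True
  then show ?thesis unfolding filled_def by blast
next
  case False
  then have disj: "(e - V) \<inter> \<Union>P = {}" using edge_meets_edges[OF e P] by blast
  then have "p \<in> inside (\<Union>P)" using p unfolding filled_def by blast
  then have "e - V \<subseteq> inside (\<Union>P)"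
    using connected_inside_or_outside[OF edge_connected[OF e] disj closed_edges[OF P]] p
      inside_Int_outside by blast
  then have "closure (e - V) \<subseteq> filled (\<Union>P)"
    using closure_mono closure_inside_subset[OF closed_edges[OF P]] unfolding filled_def by blast
  then show ?thesis using edge_closure[OF e] by blast
qed

fun walk :: "complex \<Rightarrow> complex list \<Rightarrow> complex \<Rightarrow> bool" where
  "walk a [] b \<longleftrightarrow> adj a b"
| "walk a (y # ys) b \<longleftrightarrow> adj a y \<and> walk y ys b"

text \<open>
The edges of the walk from \<open>a\<close> through \<open>ys\<close> to \<open>b\<close>, as a set of arcs, so that unions and
disjointness of walks can be read off from the edge sets.
\<close>

fun chain :: "complex \<Rightarrow> complex list \<Rightarrow> complex \<Rightarrow> complex set set" where
  "chain a [] b = {edge_between a b}"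
| "chain a (y # ys) b = insert (edge_between a y) (chain y ys b)"

lemma walk_append: "walk a (xs @ w # ys) b \<longleftrightarrow> walk a xs w \<and> walk w ys b"
  by (induction xs arbitrary: a) auto

lemma chain_append: "chain a (xs @ w # ys) b = chain a xs w \<union> chain w ys b"
  by (induction xs arbitrary: a) auto

lemma chain_in: "walk a ys b \<Longrightarrow> chain a ys b \<subseteq> A"
  by (induction ys arbitrary: a) (auto simp: edge_between_in)

lemma chain_verts: "walk a ys b \<Longrightarrow> \<Union>(chain a ys b) \<inter> V = {a, b} \<union> set ys"
  by (induction ys arbitrary: a) (auto simp: edge_between_ends Int_Un_distrib2)

lemma unions_meet:
  assumes "P \<subseteq> A" "Q \<subseteq> A" "P \<inter> Q = {}"
  shows "\<Union>P \<inter> \<Union>Q = (\<Union>P \<inter> V) \<inter> (\<Union>Q \<inter> V)"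
proof -
  have "\<Union>P \<inter> \<Union>Q \<subseteq> V"
  proof
    fix x assume "x \<in> \<Union>P \<inter> \<Union>Q"
    then obtain e e' where "e \<in> P" "e' \<in> Q" "x \<in> e \<inter> e'" by blast
    moreover then have "e \<noteq> e'" using assms(3) by blast
    ultimately show "x \<in> V" using edges_meet[of e e'] assms by blast
  qed
  then show ?thesis by blast
qed

lemma chain_edge_notin:
  assumes "walk a ys b" "distinct (a # ys @ [b])" "adj u v" "\<not> {u, v} \<subseteq> {a, b} \<union> set ys"
  shows "edge_between u v \<notin> chain a ys b"
  using chain_verts[OF assms(1)] edge_between_ends[OF assms(3)] assms(4) by blast

lemma chord_notin_chain:
  assumes "walk a ys b" "distinct (a # ys @ [b])" "adj a b" "ys \<noteq> []"
  shows "edge_between a b \<notin> chain a ys b"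
proof -
  obtain y ys' where ys: "ys = y # ys'" using assms(4) by (cases ys) auto
  have "edge_between a y \<inter> V \<noteq> edge_between a b \<inter> V"
    using assms ys edge_between_ends[of a y] edge_between_ends[of a b] by (auto simp: doubleton_eq_iff)
  moreover have "edge_between a b \<notin> chain y ys' b"
    using assms ys by (intro chain_edge_notin) auto
  ultimately show ?thesis using ys by auto
qed

lemma chain_arc:
  "walk a ys b \<Longrightarrow> distinct (a # ys @ [b]) \<Longrightarrow>
    \<exists>g. arc g \<and> path_image g = \<Union>(chain a ys b) \<and> pathstart g = a \<and> pathfinish g = b"
proof (induction ys arbitrary: a)
  case Nil
  then show ?case using edge_between_path[of a b] by auto
next
  case (Cons y ys)
  then have "walk y ys b" "distinct (y # ys @ [b])" by auto
  from Cons.IH[OF this] obtain g where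
    g: "arc g" "path_image g = \<Union>(chain y ys b)" "pathstart g = y" "pathfinish g = b" by blast
  obtain h where h: "arc h" "path_image h = edge_between a y" "pathstart h = a" "pathfinish h = y"
    using Cons.prems edge_between_path[of a y] by auto
  have w: "adj a y" "walk y ys b" using Cons.prems by auto
  have "edge_between a y \<notin> chain y ys b" using Cons.prems by (intro chain_edge_notin) auto
  then have "\<Union>{edge_between a y} \<inter> \<Union>(chain y ys b) = (\<Union>{edge_between a y} \<inter> V) \<inter> (\<Union>(chain y ys b) \<inter> V)"
    using w edge_between_in chain_in by (intro unions_meet) auto
  also have "\<dots> = {y}" using Cons.prems chain_verts[OF w(2)] edge_between_ends[OF w(1)] by auto
  finally have "arc (h +++ g)" using g h by (intro arc_join) auto
  moreover have "path_image (h +++ g) = \<Union>(chain a (y # ys) b)"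
    using g h by (subst path_image_join) auto
  ultimately show ?case using g h by (intro exI[of _ "h +++ g"]) auto
qed


text \<open>
The theta curve theorem for a disc whose boundary consists of a chain from \<open>a\<close> to \<open>w\<close> and of further
edges \<open>Q\<close>, cut by the edge \<open>a w\<close>. If the chain is that edge itself, the disc cut off is
degenerate and nothing happens.
\<close>

lemma split_chord:
  assumes w: "walk a ys w" "distinct (a # ys @ [w])" "adj a w"
    and Q: "Q \<subseteq> A" "arc q" "path_image q = \<Union>Q" "pathstart q = a" "pathfinish q = w"
    and disj: "chain a ys w \<inter> Q = {}" "edge_between a w \<notin> Q" "(\<Union>Q \<inter> V) \<inter> ({a, w} \<union> set ys) = {a, w}"
    and inn: "edge_between a w \<subseteq> filled (\<Union>(chain a ys w \<union> Q))"
  shows "inside (\<Union>(insert (edge_between a w) (chain a ys w))) \<subseteq> inside (\<Union>(chain a ys w \<union> Q))"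
    "inside (\<Union>(insert (edge_between a w) Q)) \<subseteq> inside (\<Union>(chain a ys w \<union> Q))"
    "filled (\<Union>(chain a ys w \<union> Q)) =
       filled (\<Union>(insert (edge_between a w) (chain a ys w))) \<union> filled (\<Union>(insert (edge_between a w) Q))"
    "inside (\<Union>(chain a ys w \<union> Q)) - edge_between a w \<subseteq>
       inside (\<Union>(insert (edge_between a w) (chain a ys w))) \<union> inside (\<Union>(insert (edge_between a w) Q))"
proof -
  let ?f = "edge_between a w" and ?C = "chain a ys w"
  let ?J = "\<Union>(?C \<union> Q)" and ?J1 = "\<Union>(insert ?f ?C)" and ?J2 = "\<Union>(insert ?f Q)"
  obtain f where f: "arc f" "path_image f = ?f" "pathstart f = a" "pathfinish f = w"
    using edge_between_path[OF w(3)] by blast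
  obtain c where c: "arc c" "path_image c = \<Union>?C" "pathstart c = a" "pathfinish c = w"
    using chain_arc[OF w(1,2)] by blast
  have "inside ?J1 \<subseteq> inside ?J \<and> inside ?J2 \<subseteq> inside ?J \<and>
        filled ?J = filled ?J1 \<union> filled ?J2 \<and> inside ?J - ?f \<subseteq> inside ?J1 \<union> inside ?J2"
  proof (cases "ys = []")
    case True
    then have "?J1 = ?f" "?J2 = ?J" by auto
    moreover have "inside ?f = {}" using inside_arc_empty[OF f(1)] f(2) by simp
    ultimately show ?thesis unfolding filled_def by auto
  next
    case False
    have C: "?C \<subseteq> A" "?f \<in> A" "?f \<notin> ?C"
      using chain_in[OF w(1)] edge_between_in[OF w(3)] chord_notin_chain[OF w False] by auto
    have V: "\<Union>?C \<inter> V = {a, w} \<union> set ys" "?f \<inter> V = {a, w}"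
      using chain_verts[OF w(1)] edge_between_ends[OF w(3)] by auto
    have QV: "a \<in> \<Union>Q \<inter> V" "w \<in> \<Union>Q \<inter> V" using disj(3) by blast+
    have i1: "\<Union>?C \<inter> \<Union>Q = {a, w}"
      using unions_meet[OF C(1) Q(1) disj(1)] V(1) disj(3) by blast
    have i2: "\<Union>?C \<inter> ?f = {a, w}"
      using unions_meet[OF C(1), of "{?f}"] C V by auto
    have i3: "\<Union>Q \<inter> ?f = {a, w}"
      using unions_meet[OF Q(1), of "{?f}"] C V(2) disj(2) QV by auto
    obtain p where p: "p \<in> ?f - V" using edge_inner_point[OF C(2)] by blast
    have "?f \<notin> ?C \<union> Q" using C(3) disj(2) by blast
    then have "p \<notin> ?J" using edge_meets_edges[OF C(2) _ p, of "?C \<union> Q"] C(1) Q(1) by blast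
    then have "p \<in> inside ?J" using inn p unfolding filled_def by blast
    then have ne: "path_image f \<inter> inside (path_image c \<union> path_image q) \<noteq> {}"
      using p f(2) c(2) Q(3) by auto
    note sp = arc_imp_simple_path
    have "inside (path_image c \<union> path_image f) \<inter> inside (path_image q \<union> path_image f) = {} \<and>
       inside (path_image c \<union> path_image f) \<union> inside (path_image q \<union> path_image f) \<union>
           (path_image f - {a, w}) = inside (path_image c \<union> path_image q)"
      by (rule split_inside_simple_closed_curve[OF sp[OF c(1)] c(3,4) sp[OF Q(2)] Q(4,5)
            sp[OF f(1)] f(3,4) adj_neq[OF w(3)]])
         (use i1 i2 i3 ne f(2) c(2) Q(3) in auto)
    moreover have "path_image c \<union> path_image f = ?J1" "path_image q \<union> path_image f = ?J2"
        "path_image c \<union> path_image q = ?J" using f c Q by auto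
    ultimately have eq: "inside ?J = inside ?J1 \<union> inside ?J2 \<union> (?f - {a, w})"
      using f(2) by simp
    have "?J1 \<union> ?J2 = ?J \<union> ?f" by auto
    moreover have "{a, w} \<subseteq> ?J" using QV by auto
    ultimately have "filled ?J = filled ?J1 \<union> filled ?J2"
      unfolding filled_def eq by blast
    then show ?thesis using eq by blast
  qed
  then show "inside ?J1 \<subseteq> inside ?J" "inside ?J2 \<subseteq> inside ?J"
    "filled ?J = filled ?J1 \<union> filled ?J2" "inside ?J - ?f \<subseteq> inside ?J1 \<union> inside ?J2" by blast+
qed

lemma face_props:
  assumes "F \<in> faces V A"
  shows "connected F" "F \<noteq> {}" "F \<inter> drawing = {}" "frontier F \<subseteq> drawing" "open F"
proof -
  have F: "F \<in> components (- drawing)" using assms by (simp add: faces_def drawing_def)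
  then show "connected F" "F \<noteq> {}" using in_components_connected in_components_nonempty by blast+
  show "F \<inter> drawing = {}" using in_components_subset[OF F] by blast
  have "closed drawing" using compact_drawing compact_imp_closed by blast
  then show "frontier F \<subseteq> drawing" "open F"
    using frontier_of_components_closed_complement[OF _ F] open_components[OF _ F] by auto
qed

text \<open>
Near an inner point \<open>p\<close> of the edge the drawing consists of this edge only. Walking from a nearby
point inside \<open>J\<close> straight towards \<open>p\<close>, the first point of the drawing lies on the edge, and the
segment up to there stays in one face.
\<close>

lemma face_beside_edge:
  assumes e: "e \<in> A" "e \<in> P" "P \<subseteq> A" "J = \<Union>P"
    and J: "frontier (inside J) = J"
  obtains F where "F \<in> faces V A" "F \<subseteq> inside J" "frontier F \<inter> (e - V) \<noteq> {}"
proof -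
  obtain p where p: "p \<in> e - V" using edge_inner_point[OF e(1)] by blast
  define U where "U = - (V \<union> \<Union>(A - {e}))"
  have "closed (V \<union> \<Union>(A - {e}))" using finite_V closed_edges[of "A - {e}"]
    by (intro closed_Un) (auto simp: finite_imp_closed)
  then have "open U" unfolding U_def by (rule open_Compl)
  moreover have "p \<in> U" using p edges_meet[OF e(1)] unfolding U_def by blast
  ultimately obtain r where r: "0 < r" "ball p r \<subseteq> U" using open_contains_ball by blast
  have "p \<in> closure (inside J)" using J p e(2,4) frontier_closures by blast
  then obtain q where q: "q \<in> inside J" "dist q p < r" using closure_approachable r(1) by blast
  have seg: "closed_segment q p \<subseteq> ball p r"
    using q(2) r(1) by (intro closed_segment_subset) (auto simp: dist_commute)
  have "q \<notin> J" using q(1) inside_no_overlap by blast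
  have qD: "q \<in> - drawing"
  proof -
    have "q \<in> U" using seg r(2) by auto
    then show ?thesis using \<open>q \<notin> J\<close> e unfolding U_def drawing_def by blast
  qed
  define F where "F = connected_component_set (- drawing) q"
  have F: "F \<in> faces V A"
    using qD unfolding F_def faces_def drawing_def components_def by blast
  note Fp = face_props[OF F]
  have qF: "q \<in> F" using qD by (simp add: F_def connected_component_refl)
  have "p \<in> drawing" using p e(1) unfolding drawing_def by blast
  then have "closed_segment q p - F \<noteq> {}" using Fp(3) by auto
  then obtain x where x: "x \<in> closed_segment q p" "x \<in> frontier F"
    using connected_Int_frontier[of "closed_segment q p" F] qF by auto
  have "x \<in> U" using x(1) seg r(2) by blast
  then have "x \<in> e - V" using x(2) Fp(4) unfolding U_def drawing_def by blast
  moreover have "F \<subseteq> inside J"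
  proof -
    have "F \<inter> J = {}" using Fp(3) e unfolding drawing_def by blast
    moreover have "closed J" using J frontier_closed by metis
    ultimately show ?thesis
      using connected_inside_or_outside[OF Fp(1)] qF q(1) inside_Int_outside by blast
  qed
  ultimately show ?thesis using that[OF F] x(2) by blast
qed

text \<open>
An edge that meets the frontier of a face in an inner point is one of the three bounding edges.
\<close>

lemma triangle_at_edge:
  assumes F: "F \<in> faces V A" and xs: "length xs = 3" "bounded_by_cycle V A F xs"
    and e: "adj a b" "frontier F \<inter> (edge_between a b - V) \<noteq> {}"
  obtains w where "adj a w" "adj w b" "w \<noteq> a" "w \<noteq> b" "frontier F = \<Union>{edge_between a b, edge_between a w, edge_between w b}"
proof -
  obtain x0 x1 x2 where xs3: "xs = [x0, x1, x2]"
    using xs(1) by (auto simp: numeral_3_eq_3 length_Suc_conv)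
  have ce: "cycle_edges xs = {{x0, x1}, {x1, x2}, {x2, x0}}"
  proof -
    have "{i. i < length xs} = {0, 1, 2}" by (auto simp: xs3)
    then have "cycle_edges xs = (\<lambda>i. {xs ! i, xs ! (Suc i mod length xs)}) ` {0, 1, 2}"
      unfolding cycle_edges_def by blast
    then show ?thesis by (simp add: xs3)
  qed
  have cyc: "distinct xs" "cycle_edges xs \<subseteq> (\<lambda>e. e \<inter> V) ` A"
    "frontier F = \<Union>{e \<in> A. e \<inter> V \<in> cycle_edges xs}"
    using xs(2) unfolding bounded_by_cycle_def is_cycle_def graph_of_def by auto
  have adjI: "adj u v" if "{u, v} \<in> cycle_edges xs" for u v
    using subsetD[OF cyc(2) that] unfolding adj_def image_iff by metis
  obtain x where x: "x \<in> frontier F" "x \<in> edge_between a b - V" using e(2) by blast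
  then obtain e' where e': "e' \<in> A" "e' \<inter> V \<in> cycle_edges xs" "x \<in> e'" using cyc(3) by blast
  then have "e' = edge_between a b" using edges_meet[OF _ edge_between_in[OF e(1)], of e'] x(2) by blast
  then have ab: "{a, b} \<in> cycle_edges xs" using e'(2) edge_between_ends[OF e(1)] by simp
  obtain w where w: "cycle_edges xs = {{a, b}, {a, w}, {w, b}}" "w \<noteq> a" "w \<noteq> b"
  proof -
    have d: "x0 \<noteq> x1" "x1 \<noteq> x2" "x2 \<noteq> x0" using cyc(1) xs3 by auto
    from ab consider "{a, b} = {x0, x1}" | "{a, b} = {x1, x2}" | "{a, b} = {x2, x0}"
      unfolding ce by blast
    then show ?thesis
    proof cases
      case 1 then show ?thesis using that[of x2] d unfolding ce
        by (auto simp: doubleton_eq_iff insert_commute)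
    next
      case 2 then show ?thesis using that[of x0] d unfolding ce
        by (auto simp: doubleton_eq_iff insert_commute)
    next
      case 3 then show ?thesis using that[of x1] d unfolding ce
        by (auto simp: doubleton_eq_iff insert_commute)
    qed
  qed
  have adj: "adj a w" "adj w b" using adjI w(1) by auto
  have "{e \<in> A. e \<inter> V \<in> cycle_edges xs} = {edge_between a b, edge_between a w, edge_between w b}"
  proof (intro equalityI subsetI)
    fix e' assume "e' \<in> {e \<in> A. e \<inter> V \<in> cycle_edges xs}"
    then have "e' \<in> A" "e' \<inter> V = {a, b} \<or> e' \<inter> V = {a, w} \<or> e' \<inter> V = {w, b}" unfolding w(1) by auto
    then show "e' \<in> {edge_between a b, edge_between a w, edge_between w b}" using edge_between_eqI[of e'] by auto
  next
    fix e' assume "e' \<in> {edge_between a b, edge_between a w, edge_between w b}"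
    then show "e' \<in> {e \<in> A. e \<inter> V \<in> cycle_edges xs}"
      unfolding w(1) using edge_between_in[OF e(1)] edge_between_ends[OF e(1)] edge_between_in[OF adj(1)] edge_between_ends[OF adj(1)]
        edge_between_in[OF adj(2)] edge_between_ends[OF adj(2)] by auto
  qed
  then show ?thesis using that[OF adj w(2,3)] cyc(3) by simp
qed


section \<open>The tree of a mop\<close>

text \<open>
The disc bounded by the chain from \<open>a\<close> to \<open>b\<close> and by the edge \<open>a b\<close>, with no vertex inside, is
triangulated by a tree that lists the vertices of the chain in order. The statement covers all edges
drawn in the disc, so the tree gives the graph exactly and not only a triangulated subgraph.
\<close>

lemma disc_tree:
  assumes tri: "\<And>F. F \<in> faces V A \<Longrightarrow> bounded F \<Longrightarrow> \<exists>xs. length xs = 3 \<and> bounded_by_cycle V A F xs"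
  shows "walk a ys b \<Longrightarrow> distinct (a # ys @ [b]) \<Longrightarrow> adj a b \<Longrightarrow>
    V \<inter> inside (\<Union>(insert (edge_between a b) (chain a ys b))) = {} \<Longrightarrow>
    \<exists>T. inorder T = ys \<and>
      tri_edges a b T = (\<lambda>e. e \<inter> V) ` {e \<in> A. e \<subseteq> filled (\<Union>(insert (edge_between a b) (chain a ys b)))}"
proof (induction ys arbitrary: a b rule: length_induct)
  case (1 ys)
  note walk = 1(2) and dist = 1(3) and ab = 1(4) and empty = 1(5)
  let ?e = "edge_between a b"
  show ?case
  proof (cases "ys = []")
    case True
    obtain g where g: "arc g" "path_image g = ?e" using edge_between_path[OF ab] by blast
    have fill: "filled (\<Union>(insert ?e (chain a ys b))) = ?e"
      using True inside_arc_empty[OF g(1)] g(2) unfolding filled_def by simp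
    have "{e \<in> A. e \<subseteq> ?e} = {?e}"
    proof (intro equalityI subsetI)
      fix e assume e: "e \<in> {e \<in> A. e \<subseteq> ?e}"
      then obtain p where "p \<in> e - V" using edge_inner_point by blast
      then have "e = ?e" using e edges_meet[of e ?e] edge_between_in[OF ab] by blast
      then show "e \<in> {?e}" by simp
    qed (use edge_between_in[OF ab] in auto)
    then have "tri_edges a b \<langle>\<rangle> = (\<lambda>e. e \<inter> V) ` {e \<in> A. e \<subseteq> ?e}" using edge_between_ends[OF ab] by simp
    then show ?thesis using True fill by (intro exI[of _ "\<langle>\<rangle>"]) simp
  next
    case False
    let ?C = "chain a ys b"
    let ?J = "\<Union>(insert ?e ?C)"
    have eA: "?e \<in> A" and CA: "?C \<subseteq> A" and eC: "?e \<notin> ?C"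
      using edge_between_in[OF ab] chain_in[OF walk] chord_notin_chain[OF walk dist ab False] by auto
    have CV: "\<Union>?C \<inter> V = {a, b} \<union> set ys" and eV: "?e \<inter> V = {a, b}"
      using chain_verts[OF walk] edge_between_ends[OF ab] by auto
    have J: "open (inside ?J)" "connected (inside ?J)" "bounded (inside ?J)" "frontier (inside ?J) = ?J"
      "closed ?J"
    proof -
      obtain c where c: "arc c" "path_image c = \<Union>?C" "pathstart c = a" "pathfinish c = b"
        using chain_arc[OF walk dist] by blast
      obtain g where g: "arc g" "path_image g = ?e" "pathstart g = a" "pathfinish g = b"
        using edge_between_path[OF ab] by blast
      have "\<Union>{?e} \<inter> \<Union>?C = (\<Union>{?e} \<inter> V) \<inter> (\<Union>?C \<inter> V)"
        by (rule unions_meet) (use eA CA eC in auto)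
      then have "path_image g \<inter> path_image c = {pathstart g, pathfinish g}"
        using CV eV c g by auto
      then show "open (inside ?J)" "connected (inside ?J)" "bounded (inside ?J)"
        "frontier (inside ?J) = ?J" "closed ?J"
        using Jordan_two_arcs[OF g(1) c(1), of ?J] c g by auto
    qed
    obtain F where F: "F \<in> faces V A" "F \<subseteq> inside ?J" "frontier F \<inter> (?e - V) \<noteq> {}"
      using face_beside_edge[OF eA _ _ refl J(4)] eA CA by blast
    note Fp = face_props[OF F(1)]
    have Fb: "bounded F" using F(2) J(3) bounded_subset by blast
    obtain w where aw: "adj a w" and wb: "adj w b" and wn: "w \<noteq> a" "w \<noteq> b"
      and fr: "frontier F = \<Union>{?e, edge_between a w, edge_between w b}"
      using tri[OF F(1) Fb] triangle_at_edge[OF F(1) _ _ ab F(3)] by metis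
    let ?f = "edge_between a w" and ?g = "edge_between w b"
    have fA: "?f \<in> A" and gA: "?g \<in> A" and fV: "?f \<inter> V = {a, w}" and gV: "?g \<inter> V = {w, b}"
      using edge_between_in edge_between_ends aw wb by auto
    have abn: "a \<noteq> b" using dist by auto
    have efg: "?e \<noteq> ?f" "?e \<noteq> ?g" "?f \<noteq> ?g"
      using eV fV gV wn abn by (auto simp: doubleton_eq_iff)
    have "closure F \<subseteq> closure (inside ?J)" using F(2) closure_mono by blast
    then have clF: "closure F \<subseteq> filled ?J"
      using closure_inside_subset[OF J(5)] unfolding filled_def by blast
    have frF: "frontier F \<subseteq> closure F" by (simp add: frontier_def)
    have "w \<in> filled ?J" using frF clF fr fV by blast
    then have "w \<in> ?J" using empty fV unfolding filled_def by blast
    then have "w \<in> set ys" using CV eV fV wn by blast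
    then obtain ys1 ys2 where ys: "ys = ys1 @ w # ys2" by (meson split_list)
    let ?C1 = "chain a ys1 w" and ?C2 = "chain w ys2 b"
    have C: "?C = ?C1 \<union> ?C2" by (simp add: ys chain_append)
    have walk1: "walk a ys1 w" and walk2: "walk w ys2 b" using walk by (auto simp: ys walk_append)
    have dist1: "distinct (a # ys1 @ [w])" and dist2: "distinct (w # ys2 @ [b])"
      using dist by (auto simp: ys)
    have C1V: "\<Union>?C1 \<inter> V = {a, w} \<union> set ys1" and C2V: "\<Union>?C2 \<inter> V = {w, b} \<union> set ys2"
      using chain_verts walk1 walk2 by auto
    have C12: "?C1 \<inter> ?C2 = {}"
    proof (rule ccontr)
      assume "?C1 \<inter> ?C2 \<noteq> {}"
      then obtain h where h: "h \<in> ?C1" "h \<in> ?C2" by blast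
      then have "h \<inter> V \<subseteq> {a, w} \<union> set ys1" "h \<inter> V \<subseteq> {w, b} \<union> set ys2"
        using C1V C2V by blast+
      moreover have "({a, w} \<union> set ys1) \<inter> ({w, b} \<union> set ys2) = {w}"
        using dist unfolding ys by auto
      ultimately have "h \<inter> V \<subseteq> {w}" by blast
      moreover have "h \<in> A" using h CA C by blast
      then obtain k where "arc k" "h \<inter> V = {pathstart k, pathfinish k}" using edge_arc by blast
      ultimately show False using arc_distinct_ends[of k] by auto
    qed
    have eC1: "?e \<notin> ?C1" and fC2: "?f \<notin> ?C2" and gC1: "?g \<notin> ?C1" and eC2: "?e \<notin> ?C2"
      using chain_edge_notin[OF walk1 dist1 ab] chain_edge_notin[OF walk2 dist2 aw]
        chain_edge_notin[OF walk1 dist1 wb] eC C dist unfolding ys by auto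
    \<comment> \<open>The chords \<open>a w\<close> and \<open>w b\<close> cut the disc one after the other; \<open>Q\<close> and \<open>P\<close> collect the
      edges on the far side of the first and of the second cut.\<close>
    let ?Q = "insert ?e ?C2"
    have J1: "\<Union>(?C1 \<union> ?Q) = ?J" using C by auto
    obtain q where q: "arc q" "path_image q = \<Union>?Q" "pathstart q = a" "pathfinish q = w"
    proof -
      obtain c where c: "arc c" "path_image c = \<Union>?C2" "pathstart c = w" "pathfinish c = b"
        using chain_arc[OF walk2 dist2] by blast
      obtain g where g: "arc g" "path_image g = ?e" "pathstart g = a" "pathfinish g = b"
        using edge_between_path[OF ab] by blast
      have "\<Union>{?e} \<inter> \<Union>?C2 = (\<Union>{?e} \<inter> V) \<inter> (\<Union>?C2 \<inter> V)"
        by (rule unions_meet) (use eA CA C eC2 in auto)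
      also have "\<dots> = {b}" using eV C2V dist unfolding ys by auto
      finally have "arc (g +++ reversepath c)"
        using c g by (intro arc_join) (auto simp: arc_reversepath)
      moreover have "path_image (g +++ reversepath c) = \<Union>?Q"
        using c g by (subst path_image_join) auto
      ultimately show ?thesis using that[of "g +++ reversepath c"] c g by simp
    qed
    have QV: "\<Union>?Q \<inter> V = {a, w, b} \<union> set ys2" using eV C2V by auto
    have inn1: "?f \<subseteq> filled (\<Union>(?C1 \<union> ?Q))" unfolding J1 using fr frF clF by blast
    have Q1: "?Q \<subseteq> A" using eA CA C by blast
    have Q2: "?C1 \<inter> ?Q = {}" using C12 eC1 by blast
    have Q3: "?f \<notin> ?Q" using efg fC2 by blast
    have Q4: "(\<Union>?Q \<inter> V) \<inter> ({a, w} \<union> set ys1) = {a, w}" using QV dist unfolding ys by auto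
    note cut1 = split_chord[OF walk1 dist1 aw Q1 q Q2 Q3 Q4 inn1, unfolded J1]
    let ?J' = "\<Union>(insert ?f ?Q)"
    have closed1: "closed (\<Union>(insert ?f ?C1))" and closed2: "closed ?J'"
      by (rule closed_edges, use fA eA CA C in blast)+
    \<comment> \<open>The face lies on the side of \<open>a w\<close> that still has \<open>a b\<close> on its boundary.\<close>
    have FJ': "F \<subseteq> inside ?J'"
    proof -
      have F1: "F \<inter> \<Union>(insert ?f ?C1) = {}" using Fp(3) fA CA C unfolding drawing_def by blast
      have "\<not> F \<subseteq> inside (\<Union>(insert ?f ?C1))"
      proof
        assume "F \<subseteq> inside (\<Union>(insert ?f ?C1))"
        then have "closure F \<subseteq> filled (\<Union>(insert ?f ?C1))"
          using closure_mono closure_inside_subset[OF closed1] unfolding filled_def by blast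
        then have e1: "?e \<subseteq> filled (\<Union>(insert ?f ?C1))" using fr frF by blast
        obtain p where p: "p \<in> ?e - V" using edge_inner_point[OF eA] by blast
        have "p \<notin> inside ?J" using p inside_no_overlap[of ?J] by blast
        then have "p \<in> \<Union>(insert ?f ?C1)" using e1 p cut1(1) unfolding filled_def by blast
        then have "?e \<in> insert ?f ?C1"
          using edge_meets_edges[OF eA _ p] fA CA C by blast
        then show False using efg eC1 by blast
      qed
      then have "F \<subseteq> outside (\<Union>(insert ?f ?C1))"
        using connected_inside_or_outside[OF Fp(1) F1 closed1] by blast
      then have "F \<inter> inside (\<Union>(insert ?f ?C1)) = {}" using inside_Int_outside by blast
      moreover have "F \<subseteq> inside ?J - ?f" using F(2) Fp(3) fA unfolding drawing_def by blast
      ultimately show ?thesis using cut1(4) by blast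
    qed
    let ?P = "{?e, ?f}"
    have J2: "\<Union>(?C2 \<union> ?P) = ?J'" by auto
    obtain r where r: "arc r" "path_image r = \<Union>?P" "pathstart r = w" "pathfinish r = b"
    proof -
      obtain h where h: "arc h" "path_image h = ?f" "pathstart h = a" "pathfinish h = w"
        using edge_between_path[OF aw] by blast
      obtain g where g: "arc g" "path_image g = ?e" "pathstart g = a" "pathfinish g = b"
        using edge_between_path[OF ab] by blast
      have "?f \<inter> ?e \<subseteq> {a}" using edges_meet[OF fA eA] efg fV eV wn by blast
      then have "arc (reversepath h +++ g)"
        using h g by (intro arc_join) (auto simp: arc_reversepath)
      moreover have "path_image (reversepath h +++ g) = \<Union>?P"
        using h g by (subst path_image_join) auto
      ultimately show ?thesis using that[of "reversepath h +++ g"] h g by simp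
    qed
    have PV: "\<Union>?P \<inter> V = {a, w, b}" using eV fV by auto
    have inn2: "?g \<subseteq> filled (\<Union>(?C2 \<union> ?P))"
    proof -
      have "closure F \<subseteq> closure (inside ?J')" by (rule closure_mono[OF FJ'])
      also have "\<dots> \<subseteq> filled ?J'" using closure_inside_subset[OF closed2] unfolding filled_def .
      finally have "closure F \<subseteq> filled ?J'" .
      moreover have "?g \<subseteq> closure F" using fr frF by auto
      ultimately show ?thesis unfolding J2 by (rule order_trans[rotated])
    qed
    have P1: "?P \<subseteq> A" using eA fA by blast
    have P2: "?C2 \<inter> ?P = {}" using eC2 fC2 by blast
    have P3: "?g \<notin> ?P" using efg by blast
    have P4: "(\<Union>?P \<inter> V) \<inter> ({w, b} \<union> set ys2) = {w, b}" using PV dist unfolding ys by auto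
    note cut2 = split_chord[OF walk2 dist2 wb P1 r P2 P3 P4 inn2, unfolded J2]
    let ?K = "\<Union>(insert ?g ?P)"
    have K: "F = inside ?K"
    proof -
      obtain g where g: "arc g" "path_image g = ?g" "pathstart g = w" "pathfinish g = b"
        using edge_between_path[OF wb] by blast
      have "\<Union>{?g} \<inter> \<Union>?P = (\<Union>{?g} \<inter> V) \<inter> (\<Union>?P \<inter> V)"
        by (rule unions_meet) (use eA fA gA efg in auto)
      then have "path_image g \<inter> path_image r = {pathstart g, pathfinish g}"
        using PV gV r g by auto
      note Kp = Jordan_two_arcs[OF g(1) r(1) _ _ this, of ?K]
      have KF: "?K = frontier F" unfolding fr by blast
      have "F \<inter> ?K = {}" using Fp(3,4) unfolding KF by blast
      then show ?thesis
        using face_eq_side[OF Fp(1,2), of ?K] Kp Fb KF g r by auto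
    qed
    have len: "length ys1 < length ys" "length ys2 < length ys" using ys by simp_all
    have emp: "V \<inter> inside (\<Union>(insert ?f ?C1)) = {}" "V \<inter> inside (\<Union>(insert ?g ?C2)) = {}"
      using cut1(1,2) cut2(1) empty by blast+
    obtain T1 where T1: "inorder T1 = ys1"
      "tri_edges a w T1 = (\<lambda>e. e \<inter> V) ` {e \<in> A. e \<subseteq> filled (\<Union>(insert ?f ?C1))}"
      using 1(1)[rule_format, OF len(1) walk1 dist1 aw emp(1)] by (elim exE conjE)
    obtain T2 where T2: "inorder T2 = ys2"
      "tri_edges w b T2 = (\<lambda>e. e \<inter> V) ` {e \<in> A. e \<subseteq> filled (\<Union>(insert ?g ?C2))}"
      using 1(1)[rule_format, OF len(2) walk2 dist2 wb emp(2)] by (elim exE conjE)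
    have fill: "filled ?J = filled (\<Union>(insert ?f ?C1)) \<union> filled (\<Union>(insert ?g ?C2)) \<union> filled ?K"
      using cut1(3) cut2(3) by blast
    have "{e \<in> A. e \<subseteq> filled ?J} = insert ?e ({e \<in> A. e \<subseteq> filled (\<Union>(insert ?f ?C1))} \<union>
            {e \<in> A. e \<subseteq> filled (\<Union>(insert ?g ?C2))})" (is "?L = ?R")
    proof (intro equalityI subsetI)
      fix h assume h: "h \<in> ?L"
      then obtain p where p: "p \<in> h - V" using edge_inner_point by blast
      have hA: "h \<in> A" using h by blast
      consider "p \<in> filled (\<Union>(insert ?f ?C1))" | "p \<in> filled (\<Union>(insert ?g ?C2))" | "p \<in> filled ?K"
        using h p fill by blast
      then show "h \<in> ?R"
      proof cases
        case 1
        then have "h \<subseteq> filled (\<Union>(insert ?f ?C1))"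
          using edge_in_filled[OF hA _ p] fA CA C by blast
        then show ?thesis using hA by blast
      next
        case 2
        then have "h \<subseteq> filled (\<Union>(insert ?g ?C2))"
          using edge_in_filled[OF hA _ p] gA CA C by blast
        then show ?thesis using hA by blast
      next
        case 3
        have "p \<notin> F" using p hA Fp(3) unfolding drawing_def by blast
        then have "p \<in> ?K" using 3 K unfolding filled_def by blast
        then have "h \<in> insert ?g ?P" using edge_meets_edges[OF hA _ p] gA fA eA by blast
        moreover have "?f \<subseteq> filled (\<Union>(insert ?f ?C1))" "?g \<subseteq> filled (\<Union>(insert ?g ?C2))"
          unfolding filled_def by blast+
        ultimately show ?thesis using hA by blast
      qed
    next
      fix h assume "h \<in> ?R"
      moreover have "?e \<subseteq> filled ?J" unfolding filled_def by blast
      ultimately show "h \<in> ?L" using eA fill by blast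
    qed
    then have "tri_edges a b \<langle>T1, w, T2\<rangle> = (\<lambda>e. e \<inter> V) ` ?L"
      using T1(2) T2(2) eV by (simp add: image_Un)
    moreover have "inorder \<langle>T1, w, T2\<rangle> = ys" using T1(1) T2(1) ys by simp
    ultimately show ?thesis by blast
  qed
qed


lemma unbounded_face: "\<exists>F\<in>faces V A. \<not> bounded F"
  using cobounded_unbounded_components[of "- drawing"] compact_imp_bounded[OF compact_drawing]
  unfolding faces_def drawing_def by auto

fun path_pairs :: "complex \<Rightarrow> complex list \<Rightarrow> complex \<Rightarrow> complex set set" where
  "path_pairs a [] b = {{a, b}}"
| "path_pairs a (y # ys) b = insert {a, y} (path_pairs y ys b)"

text \<open>
\<open>cycle_edges\<close> is defined by list positions, whereas walks are recursive; \<open>path_pairs\<close> mediates.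
\<close>

lemma path_pairs_nth:
  "path_pairs a ys b = (\<lambda>i. {(a # ys @ [b]) ! i, (a # ys @ [b]) ! Suc i}) ` {..length ys}"
proof (induction ys arbitrary: a)
  case (Cons y ys)
  show ?case
    by (simp add: Cons.IH atMost_Suc_eq_insert_0 image_image)
qed simp

lemma cycle_edges_Cons: "cycle_edges (a # ys @ [b]) = insert {b, a} (path_pairs a ys b)"
proof -
  let ?zs = "a # ys @ [b]"
  have "{i. i < length ?zs} = insert (Suc (length ys)) {..length ys}" by auto
  then have "cycle_edges ?zs =
      (\<lambda>i. {?zs ! i, ?zs ! (Suc i mod length ?zs)}) ` insert (Suc (length ys)) {..length ys}"
    unfolding cycle_edges_def by (simp only: image_Collect[symmetric] setcompr_eq_image)
  also have "\<dots> = insert {b, a} ((\<lambda>i. {?zs ! i, ?zs ! (Suc i mod length ?zs)}) ` {..length ys})"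
    by (simp add: nth_append)
  also have "(\<lambda>i. {?zs ! i, ?zs ! (Suc i mod length ?zs)}) ` {..length ys} =
             (\<lambda>i. {?zs ! i, ?zs ! Suc i}) ` {..length ys}"
    by (intro image_cong) auto
  finally show ?thesis by (simp only: path_pairs_nth)
qed

lemma cycle_edges_rotate:
  fixes xs :: "complex list"
  shows "cycle_edges (rotate m xs) = cycle_edges xs"
proof (induction m)
  case (Suc m)
  have "cycle_edges (rotate1 zs) = cycle_edges zs" for zs :: "complex list"
  proof (cases zs)
    case (Cons a zs')
    show ?thesis
    proof (cases zs' rule: rev_cases)
      case (snoc zs2 b)
      show ?thesis
      proof (cases zs2)
        case Nil
        then show ?thesis using Cons snoc cycle_edges_Cons[of a "[]" b] cycle_edges_Cons[of b "[]" a]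
          by auto
      next
        case (Cons y zs3)
        have 1: "path_pairs y (zs3 @ [b]) a = insert {b, a} (path_pairs y zs3 b)"
          by (induction zs3 arbitrary: y) auto
        show ?thesis
          using \<open>zs = a # zs'\<close> snoc Cons cycle_edges_Cons[of a "y # zs3" b]
            cycle_edges_Cons[of y "zs3 @ [b]" a] 1 by (auto simp: insert_commute)
      qed
    qed (use Cons in simp)
  qed simp
  then show ?case using Suc by (simp add: rotate_def)
qed (simp add: rotate_def)

lemma adj_iff: "adj u v \<longleftrightarrow> {u, v} \<in> (\<lambda>e. e \<inter> V) ` A"
  unfolding adj_def image_iff by metis

lemma walk_iff: "walk a ys b \<longleftrightarrow> path_pairs a ys b \<subseteq> (\<lambda>e. e \<inter> V) ` A"
  by (induction ys arbitrary: a) (simp_all add: adj_iff)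

lemma edges_with_ends: "adj u v \<Longrightarrow> {e \<in> A. e \<inter> V = {u, v}} = {edge_between u v}"
  using edge_between_in edge_between_ends edge_between_eqI by (intro equalityI subsetI) (simp_all, metis)

lemma chain_eq: "walk a ys b \<Longrightarrow> chain a ys b = {e \<in> A. e \<inter> V \<in> path_pairs a ys b}"
proof (induction ys arbitrary: a)
  case Nil
  then show ?case using edges_with_ends[of a b] by simp
next
  case (Cons y ys)
  have "{e \<in> A. e \<inter> V \<in> path_pairs a (y # ys) b} =
      {e \<in> A. e \<inter> V = {a, y}} \<union> {e \<in> A. e \<inter> V \<in> path_pairs y ys b}"
    by auto
  then show ?case using Cons edges_with_ends[of a y] by simp
qed

text \<open>
The outer face is the outside of the Hamiltonian boundary cycle, so all edges are drawn in the disc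
that the cycle bounds. Rotating the cycle makes any vertex \<open>x\<close> an end of the root edge.
\<close>

lemma mop_tree:
  assumes mop: "mop V A" and x: "x \<in> V"
  shows "\<exists>b T. distinct (x # b # inorder T) \<and> V = {x, b} \<union> set_tree T \<and> T \<noteq> \<langle>\<rangle> \<and>
           tri_edges x b T = edges (graph_of V A)"
proof -
  have tri: "\<exists>xs. length xs = 3 \<and> bounded_by_cycle V A F xs" if "F \<in> faces V A" "bounded F" for F
    using mop that unfolding mop_def triangulated_disc_def by blast
  obtain F where F: "F \<in> faces V A" "\<not> bounded F" using unbounded_face by blast
  have "\<forall>F\<in>faces V A. \<not> bounded F \<longrightarrow> (\<exists>xs. bounded_by_cycle V A F xs)"
    "\<forall>F\<in>faces V A. \<not> bounded F \<longrightarrow> V \<subseteq> frontier F"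
    using mop by (simp_all add: mop_def triangulated_disc_def)
  then obtain xs where xs: "bounded_by_cycle V A F xs" and VF: "V \<subseteq> frontier F"
    using F by metis
  have xs': "3 \<le> length xs" "distinct xs" "set xs \<subseteq> V" "cycle_edges xs \<subseteq> (\<lambda>e. e \<inter> V) ` A"
    and fr: "frontier F = \<Union>{e \<in> A. e \<inter> V \<in> cycle_edges xs}"
    using xs unfolding bounded_by_cycle_def is_cycle_def graph_of_def by auto
  have "V \<subseteq> \<Union>(cycle_edges xs)" using VF fr by blast
  also have "\<dots> \<subseteq> set xs" unfolding cycle_edges_def using xs'(1)
    by (auto intro!: nth_mem mod_less_divisor)
  finally have setxs: "set xs = V" using xs'(3) by blast
  obtain us vs where "xs = us @ x # vs" using x setxs by (metis split_list)
  then have rot: "rotate (length us) xs = x # vs @ us" by (simp add: rotate_append)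
  have "length (vs @ us) \<ge> 2" using rot xs'(1) by (metis Suc_le_mono eval_nat_numeral(3) length_Cons length_rotate numeral_2_eq_2)
  moreover obtain ys b where ysb: "vs @ us = ys @ [b]"
    using calculation by (cases "vs @ us" rule: rev_cases) auto
  ultimately have yb: "vs @ us = ys @ [b]" "ys \<noteq> []" by auto
  let ?zs = "x # ys @ [b]"
  have zs: "rotate (length us) xs = ?zs" using rot yb by simp
  have dist: "distinct ?zs" and setV: "set ?zs = V" and ce: "cycle_edges ?zs = cycle_edges xs"
    using xs'(2) setxs cycle_edges_rotate[of "length us" xs]
    by (simp_all only: zs[symmetric] distinct_rotate set_rotate)
  have pp: "insert {b, x} (path_pairs x ys b) = cycle_edges xs"
    using ce cycle_edges_Cons by simp
  have walk: "walk x ys b" unfolding walk_iff using pp xs'(4) by blast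
  have xb: "adj x b" using pp xs'(4) adj_iff[of b x] adj_commute by auto
  let ?J = "\<Union>(insert (edge_between x b) (chain x ys b))"
  have J: "?J = frontier F"
  proof -
    have "{e \<in> A. e \<inter> V = {b, x}} = {edge_between x b}"
      using edges_with_ends[OF xb] by (simp add: insert_commute)
    moreover have "{e \<in> A. e \<inter> V \<in> cycle_edges xs} =
        {e \<in> A. e \<inter> V = {b, x}} \<union> {e \<in> A. e \<inter> V \<in> path_pairs x ys b}"
      unfolding pp[symmetric] by auto
    ultimately have "{e \<in> A. e \<inter> V \<in> cycle_edges xs} = insert (edge_between x b) (chain x ys b)"
      unfolding chain_eq[OF walk] by simp
    then show ?thesis using fr by simp
  qed
  note Fp = face_props[OF F(1)]
  have out: "F = outside ?J"
  proof -
    obtain c where c: "arc c" "path_image c = \<Union>(chain x ys b)" "pathstart c = x" "pathfinish c = b"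
      using chain_arc[OF walk dist] by blast
    obtain g where g: "arc g" "path_image g = edge_between x b" "pathstart g = x" "pathfinish g = b"
      using edge_between_path[OF xb] by blast
    have "\<Union>{edge_between x b} \<inter> \<Union>(chain x ys b) = (\<Union>{edge_between x b} \<inter> V) \<inter> (\<Union>(chain x ys b) \<inter> V)"
      by (rule unions_meet)
        (use edge_between_in[OF xb] chain_in[OF walk] chord_notin_chain[OF walk dist xb yb(2)] in auto)
    then have "path_image g \<inter> path_image c = {pathstart g, pathfinish g}"
      using chain_verts[OF walk] edge_between_ends[OF xb] c g by auto
    note Jp = Jordan_two_arcs[OF g(1) c(1) _ _ this, of ?J]
    have "F \<inter> ?J = {}" using Fp(3,4) unfolding J by blast
    then show ?thesis
      using face_eq_side[OF Fp(1,2), of ?J] Jp F(2) J g c by auto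
  qed
  have filled: "filled ?J = - F" unfolding out filled_def by (rule union_with_inside)
  have "V \<inter> inside ?J = {}" using VF inside_no_overlap[of ?J] unfolding J by blast
  then obtain T where T: "inorder T = ys"
    "tri_edges x b T = (\<lambda>e. e \<inter> V) ` {e \<in> A. e \<subseteq> filled ?J}"
    using disc_tree[OF tri walk dist xb] by blast
  have "{e \<in> A. e \<subseteq> filled ?J} = A" using Fp(3) unfolding filled drawing_def by blast
  then have "tri_edges x b T = edges (graph_of V A)" using T(2) unfolding graph_of_def by simp
  moreover have "distinct (x # b # inorder T)" using dist T(1) by auto
  moreover have "V = {x, b} \<union> set_tree T" using setV T(1) set_inorder[of T] by auto
  moreover have "T \<noteq> \<langle>\<rangle>" using T(1) yb(2) by auto
  ultimately show ?thesis by blast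
qed

end

section \<open>The upper bound for mops\<close>

fun cherry_apices :: "'a tree \<Rightarrow> 'a set" where
  "cherry_apices \<langle>\<rangle> = {}"
| "cherry_apices \<langle>l, w, r\<rangle> =
    (if l = \<langle>\<rangle> \<and> r = \<langle>\<rangle> then {w} else cherry_apices l \<union> cherry_apices r)"

lemma cherry_apices_subset: "cherry_apices T \<subseteq> set_tree T"
  by (induction T) auto

lemma finite_cherry_apices: "finite (cherry_apices T)"
  by (induction T) auto

lemma card_cherry_apices: "distinct (inorder T) \<Longrightarrow> card (cherry_apices T) = cherries T"
proof (induction T)
  case (Node l w r)
  have "cherry_apices l \<inter> cherry_apices r = {}"
    using Node.prems cherry_apices_subset[of l] cherry_apices_subset[of r] by auto
  then have "card (cherry_apices l \<union> cherry_apices r) = card (cherry_apices l) + card (cherry_apices r)"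
    by (intro card_Un_disjoint finite_cherry_apices)
  then show ?case using Node by auto
qed simp

lemma cherry_apex_neighbours:
  "distinct (u # v # inorder T) \<Longrightarrow> x \<in> cherry_apices T \<Longrightarrow>
    \<exists>a b. a \<noteq> b \<and> {y. {y, x} \<in> tri_edges u v T} = {a, b}"
proof (induction u v T rule: tri_edges.induct)
  case (2 u v l w r)
  show ?case
  proof (cases "l = \<langle>\<rangle> \<and> r = \<langle>\<rangle>")
    case True
    then have "x = w" using 2(4) by simp
    then have "{y. {y, x} \<in> tri_edges u v \<langle>l, w, r\<rangle>} = {u, v}"
      using True 2(3) by (auto simp: doubleton_eq_iff)
    then show ?thesis using 2(3) by (intro exI[of _ u] exI[of _ v]) simp
  next
    case False
    then consider "x \<in> cherry_apices l" | "x \<in> cherry_apices r" using 2(4) by auto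
    then show ?thesis
    proof cases
      case 1
      then have x: "x \<in> set_tree l" using cherry_apices_subset by (rule subsetD[rotated])
      then have "x \<notin> {u, v}" "x \<notin> {w, v} \<union> set_tree r" using 2(3) by auto
      then have "{y. {y, x} \<in> tri_edges u v \<langle>l, w, r\<rangle>} = {y. {y, x} \<in> tri_edges u w l}"
        using tri_edges_subset[of _ w v r] by (auto simp: doubleton_eq_iff)
      moreover have "distinct (u # w # inorder l)" using "2.prems"(1) by auto
      ultimately show ?thesis using "2.IH"(1)[OF _ 1] by simp
    next
      case 2
      then have x: "x \<in> set_tree r" using cherry_apices_subset by (rule subsetD[rotated])
      then have "x \<notin> {u, v}" "x \<notin> {u, w} \<union> set_tree l" using "2.prems"(1) by auto
      then have "{y. {y, x} \<in> tri_edges u v \<langle>l, w, r\<rangle>} = {y. {y, x} \<in> tri_edges w v r}"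
        using tri_edges_subset[of _ u w l] by (auto simp: doubleton_eq_iff)
      moreover have "distinct (w # v # inorder r)" using "2.prems"(1) by auto
      ultimately show ?thesis using "2.IH"(2)[OF _ 2] by simp
    qed
  qed
qed simp

lemma star_copyD:
  assumes "contains_copy (delete_verts G X) (star m)"
  shows "\<exists>x Y. x \<in> verts G - X \<and> Y \<subseteq> verts G - X \<and> card Y = m \<and> (\<forall>y\<in>Y. {x, y} \<in> edges G)"
proof -
  obtain f where f: "inj_on f {0..m}" "f ` {0..m} \<subseteq> verts G - X"
    "\<forall>e\<in>edges (star m). f ` e \<in> edges (delete_verts G X)"
    using assms unfolding contains_copy_def star_def delete_verts_def by auto
  have "{f 0, f i} \<in> edges G" if "i \<in> {1..m}" for i
  proof -
    have "{0, i} \<in> edges (star m)" using that unfolding star_def by auto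
    then have "f ` {0, i} \<in> edges (delete_verts G X)" using f(3) by blast
    then show ?thesis unfolding delete_verts_def by simp
  qed
  moreover have "card (f ` {1..m}) = m"
    using card_image[OF inj_on_subset[OF f(1)], of "{1..m}"] by simp
  moreover have "f i \<in> verts G - X" if "i \<in> {0..m}" for i using f(2) that by blast
  then have "f 0 \<in> verts G - X" "f ` {1..m} \<subseteq> verts G - X" by auto
  ultimately show ?thesis by (intro exI[of _ "f 0"] exI[of _ "f ` {1..m}"]) auto
qed

lemma star_copyI:
  assumes "x \<in> verts G - X" "Y \<subseteq> verts G - X" "finite Y" "card Y = m" "x \<notin> Y"
    and "\<And>y. y \<in> Y \<Longrightarrow> {x, y} \<in> edges G"
  shows "contains_copy (delete_verts G X) (star m)"
proof -
  obtain g where g: "bij_betw g {1..m} Y"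
    using assms(3,4) finite_same_card_bij[of "{1..m}" Y] by auto
  define f where "f i = (if i = 0 then x else g i)" for i
  have fi: "f i \<in> Y" "f i = g i" if "i \<in> {1..m}" for i
    using that g unfolding f_def bij_betw_def by auto
  have m0: "{0..m} = insert 0 {1..m}" by (rule set_eqI) auto
  moreover have "inj_on f {1..m} \<longleftrightarrow> inj_on g {1..m}" by (rule inj_on_cong) (use fi in auto)
  then have "inj_on f {1..m}" using g bij_betw_imp_inj_on by blast
  moreover have "f 0 \<notin> f ` {1..m}" using fi(1) assms(5) unfolding f_def[of 0] by auto
  ultimately have "inj_on f {0..m}" by simp
  moreover have "f ` {0..m} \<subseteq> verts G - X" 
  proof -
    have "f i \<in> verts G - X" if "i \<in> {1..m}" for i using fi(1)[OF that] assms(2) by blast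
    then show ?thesis using assms(1) unfolding m0 by (auto simp: f_def[of 0])
  qed
  moreover have "f ` e \<in> edges (delete_verts G X)" if e: "e \<in> edges (star m)" for e
  proof -
    obtain i where i: "e = {0, i}" "i \<in> {1..m}" using e unfolding star_def by auto
    then have "f ` e = {x, f i}" by (simp add: f_def[of 0])
    then show ?thesis using fi(1)[OF i(2)] assms(1,2,6) unfolding delete_verts_def by auto
  qed
  ultimately show ?thesis unfolding contains_copy_def star_def delete_verts_def by auto
qed

lemma isolates_imp_isolating_set:
  assumes "isolates k (edges G) S" "S \<subseteq> verts G" "finite (edges G)"
    and "\<And>e. e \<in> edges G \<Longrightarrow> e \<subseteq> verts G \<and> finite e"
  shows "isolating_set G (star (k + 1)) S"
  unfolding isolating_set_def
proof (intro conjI notI)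
  have V: "x \<in> verts G" if "{x, y} \<in> edges G" for x y using assms(4)[OF that] by simp
  have N: "nbhd (edges G) S = closed_nbhd G S"
    unfolding nbhd_def closed_nbhd_def neighbors_def
    by (auto simp: insert_commute dest: V)
  assume "contains_copy (delete_verts G (closed_nbhd G S)) (star (k + 1))"
  then obtain x Y where xY: "x \<notin> nbhd (edges G) S" "Y \<inter> nbhd (edges G) S = {}" "card Y = k + 1"
    "\<forall>y\<in>Y. {x, y} \<in> edges G"
    using star_copyD unfolding N by blast
  then have "Y \<subseteq> {y. {x, y} \<in> edges G \<and> y \<notin> nbhd (edges G) S}" by blast
  moreover have "finite {y. {x, y} \<in> edges G \<and> y \<notin> nbhd (edges G) S}"
    using assms(3,4) by (intro finite_adjacent) auto
  ultimately have "k + 1 \<le> card {y. {x, y} \<in> edges G \<and> y \<notin> nbhd (edges G) S}"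
    using card_mono xY(3) by metis
  then show False using assms(1) xY(1) unfolding isolates_def by fastforce
qed (rule assms(2))

lemma iota_le: "isolating_set G (star (k + 1)) S \<Longrightarrow> iota k G \<le> card S"
  unfolding iota_def by (rule Least_le) blast

text \<open>
Any tree of the mop has a cherry and thus yields a vertex \<open>x\<close> of degree 2; a second tree rooted at
an edge of \<open>x\<close> has \<open>x\<close> in addition to its cherries.
\<close>

lemma mop_iota_bound:
  assumes mop: "mop V A" and n: "card V \<ge> k + 3"
  shows "(k + 5) * iota k (graph_of V A) \<le> card V + num_deg2 (graph_of V A)"
proof -
  interpret plane_drawing V A
    using mop by unfold_locales (simp add: mop_def triangulated_disc_def)
  let ?G = "graph_of V A"
  have verts: "verts ?G = V" by (simp add: graph_of_def)
  have deg2: "degree ?G z = 2"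
    if T: "distinct (x # b # inorder T)" "V = {x, b} \<union> set_tree T" "tri_edges x b T = edges ?G"
      and z: "z \<in> cherry_apices T" for x b T z
  proof -
    obtain c d where cd: "c \<noteq> d" "{y. {y, z} \<in> edges ?G} = {c, d}"
      using cherry_apex_neighbours[OF T(1) z] T(3) by metis
    have "y \<in> V" if "{y, z} \<in> edges ?G" for y
      using that tri_edges_subset[of "{y, z}" x b T] T(2,3) by auto
    then have "neighbors ?G z = {y. {y, z} \<in> edges ?G}" unfolding neighbors_def verts by blast
    then show ?thesis using cd by (simp add: degree_def)
  qed
  obtain x0 where "x0 \<in> V" using n by fastforce
  from mop_tree[OF mop this] obtain b0 T0 where T0: "distinct (x0 # b0 # inorder T0)"
    "V = {x0, b0} \<union> set_tree T0" "T0 \<noteq> \<langle>\<rangle>" "tri_edges x0 b0 T0 = edges ?G" by blast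
  have "1 \<le> card (cherry_apices T0)" using T0(1,3) card_cherry_apices[of T0] cherries_pos[of T0] by auto
  then obtain x where x: "x \<in> cherry_apices T0" by fastforce
  then have "x \<in> V" and x2: "degree ?G x = 2"
    using T0 cherry_apices_subset[of T0] deg2[OF T0(1,2,4)] by auto
  from mop_tree[OF mop this(1)] obtain b T where T: "distinct (x # b # inorder T)"
    "V = {x, b} \<union> set_tree T" "T \<noteq> \<langle>\<rangle>" "tri_edges x b T = edges ?G" by blast
  have size: "card V = size T + 2"
    using T(1) card_set_tree[of T] unfolding T(2) by (auto simp: card_insert_if)
  have "insert x (cherry_apices T) \<subseteq> {v \<in> verts ?G. degree ?G v = 2}"
    using x2 deg2[OF T(1,2,4)] cherry_apices_subset[of T] unfolding verts by (auto simp: T(2))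
  then have "card (insert x (cherry_apices T)) \<le> num_deg2 ?G"
    unfolding num_deg2_def using finite_V by (intro card_mono) (auto simp: verts)
  moreover have "card (insert x (cherry_apices T)) = cherries T + 1"
  proof -
    have "x \<notin> cherry_apices T" using T(1) cherry_apices_subset[of T] by auto
    then show ?thesis using card_cherry_apices[of T] T(1) by (simp add: finite_cherry_apices)
  qed
  ultimately have n2: "cherries T + 1 \<le> num_deg2 ?G" by simp
  have "guardable k x b T" using tree_isolation[OF T(1)] size n by simp
  then obtain S where S: "S \<subseteq> V" "isolates k (edges ?G) S" "(k + 5) * card S \<le> size T + cherries T + 3"
    unfolding guardable_def T(4) T(2)[symmetric] by blast
  have "isolating_set ?G (star (k + 1)) S"
  proof (rule isolates_imp_isolating_set[OF S(2)])
    show "e \<subseteq> verts ?G \<and> finite e" if "e \<in> edges ?G" for e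
    proof -
      have "e \<subseteq> V" using tri_edges_subset[of e x b T] that unfolding T(2,4) by blast
      then show ?thesis using finite_V finite_subset unfolding verts by blast
    qed
  qed (use S(1) finite_tri_edges[of x b T] T(4) verts in auto)
  then have "(k + 5) * iota k ?G \<le> (k + 5) * card S" using iota_le mult_le_mono2 by blast
  then show ?thesis using S(3) n2 size by linarith
qed

section \<open>Triangulations of a convex polygon on a parabola\<close>

text \<open>
The edges as ordered pairs, so that for numbered vertices the smaller end comes first.
\<close>

fun tri_pairs :: "'a \<Rightarrow> 'a \<Rightarrow> 'a tree \<Rightarrow> ('a \<times> 'a) set" where
  "tri_pairs u v \<langle>\<rangle> = {(u, v)}"
| "tri_pairs u v \<langle>l, w, r\<rangle> = insert (u, v) (tri_pairs u w l \<union> tri_pairs w v r)"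

lemma tri_edges_pairs: "tri_edges u v T = (\<lambda>(a, b). {a, b}) ` tri_pairs u v T"
  by (induction u v T rule: tri_edges.induct) auto

lemma root_pair: "(u, v) \<in> tri_pairs u v T"
  by (cases T) auto

text \<open>
The vertices of the polygon are numbered \<open>i, \<dots>, j\<close> along the boundary, and the labels of the tree
are these numbers.
\<close>

fun numbered_tree :: "nat \<Rightarrow> nat \<Rightarrow> nat tree \<Rightarrow> bool" where
  "numbered_tree i j \<langle>\<rangle> \<longleftrightarrow> j = Suc i"
| "numbered_tree i j \<langle>l, m, r\<rangle> \<longleftrightarrow> i < m \<and> m < j \<and> numbered_tree i m l \<and> numbered_tree m j r"

lemma numbered_tree_less: "numbered_tree i j T \<Longrightarrow> i < j"
  by (cases T) auto

lemma tri_pairs_bounds: "numbered_tree i j T \<Longrightarrow> (a, b) \<in> tri_pairs i j T \<Longrightarrow> i \<le> a \<and> a < b \<and> b \<le> j"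
proof (induction i j T rule: numbered_tree.induct)
  case (2 i j l m r)
  then show ?case using numbered_tree_less[of i m l] numbered_tree_less[of m j r] by fastforce
qed simp

lemma boundary_pair: "numbered_tree i j T \<Longrightarrow> i \<le> l \<Longrightarrow> l < j \<Longrightarrow> (l, Suc l) \<in> tri_pairs i j T"
proof (induction i j T rule: numbered_tree.induct)
  case (2 i j l' m r)
  then show ?case by (cases "l < m") auto
qed auto

definition uncrossed :: "nat \<Rightarrow> nat \<Rightarrow> nat \<Rightarrow> nat \<Rightarrow> bool" where
  "uncrossed a b c d \<longleftrightarrow> b \<le> c \<or> d \<le> a \<or> a \<le> c \<and> d \<le> b \<or> c \<le> a \<and> b \<le> d"

lemma tri_pairs_uncrossed:
  "numbered_tree i j T \<Longrightarrow> (a, b) \<in> tri_pairs i j T \<Longrightarrow> (c, d) \<in> tri_pairs i j T \<Longrightarrow> uncrossed a b c d"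
proof (induction i j T rule: numbered_tree.induct)
  case (2 i j l m r)
  have P: "p = (i, j) \<or> p \<in> tri_pairs i m l \<or> p \<in> tri_pairs m j r"
    if "p \<in> tri_pairs i j \<langle>l, m, r\<rangle>" for p
    using that by auto
  have it: "numbered_tree i m l" "numbered_tree m j r" "i < m" "m < j" using "2.prems"(1) by auto
  note B = tri_pairs_bounds[OF it(1)] tri_pairs_bounds[OF it(2)]
  show ?case
    using P[OF "2.prems"(2)] P[OF "2.prems"(3)] "2.IH"(1)[OF it(1)] "2.IH"(2)[OF it(2)]
      B[of a b] B[of c d] it(3,4) unfolding uncrossed_def
    by (elim disjE; simp; linarith)
qed (auto simp: uncrossed_def)

text \<open>
The vertices lie on a parabola, hence in convex position. The coordinates \<open>Re z\<close> and
\<open>sag z\<close>, the depth of \<open>z\<close> below the parabola, turn the chord from \<open>i\<close> to \<open>j\<close> into the graph of the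
product \<open>dip i j\<close>: the chord is \<open>sag z = dip i j z\<close>, and points above it have smaller \<open>sag\<close>. All
questions about positions become comparisons of such products.
\<close>

definition pt :: "nat \<Rightarrow> complex" where
  "pt i = Complex (real i) ((real i)\<^sup>2)"

definition sag :: "complex \<Rightarrow> real" where
  "sag z = (Re z)\<^sup>2 - Im z"

definition dip :: "nat \<Rightarrow> nat \<Rightarrow> complex \<Rightarrow> real" where
  "dip i j z = (Re z - real i) * (Re z - real j)"

definition seg :: "nat \<Rightarrow> nat \<Rightarrow> complex set" where
  "seg a b = closed_segment (pt a) (pt b)"

lemma pt_simps [simp]: "Re (pt i) = real i" "Im (pt i) = (real i)\<^sup>2" "sag (pt i) = 0"
  by (auto simp: pt_def sag_def)

lemma inj_pt: "inj pt"
  by (rule injI) (metis pt_simps(1) of_nat_eq_iff)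

lemma pt_eq_iff [simp]: "pt a = pt b \<longleftrightarrow> a = b"
  using inj_pt by (auto dest: injD)

lemma eq_ptI: "Re z = real l \<Longrightarrow> sag z = 0 \<Longrightarrow> z = pt l"
  by (auto simp: complex_eq_iff sag_def)

lemma seg_iff:
  assumes "a < b"
  shows "z \<in> seg a b \<longleftrightarrow> real a \<le> Re z \<and> Re z \<le> real b \<and> sag z = dip a b z"
proof
  assume "z \<in> seg a b"
  then obtain u where u: "0 \<le> u" "u \<le> 1" "z = (1 - u) *\<^sub>R pt a + u *\<^sub>R pt b"
    unfolding seg_def closed_segment_def by blast
  have re: "Re z = real a + u * (real b - real a)" and im: "Im z = (1 - u) * (real a)\<^sup>2 + u * (real b)\<^sup>2"
    unfolding u(3) by (simp_all add: algebra_simps)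
  have "u * (real b - real a) \<le> 1 * (real b - real a)" using u assms by (intro mult_right_mono) auto
  moreover have "0 \<le> u * (real b - real a)" using u assms by simp
  moreover have "sag z = dip a b z" unfolding sag_def dip_def re im by (simp add: algebra_simps power2_eq_square)
  ultimately show "real a \<le> Re z \<and> Re z \<le> real b \<and> sag z = dip a b z" using re by simp
next
  assume z: "real a \<le> Re z \<and> Re z \<le> real b \<and> sag z = dip a b z"
  define u where "u = (Re z - real a) / (real b - real a)"
  have u: "0 \<le> u" "u \<le> 1" "u * (real b - real a) = Re z - real a"
    using z assms unfolding u_def by auto
  have "Im z = (real a + real b) * Re z - real a * real b"
    using z unfolding sag_def dip_def by (simp add: algebra_simps power2_eq_square)
  also have "\<dots> = (1 - u) * (real a)\<^sup>2 + u * (real b)\<^sup>2"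
  proof -
    have re: "Re z = real a + u * (real b - real a)" using u(3) by simp
    show ?thesis unfolding re by (simp add: algebra_simps power2_eq_square)
  qed
  finally have im: "Im z = (1 - u) * (real a)\<^sup>2 + u * (real b)\<^sup>2" .
  have "z = (1 - u) *\<^sub>R pt a + u *\<^sub>R pt b"
    using im u(3) by (simp add: complex_eq_iff algebra_simps)
  then show "z \<in> seg a b" unfolding seg_def closed_segment_def using u(1,2) by blast
qed

text \<open>
Over the interval of the inner chord, the outer chord runs above it.
\<close>

lemma dip_nested:
  assumes "i \<le> a" "b \<le> j" "real a \<le> Re z" "Re z \<le> real b"
  shows "dip i j z \<le> dip a b z"
proof -
  have "(Re z - real a) * (real b - Re z) \<le> (Re z - real i) * (real j - Re z)"
    using assms by (intro mult_mono) auto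
  then show ?thesis unfolding dip_def by (simp add: algebra_simps)
qed

lemma dip_diff_left: "dip i m z - dip i j z = (Re z - real i) * (real j - real m)"
  by (simp add: dip_def algebra_simps)

lemma dip_diff_right: "dip m j z - dip i j z = (real j - Re z) * (real m - real i)"
  by (simp add: dip_def algebra_simps)

lemma dip_pt_zero: "dip a b (pt l) = 0 \<longleftrightarrow> l = a \<or> l = b"
  by (auto simp: dip_def)

lemma seg_pts: "a < b \<Longrightarrow> pt l \<in> seg a b \<longleftrightarrow> l = a \<or> l = b"
  using dip_pt_zero[of a b l] by (auto simp: seg_iff)

text \<open>
Chords that do not cross combinatorially are nested or lie over intervals with at most one common
point; in both cases they can only share ends.
\<close>

lemma seg_meet:
  assumes ab: "a < b" "c < d" "(a, b) \<noteq> (c, d)" and un: "uncrossed a b c d"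
  shows "seg a b \<inter> seg c d \<subseteq> pt ` {a, b, c, d}"
proof -
  have nested: "z \<in> pt ` {a, b, c, d}"
    if "a < b" "c < d" "(a, b) \<noteq> (c, d)" "a \<le> c" "d \<le> b" "z \<in> seg a b" "z \<in> seg c d" for a b c d z
  proof -
    have s: "real c \<le> Re z" "Re z \<le> real d" "sag z = dip a b z" "sag z = dip c d z"
      using that by (auto simp: seg_iff)
    consider "Re z = real c \<or> Re z = real d" | "real c < Re z" "Re z < real d" using s by linarith
    then show ?thesis
    proof cases
      case 1
      then have "sag z = 0" using s(4) by (auto simp: dip_def)
      then show ?thesis using 1 eq_ptI[of z c] eq_ptI[of z d] by blast
    next
      case 2
      have "dip c d z - dip a d z = (real d - Re z) * (real c - real a)" by (rule dip_diff_right)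
      moreover have "dip a d z - dip a b z = (Re z - real a) * (real b - real d)" by (rule dip_diff_left)
      ultimately have "(real d - Re z) * (real c - real a) + (Re z - real a) * (real b - real d) = 0"
        using s by simp
      moreover have "0 \<le> (real d - Re z) * (real c - real a)" "0 \<le> (Re z - real a) * (real b - real d)"
        using 2 that by auto
      ultimately have "(real d - Re z) * (real c - real a) = 0" "(Re z - real a) * (real b - real d) = 0"
        by linarith+
      then have "c = a" "b = d" using 2 that(4) by auto
      then show ?thesis using that(3) by simp
    qed
  qed
  have apart: "z \<in> pt ` {a, b, c, d}" if "a < b" "c < d" "b \<le> c" "z \<in> seg a b" "z \<in> seg c d" for a b c d z
  proof -
    have "Re z = real b" "sag z = dip a b z" using that by (auto simp: seg_iff)
    then have "z = pt b" by (intro eq_ptI) (auto simp: dip_def)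
    then show ?thesis by simp
  qed
  show ?thesis
  proof
    fix z assume "z \<in> seg a b \<inter> seg c d"
    then have z: "z \<in> seg a b" "z \<in> seg c d" by auto
    have sw: "pt ` {c, d, a, b} = pt ` {a, b, c, d}" by (rule arg_cong[of _ _ "image pt"]) auto
    from un[unfolded uncrossed_def] show "z \<in> pt ` {a, b, c, d}"
    proof (elim disjE)
      assume "b \<le> c" then show ?thesis using apart[OF ab(1,2) _ z] by blast
    next
      assume "d \<le> a" then show ?thesis using apart[OF ab(2,1) _ z(2,1)] sw by blast
    next
      assume "a \<le> c \<and> d \<le> b" then show ?thesis using nested[OF ab _ _ z] by blast
    next
      assume "c \<le> a \<and> b \<le> d"
      then show ?thesis using nested[OF ab(2,1) _ _ _ z(2,1)] ab(3) sw by auto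
    qed
  qed
qed

text \<open>
A convex polygon given by affine inequalities: moving towards a point that satisfies all of them
strictly shows that the weak inequalities describe the closure of the strict ones.
\<close>

lemma polygon_frontier:
  fixes H :: "(complex \<Rightarrow> real) set"
  assumes H: "finite H" "\<And>g. g \<in> H \<Longrightarrow> \<exists>n c. \<forall>z. g z = n \<bullet> z + c" and ne: "\<forall>g\<in>H. 0 < g z0"
  defines "X \<equiv> {z. \<forall>g\<in>H. 0 < g z}" and "C \<equiv> {z. \<forall>g\<in>H. 0 \<le> g z}"
  shows "open X" "convex X" "convex C" "frontier X = C - X" "frontier (- C) = C - X" "closed C"
proof -
  have cont: "continuous_on UNIV g" if gH: "g \<in> H" for g
  proof -
    obtain n c where "\<forall>z. g z = n \<bullet> z + c" using H(2)[OF gH] by blast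
    then have "g = (\<lambda>z. n \<bullet> z + c)" by auto
    then show ?thesis by (auto intro!: continuous_intros)
  qed
  have aff: "g ((1 - t) *\<^sub>R x + t *\<^sub>R y) = (1 - t) * g x + t * g y" if gH: "g \<in> H" for g t x y
  proof -
    obtain n c where "\<forall>z. g z = n \<bullet> z + c" using H(2)[OF gH] by blast
    then show ?thesis by (simp add: inner_add_right algebra_simps)
  qed
  have "X = (\<Inter>g\<in>H. {z. 0 < g z})" unfolding X_def by auto
  then show opX: "open X" using H(1) cont by (auto intro!: open_INT open_Collect_less continuous_intros)
  have "C = (\<Inter>g\<in>H. {z. 0 \<le> g z})" unfolding C_def by auto
  then show clC: "closed C" using cont by (auto intro!: closed_INT closed_Collect_le continuous_intros)
  show cvX: "convex X" unfolding convex_alt X_def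
  proof (intro ballI allI impI CollectI)
    fix x y t g assume a: "x \<in> {z. \<forall>g\<in>H. 0 < g z}" "y \<in> {z. \<forall>g\<in>H. 0 < g z}" "0 \<le> t \<and> t \<le> (1::real)" "g \<in> H"
    show "0 < g ((1 - t) *\<^sub>R x + t *\<^sub>R y)"
    proof (cases "t = 0")
      case False
      then show ?thesis unfolding aff[OF a(4)] using a by (intro add_nonneg_pos mult_nonneg_nonneg mult_pos_pos) (auto intro: less_imp_le)
    qed (use a in simp)
  qed
  show "convex C" unfolding convex_alt C_def
    by (auto simp: aff intro!: add_nonneg_nonneg mult_nonneg_nonneg)
  have clX: "closure X = C"
  proof
    show "closure X \<subseteq> C" using clC by (intro closure_minimal) (auto simp: X_def C_def intro: less_imp_le)
    show "C \<subseteq> closure X"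
    proof
      fix z assume z: "z \<in> C"
      show "z \<in> closure X"
      proof (cases "z = z0")
        case True
        then have "z \<in> X" using ne unfolding X_def by simp
        then show ?thesis using closure_subset by blast
      next
        case False
        have "open_segment z z0 \<subseteq> X"
        proof
          fix x assume "x \<in> open_segment z z0"
          then obtain t where t: "0 < t" "t < 1" "x = (1 - t) *\<^sub>R z + t *\<^sub>R z0"
            by (auto simp: in_segment)
          have "0 < g x" if "g \<in> H" for g
            unfolding t(3) aff[OF that] using t z ne that
            by (intro add_nonneg_pos mult_nonneg_nonneg mult_pos_pos) (auto simp: C_def)
          then show "x \<in> X" unfolding X_def by blast
        qed
        then have "closure (open_segment z z0) \<subseteq> closure X" by (rule closure_mono)
        then show ?thesis using False by (auto simp: closure_open_segment)
      qed
    qed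
  qed
  show "frontier X = C - X" unfolding frontier_def clX using opX by (simp add: interior_open)
  have "interior C = X" using convex_interior_closure[OF cvX] opX clX by (simp add: interior_open)
  then have "frontier C = C - X" using clC by (simp add: frontier_def)
  then show "frontier (- C) = C - X" by (simp add: frontier_complement)
qed

definition open_triangle :: "nat \<Rightarrow> nat \<Rightarrow> nat \<Rightarrow> complex set" where
  "open_triangle i m j = {z. dip i j z < sag z \<and> sag z < dip i m z \<and> sag z < dip m j z}"

text \<open>
The open convex polygon with vertices \<open>i, \<dots>, j\<close>: below the chord \<open>i j\<close> and above all boundary
chords.
\<close>

definition lens :: "nat \<Rightarrow> nat \<Rightarrow> complex set" where
  "lens i j = {z. dip i j z < sag z \<and> (\<forall>l\<in>{i..<j}. sag z < dip l (Suc l) z)}"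

definition closed_lens :: "nat \<Rightarrow> nat \<Rightarrow> complex set" where
  "closed_lens i j = {z. dip i j z \<le> sag z \<and> (\<forall>l\<in>{i..<j}. sag z \<le> dip l (Suc l) z)}"

lemma above_chord_affine: "\<exists>n c. \<forall>z. dip a b z - sag z = n \<bullet> z + c"
  by (rule exI[of _ "Complex (- (real a + real b)) 1"], rule exI[of _ "real a * real b"])
     (simp add: dip_def sag_def inner_complex_def algebra_simps power2_eq_square)

lemma below_chord_affine: "\<exists>n c. \<forall>z. sag z - dip a b z = n \<bullet> z + c"
  by (rule exI[of _ "Complex (real a + real b) (- 1)"], rule exI[of _ "- (real a * real b)"])
     (simp add: dip_def sag_def inner_complex_def algebra_simps power2_eq_square)

lemma dip_diff_mid: "dip i m z - dip m j z = (Re z - real m) * (real j - real i)"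
  by (simp add: dip_def algebra_simps)

lemma product_signs:
  fixes x c :: real
  assumes "0 < c"
  shows "0 \<le> x * c \<longleftrightarrow> 0 \<le> x" "x * c \<le> 0 \<longleftrightarrow> x \<le> 0" "0 < x * c \<longleftrightarrow> 0 < x" "x * c < 0 \<longleftrightarrow> x < 0"
  using assms by (auto simp: zero_le_mult_iff mult_le_0_iff zero_less_mult_iff mult_less_0_iff)

lemma triangle_region:
  assumes "i < m" "m < j"
  shows "open (open_triangle i m j)" "convex (open_triangle i m j)" "open_triangle i m j \<noteq> {}"
    "frontier (open_triangle i m j) = seg i j \<union> seg i m \<union> seg m j"
    "\<And>z. z \<in> open_triangle i m j \<Longrightarrow> real i < Re z \<and> Re z < real j"
proof -
  define H where "H = {\<lambda>z. sag z - dip i j z, \<lambda>z. dip i m z - sag z, \<lambda>z. dip m j z - sag z}"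
  \<comment> \<open>the midpoint between vertex \<open>m\<close> and the point of the chord \<open>i j\<close> above it\<close>
  define z0 where "z0 = Complex (real m) ((real m)\<^sup>2 - (real m - real i) * (real m - real j) / 2)"
  have pos: "0 < real m - real i" "0 < real j - real m" "0 < real j - real i" using assms by auto
  have neg: "(real m - real i) * (real m - real j) < 0" using pos by (intro mult_pos_neg) auto
  have H: "finite H" "\<And>g. g \<in> H \<Longrightarrow> \<exists>n c. \<forall>z. g z = n \<bullet> z + c"
    unfolding H_def using above_chord_affine below_chord_affine by auto
  have z0: "\<forall>g\<in>H. 0 < g z0" unfolding H_def z0_def using neg by (simp add: sag_def dip_def)
  have X: "{z. \<forall>g\<in>H. 0 < g z} = open_triangle i m j" unfolding H_def open_triangle_def by auto
  note P = polygon_frontier[OF H z0, unfolded X]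
  show "open (open_triangle i m j)" "convex (open_triangle i m j)" using P(1,2) by simp_all
  show "open_triangle i m j \<noteq> {}" using z0 X by auto
  have diffs: "dip i m z - dip i j z = (Re z - real i) * (real j - real m)"
      "dip m j z - dip i j z = (real j - Re z) * (real m - real i)"
      "dip i m z - dip m j z = (Re z - real m) * (real j - real i)" for z
    using dip_diff_left dip_diff_right dip_diff_mid by blast+
  show "real i < Re z \<and> Re z < real j" if "z \<in> open_triangle i m j" for z
  proof -
    have "0 < (Re z - real i) * (real j - real m)" "0 < (real j - Re z) * (real m - real i)"
      using that diffs[of z] unfolding open_triangle_def by auto
    then show ?thesis using product_signs(3) pos by auto
  qed
  have "{z. \<forall>g\<in>H. 0 \<le> g z} - open_triangle i m j = seg i j \<union> seg i m \<union> seg m j"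
  proof (intro equalityI subsetI)
    fix z assume "z \<in> {z. \<forall>g\<in>H. 0 \<le> g z} - open_triangle i m j"
    then have c: "dip i j z \<le> sag z" "sag z \<le> dip i m z" "sag z \<le> dip m j z"
      and eq: "sag z = dip i j z \<or> sag z = dip i m z \<or> sag z = dip m j z"
      unfolding H_def open_triangle_def by auto
    have "0 \<le> (Re z - real i) * (real j - real m)" "0 \<le> (real j - Re z) * (real m - real i)"
      unfolding diffs[symmetric] using c by linarith+
    then have x: "real i \<le> Re z" "Re z \<le> real j" using product_signs(1) pos by auto
    from eq show "z \<in> seg i j \<union> seg i m \<union> seg m j"
    proof (elim disjE)
      assume "sag z = dip i j z" then show ?thesis using x assms by (simp add: seg_iff)
    next
      assume s: "sag z = dip i m z"
      then have "(Re z - real m) * (real j - real i) \<le> 0" unfolding diffs[symmetric] using c by linarith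
      then have "Re z \<le> real m" using product_signs(2) pos by auto
      then show ?thesis using s x assms by (simp add: seg_iff)
    next
      assume s: "sag z = dip m j z"
      then have "0 \<le> (Re z - real m) * (real j - real i)" unfolding diffs[symmetric] using c by linarith
      then have "real m \<le> Re z" using product_signs(1) pos by auto
      then show ?thesis using s x assms by (simp add: seg_iff)
    qed
  next
    fix z assume "z \<in> seg i j \<union> seg i m \<union> seg m j"
    then consider "z \<in> seg i j" | "z \<in> seg i m" | "z \<in> seg m j" by blast
    then have "dip i j z \<le> sag z \<and> sag z \<le> dip i m z \<and> sag z \<le> dip m j z \<and>
        (sag z = dip i j z \<or> sag z = dip i m z \<or> sag z = dip m j z)"
    proof cases
      case 1
      then have s: "real i \<le> Re z" "Re z \<le> real j" "sag z = dip i j z" using assms by (auto simp: seg_iff)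
      then have "0 \<le> dip i m z - dip i j z" "0 \<le> dip m j z - dip i j z"
        unfolding diffs using pos by auto
      then show ?thesis using s(3) by simp
    next
      case 2
      then have s: "real i \<le> Re z" "Re z \<le> real m" "sag z = dip i m z" using assms by (auto simp: seg_iff)
      then have "0 \<le> dip i m z - dip i j z" "dip i m z - dip m j z \<le> 0"
        unfolding diffs using pos by (auto simp: product_signs)
      then show ?thesis using s(3) by simp
    next
      case 3
      then have s: "real m \<le> Re z" "Re z \<le> real j" "sag z = dip m j z" using assms by (auto simp: seg_iff)
      then have "0 \<le> dip m j z - dip i j z" "0 \<le> dip i m z - dip m j z"
        unfolding diffs using pos by auto
      then show ?thesis using s(3) by simp
    qed
    then show "z \<in> {z. \<forall>g\<in>H. 0 \<le> g z} - open_triangle i m j"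
      unfolding H_def open_triangle_def by auto
  qed
  then show "frontier (open_triangle i m j) = seg i j \<union> seg i m \<union> seg m j" using P(4) by simp
qed

text \<open>
A chord that crosses no side of the triangle either runs outside the interval \<open>[i, j]\<close>, or
above the side \<open>i j\<close>, or below one of the two other sides.
\<close>

lemma triangle_avoids_chord:
  assumes "i < m" "m < j" "a < b"
    and un: "uncrossed a b i j" "uncrossed a b i m" "uncrossed a b m j"
    and z: "z \<in> open_triangle i m j"
  shows "z \<notin> seg a b"
proof
  assume "z \<in> seg a b"
  then have s: "real a \<le> Re z" "Re z \<le> real b" "sag z = dip a b z" using assms(3) by (auto simp: seg_iff)
  have x: "real i < Re z" "Re z < real j" using triangle_region(5)[OF assms(1,2) z] by auto
  have t: "dip i j z < sag z" "sag z < dip i m z" "sag z < dip m j z" using z by (auto simp: open_triangle_def)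
  have "a < j" "i < b" using s x by linarith+
  then consider "a \<le> i" "j \<le> b" | "i \<le> a" "b \<le> m" | "m \<le> a" "b \<le> j"
    using un assms(1-3) unfolding uncrossed_def by linarith
  then show False
  proof cases
    case 1 then show ?thesis using dip_nested[of a i j b z] s x t by linarith
  next
    case 2 then show ?thesis using dip_nested[of i a b m z] s x t by linarith
  next
    case 3 then show ?thesis using dip_nested[of m a b j z] s x t by linarith
  qed
qed

definition covered :: "(nat \<times> nat) set \<Rightarrow> complex \<Rightarrow> bool" where
  "covered P z \<longleftrightarrow> (\<exists>a b. (a, b) \<in> P \<and> z \<in> seg a b) \<or>
     (\<exists>a m b. {(a, m), (m, b), (a, b)} \<subseteq> P \<and> a < m \<and> m < b \<and> z \<in> open_triangle a m b)"

lemma covered_mono: "P \<subseteq> Q \<Longrightarrow> covered P z \<Longrightarrow> covered Q z"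
  unfolding covered_def by (meson subset_iff subset_trans)

lemma coveredI:
  "(a, b) \<in> P \<Longrightarrow> z \<in> seg a b \<Longrightarrow> covered P z"
  "{(a, m), (m, b), (a, b)} \<subseteq> P \<Longrightarrow> a < m \<Longrightarrow> m < b \<Longrightarrow> z \<in> open_triangle a m b \<Longrightarrow> covered P z"
  unfolding covered_def by blast+

text \<open>
The triangles and chords of the tree fill the polygon: a point below \<open>i m\<close> or below \<open>m j\<close> belongs to
the polygon of a subtree, and a point above both belongs to the triangle at the root.
\<close>

lemma lens_cover: "numbered_tree i j T \<Longrightarrow> z \<in> lens i j \<Longrightarrow> covered (tri_pairs i j T) z"
proof (induction i j T rule: numbered_tree.induct)
  case (1 i j)
  then show ?case by (auto simp: lens_def)
next
  case (2 i j l m r)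
  have it: "numbered_tree i m l" "numbered_tree m j r" "i < m" "m < j" using "2.prems"(1) by auto
  have s: "dip i j z < sag z" "\<And>l. i \<le> l \<Longrightarrow> l < j \<Longrightarrow> sag z < dip l (Suc l) z"
    using "2.prems"(2) by (auto simp: lens_def)
  have sub: "tri_pairs i m l \<subseteq> tri_pairs i j \<langle>l, m, r\<rangle>" "tri_pairs m j r \<subseteq> tri_pairs i j \<langle>l, m, r\<rangle>"
    by auto
  have roots: "{(i, m), (m, j), (i, j)} \<subseteq> tri_pairs i j \<langle>l, m, r\<rangle>" using root_pair[of i m l] root_pair[of m j r] by auto
  consider "dip i m z < sag z" | "dip m j z < sag z" | "sag z = dip i m z" | "sag z = dip m j z"
    | "sag z < dip i m z" "sag z < dip m j z" by linarith
  then show ?case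
  proof cases
    case 1
    then have "z \<in> lens i m" using s it by (auto simp: lens_def)
    from "2.IH"(1)[OF it(1) this] show ?thesis using covered_mono[OF sub(1)] by blast
  next
    case 2
    then have "z \<in> lens m j" using s it by (auto simp: lens_def)
    from "2.IH"(2)[OF it(2) this] show ?thesis using covered_mono[OF sub(2)] by blast
  next
    case 3
    have "0 < dip i (Suc i) z - dip i m z" using s(2)[of i] 3 it by simp
    also have "\<dots> = (Re z - real i) * (real m - real (Suc i))" by (rule dip_diff_left)
    finally have "0 < Re z - real i" using it by (auto simp: zero_less_mult_iff)
    moreover have "0 < dip (m - 1) m z - dip i m z" using s(2)[of "m - 1"] 3 it by simp
    then have "0 < (real m - Re z) * (real (m - 1) - real i)" by (simp only: dip_diff_right)
    then have "0 < real m - Re z" using it by (auto simp: zero_less_mult_iff)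
    ultimately have "z \<in> seg i m" using 3 it by (simp add: seg_iff)
    then show ?thesis using roots coveredI(1)[of i m] by simp
  next
    case 4
    have "0 < dip m (Suc m) z - dip m j z" using s(2)[of m] 4 it by simp
    also have "\<dots> = (Re z - real m) * (real j - real (Suc m))" by (rule dip_diff_left)
    finally have "0 < Re z - real m" using it by (auto simp: zero_less_mult_iff)
    moreover have "0 < dip (j - 1) j z - dip m j z" using s(2)[of "j - 1"] 4 it by simp
    then have "0 < (real j - Re z) * (real (j - 1) - real m)" by (simp only: dip_diff_right)
    then have "0 < real j - Re z" using it by (auto simp: zero_less_mult_iff)
    ultimately have "z \<in> seg m j" using 4 it by (simp add: seg_iff)
    then show ?thesis using roots coveredI(1)[of m j] by simp
  next
    case 5
    then have "z \<in> open_triangle i m j" using s by (simp add: open_triangle_def)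
    then show ?thesis using coveredI(2)[OF roots] it by blast
  qed
qed

lemma chord_in_closed_lens:
  assumes "i \<le> a" "a < b" "b \<le> j" shows "seg a b \<subseteq> closed_lens i j"
proof
  fix z assume "z \<in> seg a b"
  then have s: "real a \<le> Re z" "Re z \<le> real b" "sag z = dip a b z" using assms by (auto simp: seg_iff)
  have "sag z \<le> dip l (Suc l) z" for l
  proof (cases "real l < Re z \<and> Re z < real (Suc l)")
    case True
    then have "a \<le> l" "Suc l \<le> b" using s by linarith+
    then show ?thesis using dip_nested[of a l "Suc l" b z] True s by simp
  next
    case False
    then have "0 \<le> dip l (Suc l) z" unfolding dip_def by (auto simp: zero_le_mult_iff)
    moreover have "dip a b z \<le> 0" unfolding dip_def using s by (auto simp: mult_le_0_iff)
    ultimately show ?thesis using s by linarith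
  qed
  moreover have "dip i j z \<le> sag z" using dip_nested[of i a b j z] s assms by simp
  ultimately show "z \<in> closed_lens i j" by (simp add: closed_lens_def)
qed

text \<open>
Compare the chord \<open>i j\<close> with the first and with the last boundary chord. With a single boundary
chord the polygon degenerates to the whole line through it, hence the first assumption.
\<close>

lemma closed_lens_range:
  assumes "Suc (Suc i) \<le> j" "z \<in> closed_lens i j"
  shows "real i \<le> Re z" "Re z \<le> real j"
proof -
  have s: "dip i j z \<le> sag z" "\<And>l. i \<le> l \<Longrightarrow> l < j \<Longrightarrow> sag z \<le> dip l (Suc l) z"
    using assms(2) by (auto simp: closed_lens_def)
  have "0 \<le> dip i (Suc i) z - dip i j z" using s(1) s(2)[of i] assms(1) by simp
  then have "0 \<le> (Re z - real i) * (real j - real (Suc i))" by (simp only: dip_diff_left)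
  then show "real i \<le> Re z" using assms(1) by (auto simp: zero_le_mult_iff)
  have "i \<le> j - 1" "j - 1 < j" "Suc (j - 1) = j" using assms(1) by auto
  then have "0 \<le> dip (j - 1) j z - dip i j z" using s(1) s(2)[of "j - 1"] by simp
  then have "0 \<le> (real j - Re z) * (real (j - 1) - real i)" by (simp only: dip_diff_right)
  then show "Re z \<le> real j" using assms(1) by (auto simp: zero_le_mult_iff)
qed

lemma bounded_below_chord:
  assumes "\<And>z. z \<in> S \<Longrightarrow> real i \<le> Re z \<and> Re z \<le> real j \<and> dip i j z \<le> sag z \<and> sag z \<le> dip i m z"
  shows "bounded S"
proof (rule boundedI)
  fix z assume "z \<in> S"
  note z = assms[OF this]
  have "Im z \<le> (real i + real j) * Re z - real i * real j"
    using z by (simp add: dip_def sag_def algebra_simps power2_eq_square)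
  also have "\<dots> \<le> (real i + real j) * real j"
  proof -
    have "(real i + real j) * Re z \<le> (real i + real j) * real j" using z by (intro mult_left_mono) auto
    moreover have "0 \<le> real i * real j" by simp
    ultimately show ?thesis by linarith
  qed
  finally have up: "Im z \<le> (real i + real j) * real j" .
  have "- (real i * real m) \<le> (real i + real m) * Re z - real i * real m"
    using z by (simp add: order_trans[of 0 "real i"])
  also have "\<dots> \<le> Im z" using z by (simp add: dip_def sag_def algebra_simps power2_eq_square)
  finally have lo: "- (real i * real m) \<le> Im z" .
  have "0 \<le> (real i + real j) * real j" "0 \<le> real i * real m" by auto
  then have "\<bar>Im z\<bar> \<le> (real i + real j) * real j + real i * real m" using up lo by linarith
  moreover have "\<bar>Re z\<bar> \<le> real j" using z by linarith
  ultimately show "norm z \<le> real j + ((real i + real j) * real j + real i * real m)"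
    using cmod_le[of z] by linarith
qed

lemma lens_frontier:
  assumes ij: "Suc (Suc i) \<le> j"
  shows "convex (closed_lens i j)" "bounded (closed_lens i j)"
    "closed_lens i j - lens i j = seg i j \<union> (\<Union>l\<in>{i..<j}. seg l (Suc l))"
    "frontier (- closed_lens i j) = seg i j \<union> (\<Union>l\<in>{i..<j}. seg l (Suc l))"
proof -
  define H where "H = insert (\<lambda>z. sag z - dip i j z) ((\<lambda>l z. dip l (Suc l) z - sag z) ` {i..<j})"
  \<comment> \<open>the midpoint between vertex \<open>i + 1\<close> and the point of the chord \<open>i j\<close> above it\<close>
  define z0 where "z0 = Complex (real (Suc i)) ((real (Suc i))\<^sup>2 - (real (Suc i) - real j) / 2)"
  have H: "finite H" "\<And>g. g \<in> H \<Longrightarrow> \<exists>n c. \<forall>z. g z = n \<bullet> z + c"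
    unfolding H_def using above_chord_affine below_chord_affine by auto
  have "0 \<le> (real (Suc i) - real l) * (real (Suc i) - real (Suc l))" for l
    by (cases "l \<le> i") (auto simp: zero_le_mult_iff)
  moreover have "(real (Suc i) - real j) / 2 < 0" using ij by simp
  ultimately have "sag z0 < dip l (Suc l) z0" for l
    unfolding sag_def dip_def z0_def by (smt (verit) complex.sel)
  moreover have "dip i j z0 < sag z0" unfolding sag_def dip_def z0_def using ij by simp
  ultimately have z0: "\<forall>g\<in>H. 0 < g z0" unfolding H_def by auto
  have X: "{z. \<forall>g\<in>H. 0 < g z} = lens i j" and C: "{z. \<forall>g\<in>H. 0 \<le> g z} = closed_lens i j"
    unfolding H_def lens_def closed_lens_def by auto
  note P = polygon_frontier[OF H z0, unfolded X C]
  show "convex (closed_lens i j)" by (rule P)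
  show "bounded (closed_lens i j)"
  proof (rule bounded_below_chord)
    fix z assume z: "z \<in> closed_lens i j"
    then show "real i \<le> Re z \<and> Re z \<le> real j \<and> dip i j z \<le> sag z \<and> sag z \<le> dip i (Suc i) z"
      using closed_lens_range[OF ij z] ij by (auto simp: closed_lens_def)
  qed
  show eq: "closed_lens i j - lens i j = seg i j \<union> (\<Union>l\<in>{i..<j}. seg l (Suc l))"
  proof (intro equalityI subsetI)
    fix z assume z: "z \<in> closed_lens i j - lens i j"
    then have s: "dip i j z \<le> sag z" "\<And>l. i \<le> l \<Longrightarrow> l < j \<Longrightarrow> sag z \<le> dip l (Suc l) z"
      by (auto simp: closed_lens_def)
    have x: "real i \<le> Re z" "Re z \<le> real j" using closed_lens_range[OF ij] z by auto
    have "sag z = dip i j z \<or> (\<exists>l\<in>{i..<j}. sag z = dip l (Suc l) z)"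
      using z unfolding closed_lens_def lens_def by force
    then show "z \<in> seg i j \<union> (\<Union>l\<in>{i..<j}. seg l (Suc l))"
    proof (elim disjE bexE)
      assume "sag z = dip i j z" then show ?thesis using x ij by (simp add: seg_iff)
    next
      fix l assume l: "l \<in> {i..<j}" and eq: "sag z = dip l (Suc l) z"
      have "real l \<le> Re z"
      proof (cases "l = i")
        case False
        then obtain k where k: "l = Suc k" using l by (cases l) auto
        have "dip l (Suc l) z \<le> dip k l z" using s(2)[of k] l eq False k by simp
        then show ?thesis unfolding dip_def k by (simp add: algebra_simps)
      qed (use x in simp)
      moreover have "Re z \<le> real (Suc l)"
      proof (cases "Suc l = j")
        case False
        have "dip l (Suc l) z \<le> dip (Suc l) (Suc (Suc l)) z" using s(2)[of "Suc l"] l eq False by simp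
        then show ?thesis unfolding dip_def by (simp add: algebra_simps)
      qed (use x in simp)
      ultimately show ?thesis using l eq by (auto simp: seg_iff)
    qed
  next
    fix z assume z: "z \<in> seg i j \<union> (\<Union>l\<in>{i..<j}. seg l (Suc l))"
    then have "z \<in> closed_lens i j"
      using chord_in_closed_lens[of i i j j] chord_in_closed_lens[of i _ "Suc _" j] ij by fastforce
    moreover have "z \<notin> lens i j" using z ij by (auto simp: lens_def seg_iff)
    ultimately show "z \<in> closed_lens i j - lens i j" by blast
  qed
  show "frontier (- closed_lens i j) = seg i j \<union> (\<Union>l\<in>{i..<j}. seg l (Suc l))"
    using P(5) eq by simp
qed

section \<open>The straight-line drawing is a mop\<close>

text \<open>
Each candidate for a face (the triangles of the tree and the complement of the closed polygon) is
connected, avoids the drawing and has its frontier in the drawing. So a face that meets one of them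
is equal to it, and by \<open>lens_cover\<close> every face meets one.
\<close>

lemma drawn_tree:
  assumes T: "numbered_tree 0 N T" and N: "2 \<le> N"
  shows "\<exists>V A. mop V A \<and> V = pt ` {0..N} \<and> edges (graph_of V A) = image pt ` tri_edges 0 N T"
proof -
  define P where "P = tri_pairs 0 N T"
  define V where "V = pt ` {0..N}"
  define A where "A = (\<lambda>(a, b). seg a b) ` P"
  have bounds: "a < b" "b \<le> N" if "(a, b) \<in> P" for a b
    using tri_pairs_bounds[OF T] that unfolding P_def by auto
  have bdry: "(l, Suc l) \<in> P" if "l < N" for l using boundary_pair[OF T] that unfolding P_def by simp
  have root: "(0, N) \<in> P" unfolding P_def by (rule root_pair)
  have un: "uncrossed a b c d" if "(a, b) \<in> P" "(c, d) \<in> P" for a b c d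
    using tri_pairs_uncrossed[OF T] that unfolding P_def by blast
  have ends: "seg a b \<inter> V = {pt a, pt b}" if "(a, b) \<in> P" for a b
  proof -
    have "pt l \<in> seg a b \<longleftrightarrow> l = a \<or> l = b" for l using seg_pts bounds[OF that] by blast
    then show ?thesis using bounds[OF that] unfolding V_def by auto
  qed
  have seg_in: "seg a b \<in> A" if "(a, b) \<in> P" for a b
    unfolding A_def using that by (rule rev_image_eqI) simp
  have plane: "plane_graph V A"
    unfolding plane_graph_def
  proof (intro conjI ballI impI)
    show "finite V" unfolding V_def by simp
  next
    fix e assume "e \<in> A"
    then obtain a b where ab: "(a, b) \<in> P" "e = seg a b" unfolding A_def by auto
    then show "\<exists>g. arc g \<and> path_image g = e \<and> e \<inter> V = {pathstart g, pathfinish g}"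
      using ends[OF ab(1)] bounds[OF ab(1)]
      by (intro exI[of _ "linepath (pt a) (pt b)"]) (simp add: seg_def)
  next
    fix e e' assume e: "e \<in> A" "e' \<in> A" "e \<noteq> e'"
    then obtain a b c d where p: "(a, b) \<in> P" "e = seg a b" "(c, d) \<in> P" "e' = seg c d"
      unfolding A_def by auto
    then have ne: "(a, b) \<noteq> (c, d)" using e(3) by auto
    then show "e \<inter> V \<noteq> e' \<inter> V"
      using ends[OF p(1)] ends[OF p(3)] bounds(1)[OF p(1)] bounds(1)[OF p(3)] p(2,4)
      by (auto simp: doubleton_eq_iff)
    have "e \<inter> e' \<subseteq> pt ` {a, b, c, d}"
      unfolding p(2,4) using bounds(1)[OF p(1)] bounds(1)[OF p(3)] ne un[OF p(1,3)] by (rule seg_meet)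
    also have "\<dots> \<subseteq> V" using bounds[OF p(1)] bounds[OF p(3)] unfolding V_def by auto
    finally show "e \<inter> e' \<subseteq> V" .
  qed
  interpret plane_drawing V A by (rule plane_drawing.intro[OF plane])
  have drawing_eq: "drawing = \<Union>A"
  proof -
    have "pt l \<in> \<Union>A" if "l \<le> N" for l
    proof (cases "l < N")
      case True
      then have "seg l (Suc l) \<in> A" using bdry seg_in by blast
      then show ?thesis using seg_pts[of l "Suc l" l] by auto
    next
      case False
      then have "l = N" using that by simp
      moreover have "seg 0 N \<in> A" using root seg_in by blast
      ultimately show ?thesis using seg_pts[of 0 N N] N by auto
    qed
    then have "V \<subseteq> \<Union>A" unfolding V_def by auto
    then show ?thesis unfolding drawing_def by blast
  qed
  have pair_adj: "adj (pt a) (pt b)" "edge_between (pt a) (pt b) = seg a b" if "(a, b) \<in> P" for a b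
  proof -
    have "seg a b \<in> A" using that by (rule seg_in)
    then show "adj (pt a) (pt b)" "edge_between (pt a) (pt b) = seg a b"
      using ends[OF that] edge_between_eqI unfolding adj_def by auto
  qed
  have graph: "edges (graph_of V A) = (\<lambda>(a, b). {pt a, pt b}) ` P"
  proof -
    have "edges (graph_of V A) = (\<lambda>(a, b). seg a b \<inter> V) ` P"
      unfolding graph_of_def A_def by (auto simp: image_image)
    also have "\<dots> = (\<lambda>(a, b). {pt a, pt b}) ` P" using ends by (intro image_cong) auto
    finally show ?thesis .
  qed
  have same_face: "F = X"
    if "F \<in> faces V A" "z \<in> F" "z \<in> X" "connected X" "X \<inter> drawing = {}" "frontier X \<subseteq> drawing" for F X z
  proof -
    have F: "F \<in> components (- drawing)" using that(1) by (simp add: faces_def drawing_def)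
    have "X \<subseteq> F" using components_maximal[OF F that(4)] that by blast
    moreover have "frontier X \<inter> F = {}" using face_props(3)[OF that(1)] that(6) by blast
    ultimately show ?thesis
      using open_subset_eqI[OF face_props(1)[OF that(1)], of X] that(3) by blast
  qed
  have edges_among: "{e \<in> A. e \<inter> V \<in> (\<lambda>(a, b). {pt a, pt b}) ` Q} = (\<lambda>(a, b). seg a b) ` Q" if "Q \<subseteq> P" for Q
  proof (intro equalityI subsetI)
    fix e assume "e \<in> {e \<in> A. e \<inter> V \<in> (\<lambda>(a, b). {pt a, pt b}) ` Q}"
    then obtain a b where e: "e \<in> A" "(a, b) \<in> Q" "e \<inter> V = {pt a, pt b}" by auto
    then have "e = seg a b" using edge_between_eqI[OF e(1,3)] pair_adj(2) that by auto
    then show "e \<in> (\<lambda>(a, b). seg a b) ` Q" using e(2) by force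
  next
    fix e assume "e \<in> (\<lambda>(a, b). seg a b) ` Q"
    then obtain a b where e: "(a, b) \<in> Q" "e = seg a b" by auto
    have ab: "(a, b) \<in> P" using e(1) that by blast
    have "e \<in> A" "e \<inter> V = {pt a, pt b}" using seg_in[OF ab] ends[OF ab] e(2) by simp_all
    moreover have "{pt a, pt b} \<in> (\<lambda>(a, b). {pt a, pt b}) ` Q" using e(1) by (rule rev_image_eqI) simp
    ultimately show "e \<in> {e \<in> A. e \<inter> V \<in> (\<lambda>(a, b). {pt a, pt b}) ` Q}" by simp
  qed
  have in_drawing: "y \<in> drawing \<longleftrightarrow> (\<exists>a b. (a, b) \<in> P \<and> y \<in> seg a b)" for y
  proof -
    have "y \<in> \<Union>A \<longleftrightarrow> (\<exists>a b. (a, b) \<in> P \<and> y \<in> seg a b)" unfolding A_def by auto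
    then show ?thesis by (simp only: drawing_eq)
  qed
  have clens: "drawing \<subseteq> closed_lens 0 N"
  proof
    fix y assume "y \<in> drawing"
    then obtain a b where ab: "(a, b) \<in> P" "y \<in> seg a b" unfolding in_drawing by blast
    then show "y \<in> closed_lens 0 N"
      using chord_in_closed_lens[OF _ bounds[OF ab(1)], of 0] by blast
  qed
  have N': "Suc (Suc 0) \<le> N" using N by simp
  note L = lens_frontier[OF N']
  have rim: "seg 0 N \<union> (\<Union>l\<in>{0..<N}. seg l (Suc l)) \<subseteq> drawing"
    using root bdry in_drawing by (intro Un_least UN_least subsetI) (auto)
  have faces_cases: "F = - closed_lens 0 N \<or>
      (\<exists>a m b. {(a, m), (m, b), (a, b)} \<subseteq> P \<and> a < m \<and> m < b \<and> F = open_triangle a m b)"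
    if F: "F \<in> faces V A" for F
  proof -
    obtain z where z: "z \<in> F" using face_props(2)[OF F] by blast
    then have zD: "z \<notin> drawing" using face_props(3)[OF F] by blast
    show ?thesis
    proof (cases "z \<in> closed_lens 0 N")
      case False
      have "connected (- closed_lens 0 N)"
        by (rule connected_complement_bounded_convex[OF L(2,1)]) simp
      moreover have "- closed_lens 0 N \<inter> drawing = {}" using clens by blast
      moreover have "frontier (- closed_lens 0 N) \<subseteq> drawing" unfolding L(4) by (rule rim)
      ultimately have "F = - closed_lens 0 N" using same_face[OF F z] False by blast
      then show ?thesis by blast
    next
      case True
      then have "z \<in> lens 0 N" using L(3) rim zD by blast
      then have "covered P z" unfolding P_def by (rule lens_cover[OF T])
      moreover have "z \<notin> seg a b" if "(a, b) \<in> P" for a b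
        using zD that in_drawing by blast
      ultimately obtain a m b where t: "{(a, m), (m, b), (a, b)} \<subseteq> P" "a < m" "m < b" "z \<in> open_triangle a m b"
        unfolding covered_def by blast
      note R = triangle_region[OF t(2,3)]
      have "open_triangle a m b \<inter> drawing = {}"
      proof -
        have "y \<notin> seg c d" if "y \<in> open_triangle a m b" "(c, d) \<in> P" for y c d
          using triangle_avoids_chord[OF t(2,3) bounds(1)[OF that(2)] _ _ _ that(1)] un[OF that(2)] t(1)
          by simp
        then show ?thesis using in_drawing by blast
      qed
      moreover have "frontier (open_triangle a m b) \<subseteq> drawing"
        unfolding R(4) drawing_eq using seg_in[of a m] seg_in[of m b] seg_in[of a b] t(1) by auto
      ultimately have "F = open_triangle a m b"
        using same_face[OF F z t(4) convex_connected[OF R(2)]] by blast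
      then show ?thesis using t by blast
    qed
  qed
  have tri_bounded: "bounded (open_triangle a m b)" if "a < m" "m < b" for a m b
    by (rule bounded_below_chord[of _ a b m])
      (use triangle_region(5)[OF that] in \<open>fastforce simp: open_triangle_def\<close>)
  have outer_unbounded: "\<not> bounded (- closed_lens 0 N)"
    using L(2) cobounded_imp_unbounded by blast
  have inner: "\<exists>xs. length xs = 3 \<and> bounded_by_cycle V A F xs" if Fb: "F \<in> faces V A" "bounded F" for F
  proof -
    obtain a m b where t: "{(a, m), (m, b), (a, b)} \<subseteq> P" "a < m" "m < b" "F = open_triangle a m b"
      using faces_cases[OF Fb(1)] Fb(2) outer_unbounded by blast
    let ?xs = "[pt a, pt m, pt b]"
    have "{i. i < length ?xs} = {0, 1, 2}" by auto
    then have "cycle_edges ?xs = (\<lambda>i. {?xs ! i, ?xs ! (Suc i mod length ?xs)}) ` {0, 1, 2}"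
      unfolding cycle_edges_def by (simp only: image_Collect[symmetric] setcompr_eq_image)
    also have "\<dots> = (\<lambda>(a, b). {pt a, pt b}) ` {(a, m), (m, b), (a, b)}"
      by (auto simp: insert_commute)
    finally have ce: "cycle_edges ?xs = (\<lambda>(a, b). {pt a, pt b}) ` {(a, m), (m, b), (a, b)}" .
    have "frontier F = \<Union>{e \<in> A. e \<inter> V \<in> cycle_edges ?xs}"
      unfolding ce edges_among[OF t(1)] t(4) triangle_region(4)[OF t(2,3)] by auto
    moreover have "is_cycle (graph_of V A) ?xs"
      unfolding is_cycle_def graph ce
    proof (intro conjI)
      show "distinct ?xs" using t(2,3) by simp
      show "set ?xs \<subseteq> verts (graph_of V A)"
        using t bounds[of a b] unfolding graph_of_def V_def by auto
    qed (use t(1) in auto)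
    ultimately show ?thesis unfolding bounded_by_cycle_def by (intro exI[of _ ?xs]) simp
  qed
  have outer: "(\<exists>xs. bounded_by_cycle V A F xs) \<and> V \<subseteq> frontier F"
    if "F \<in> faces V A" "\<not> bounded F" for F
  proof -
    have F: "F = - closed_lens 0 N" using faces_cases[OF that(1)] that(2) tri_bounded by blast
    let ?Q = "insert (0, N) ((\<lambda>l. (l, Suc l)) ` {0..<N})"
    have Q: "?Q \<subseteq> P" using root bdry by auto
    let ?xs = "map pt [0..<Suc N]"
    have "{i. i < length ?xs} = insert N {0..<N}" by auto
    then have "cycle_edges ?xs = (\<lambda>i. {?xs ! i, ?xs ! (Suc i mod length ?xs)}) ` insert N {0..<N}"
      unfolding cycle_edges_def by (simp only: image_Collect[symmetric] setcompr_eq_image)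
    also have "\<dots> = insert {pt 0, pt N} ((\<lambda>i. {pt i, pt (Suc i)}) ` {0..<N})"
    proof -
      have "(\<lambda>i. {?xs ! i, ?xs ! (Suc i mod length ?xs)}) ` {0..<N} = (\<lambda>i. {pt i, pt (Suc i)}) ` {0..<N}"
        by (intro image_cong) (auto simp: nth_append less_Suc_eq_le)
      moreover have "{?xs ! N, ?xs ! (Suc N mod length ?xs)} = {pt 0, pt N}"
        using N by (auto simp: nth_append)
      ultimately show ?thesis by (simp only: image_insert)
    qed
    also have "\<dots> = (\<lambda>(a, b). {pt a, pt b}) ` ?Q" by (simp add: image_image)
    finally have ce: "cycle_edges ?xs = (\<lambda>(a, b). {pt a, pt b}) ` ?Q" .
    have fr: "frontier F = seg 0 N \<union> (\<Union>l\<in>{0..<N}. seg l (Suc l))" unfolding F by (rule L(4))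
    have "frontier F = \<Union>{e \<in> A. e \<inter> V \<in> cycle_edges ?xs}"
      unfolding ce edges_among[OF Q] fr by (simp add: image_image)
    moreover have "is_cycle (graph_of V A) ?xs"
      unfolding is_cycle_def graph ce
    proof (intro conjI)
      show "3 \<le> length ?xs" using N by simp
      show "distinct ?xs" 
        using inj_on_subset[OF inj_pt subset_UNIV] by (simp add: distinct_map del: upt_Suc)
      show "set ?xs \<subseteq> verts (graph_of V A)" unfolding graph_of_def V_def by auto
    qed (rule image_mono[OF Q])
    moreover have "V \<subseteq> frontier F"
    proof -
      have "pt l \<in> frontier F" if "l \<le> N" for l
      proof (cases "l < N")
        case True
        then show ?thesis unfolding fr using seg_pts[of l "Suc l" l] by auto
      next
        case False
        then show ?thesis unfolding fr using seg_pts[of 0 N l] that N by auto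
      qed
      then show ?thesis unfolding V_def by auto
    qed
    ultimately show ?thesis unfolding bounded_by_cycle_def by blast
  qed
  have "mop V A"
    unfolding mop_def triangulated_disc_def using plane inner outer by blast
  moreover have "edges (graph_of V A) = image pt ` tri_edges 0 N T"
    unfolding graph tri_edges_pairs P_def by (auto simp: image_image)
  ultimately show ?thesis unfolding V_def by blast
qed

section \<open>Mops that attain the bound\<close>

text \<open>
The fan at the vertex \<open>u + c + 1\<close> over the boundary path from \<open>u\<close> to \<open>u + c\<close>.
\<close>

fun fan :: "nat \<Rightarrow> nat \<Rightarrow> nat tree" where
  "fan u 0 = \<langle>\<rangle>"
| "fan u (Suc c) = \<langle>\<langle>\<rangle>, Suc u, fan (Suc u) c\<rangle>"

text \<open>
The block occupies \<open>u, \<dots>, u + k + 3\<close>. Vertex \<open>u + k + 2\<close> is adjacent to \<open>u + 1, \<dots>, u + k + 1\<close>, and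
together they form a \<open>K\<^bsub>1,k+1\<^esub>\<close> that the edge from \<open>u\<close> to \<open>u + k + 3\<close> shields from the other vertices.
Only \<open>u + k + 1\<close> has degree 2.
\<close>

definition block :: "nat \<Rightarrow> nat \<Rightarrow> nat tree" where
  "block k u = \<langle>fan u (k + 1), u + k + 2, \<langle>\<rangle>\<rangle>"

text \<open>
Blocks are numbered from 0, so \<open>blocks k t\<close> has \<open>t + 1\<close> of them. The previous blocks and the new
one are joined by two triangles, both with the edge from the last old to the last new vertex.
\<close>

fun blocks :: "nat \<Rightarrow> nat \<Rightarrow> nat tree" where
  "blocks k 0 = block k 0"
| "blocks k (Suc t) =
    \<langle>blocks k t, Suc t * (k + 4) - 1, \<langle>\<langle>\<rangle>, Suc t * (k + 4), block k (Suc t * (k + 4))\<rangle>\<rangle>"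

lemma numbered_tree_fan: "numbered_tree u (u + c + 1) (fan u c)"
proof (induction c arbitrary: u)
  case (Suc c)
  from Suc[of "Suc u"] show ?case by simp
qed simp

lemma fan_pairs: "i \<le> c \<Longrightarrow> (u + i, u + c + 1) \<in> tri_pairs u (u + c + 1) (fan u c)"
proof (induction c arbitrary: u i)
  case (Suc c)
  show ?case
  proof (cases i)
    case (Suc i')
    then show ?thesis using Suc.IH[of i' "Suc u"] Suc.prems by simp
  qed (simp add: root_pair)
qed simp

lemma numbered_tree_block: "numbered_tree u (u + k + 3) (block k u)"
  using numbered_tree_fan[of u "k + 1"] by (simp add: block_def add.assoc)

lemma numbered_tree_blocks: "numbered_tree 0 (Suc t * (k + 4) - 1) (blocks k t)"
proof (induction t)
  case 0
  then show ?case using numbered_tree_block[of 0 k] by (simp add: add.commute)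
next
  case (Suc t)
  have "Suc (Suc t) * (k + 4) - 1 = Suc t * (k + 4) + k + 3" by simp
  then show ?case using Suc numbered_tree_block[of "Suc t * (k + 4)" k] by simp
qed

lemma block_in_blocks:
  "i \<le> t \<Longrightarrow> tri_pairs (i * (k + 4)) (i * (k + 4) + k + 3) (block k (i * (k + 4)))
     \<subseteq> tri_pairs 0 (Suc t * (k + 4) - 1) (blocks k t)"
proof (induction t)
  case 0
  then show ?case by (simp add: add.commute)
next
  case (Suc t)
  show ?case
  proof (cases "i = Suc t")
    case True
    have "Suc (Suc t) * (k + 4) - 1 = Suc t * (k + 4) + k + 3" by simp
    then show ?thesis unfolding True by (simp only: blocks.simps tri_pairs.simps) blast
  next
    case False
    then have "i \<le> t" using Suc.prems by simp
    from Suc.IH[OF this] show ?thesis by (simp only: blocks.simps tri_pairs.simps) blast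
  qed
qed

lemma block_pairs:
  "(u, u + k + 3) \<in> tri_pairs u (u + k + 3) (block k u)"
  "i \<le> k + 1 \<Longrightarrow> (u + i, u + k + 2) \<in> tri_pairs u (u + k + 3) (block k u)"
  using fan_pairs[of i "k + 1" u] by (auto simp: block_def add.assoc)

lemma star_isolating_verts: "isolating_set G (star m) (verts G)"
  unfolding isolating_set_def using star_copyD unfolding closed_nbhd_def by blast

lemma iota_attained: "\<exists>S. isolating_set G (star (k + 1)) S \<and> card S = iota k G"
  unfolding iota_def by (rule LeastI_ex) (use star_isolating_verts in blast)

text \<open>
The last vertex of a single block would have degree 2 for lack of a neighbour in another block,
hence \<open>1 \<le> t\<close>.
\<close>

lemma extremal_mop:
  fixes k t :: nat
  assumes t: "1 \<le> t"
  shows "\<exists>V A. mop V A \<and> card V = Suc t * (k + 4) \<and>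
    num_deg2 (graph_of V A) \<le> Suc t \<and> Suc t \<le> iota k (graph_of V A)"
proof -
  define s where "s = k + 4"
  define N where "N = Suc t * s - 1"
  define P where "P = tri_pairs 0 N (blocks k t)"
  have s: "0 < s" "s = k + 4" and N: "Suc N = Suc t * s" "2 \<le> N" unfolding s_def N_def by auto
  have T: "numbered_tree 0 N (blocks k t)" unfolding N_def s_def by (rule numbered_tree_blocks)
  obtain V A where mop: "mop V A" and V: "V = pt ` {0..N}"
    and edges: "edges (graph_of V A) = image pt ` tri_edges 0 N (blocks k t)"
    using drawn_tree[OF T N(2)] by blast
  let ?G = "graph_of V A"
  have verts: "verts ?G = V" by (simp add: graph_of_def)
  have vertsN: "verts ?G = pt ` {0..N}" using verts V by simp
  have cardV: "card V = Suc t * s"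
    unfolding V using N(1) by (subst card_image) (auto intro: inj_on_subset[OF inj_pt])
  have edge_iff: "{pt a, pt b} \<in> edges ?G \<longleftrightarrow> (a, b) \<in> P \<or> (b, a) \<in> P" for a b
  proof -
    have "edges ?G = (\<lambda>(a, b). {pt a, pt b}) ` P"
      unfolding edges tri_edges_pairs P_def by (auto simp: image_image)
    then show ?thesis by (auto simp: doubleton_eq_iff)
  qed
  have bdry: "(l, Suc l) \<in> P" if "l < N" for l
    using boundary_pair[OF T, of l] that unfolding P_def by simp
  have root: "(0, N) \<in> P" unfolding P_def by (rule root_pair)
  have block: "tri_pairs (i * s) (i * s + k + 3) (block k (i * s)) \<subseteq> P" if "i \<le> t" for i
    using block_in_blocks[OF that, of k] unfolding P_def N_def s_def .
  have in_block: "i * s + r \<le> N" if "i \<le> t" "r < s" for i r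
  proof -
    have "i * s \<le> t * s" using that(1) by (rule mult_le_mono1)
    then show ?thesis using that(2) N(1) unfolding mult_Suc by linarith
  qed
  have deg3: "degree ?G (pt l) \<noteq> 2"
    if nb: "{x, y, z} \<subseteq> {0..N}" "x \<noteq> y" "y \<noteq> z" "x \<noteq> z"
      "\<And>w. w \<in> {x, y, z} \<Longrightarrow> (w, l) \<in> P \<or> (l, w) \<in> P" for l x y z
  proof -
    have "pt ` {x, y, z} \<subseteq> neighbors ?G (pt l)"
      using nb(1,5) edge_iff unfolding neighbors_def vertsN by auto
    moreover have "finite (neighbors ?G (pt l))" unfolding neighbors_def vertsN by simp
    ultimately have "card (pt ` {x, y, z}) \<le> degree ?G (pt l)"
      unfolding degree_def by (rule card_mono[rotated])
    moreover have "card (pt ` {x, y, z}) = 3" using nb(2-4) by (simp add: card_insert_if)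
    ultimately show ?thesis by simp
  qed
  have "num_deg2 ?G \<le> card ((\<lambda>i. pt (i * s + k + 1)) ` {..t})"
    unfolding num_deg2_def
  proof (rule card_mono)
    show "{v \<in> verts ?G. degree ?G v = 2} \<subseteq> (\<lambda>i. pt (i * s + k + 1)) ` {..t}"
    proof
      fix v assume v: "v \<in> {v \<in> verts ?G. degree ?G v = 2}"
      then obtain l where l: "l \<le> N" "v = pt l" unfolding vertsN by auto
      define i where "i = l div s"
      define r where "r = l mod s"
      have lr: "l = i * s + r" "r < s" unfolding i_def r_def using s(1) by simp_all
      have "l < Suc t * s" using l(1) N(1) by simp
      then have i: "i \<le> t" unfolding i_def using less_mult_imp_div_less[of l "Suc t" s] by simp
      note B = subsetD[OF block[OF i] block_pairs(1)] subsetD[OF block[OF i] block_pairs(2)]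
      have b: "i * s + k + 3 \<le> N" using in_block[OF i, of "k + 3"] s by simp
      have last: "(i * s, l) \<in> P" "(i * s + k + 2, l) \<in> P" "i * s + k + 2 < l" if "r = k + 3"
      proof -
        have l1: "l = i * s + k + 3" and l2: "l = Suc (i * s + k + 2)" using lr that by simp_all
        show "(i * s, l) \<in> P" unfolding l1 by (rule B(1))
        show "(i * s + k + 2, l) \<in> P" "i * s + k + 2 < l"
          using bdry[of "i * s + k + 2"] b l1 unfolding l2 by simp_all
      qed
      have "r = k + 1"
      proof (rule ccontr)
        assume "r \<noteq> k + 1"
        then consider "r = 0" | "0 < r" "r \<le> k" | "r = k + 2" | "r = k + 3" "i < t" | "r = k + 3" "i = t"
          using lr(2) s i by linarith
        then have "degree ?G (pt l) \<noteq> 2"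
        proof cases
          case 1
          then show ?thesis
            using deg3[of "l + 1" "l + k + 2" "l + k + 3" l] bdry[of l] B(1) B(2)[of 0] b lr by auto
        next
          case 2
          then obtain r' where r': "r = Suc r'" by (cases r) auto
          show ?thesis
            using deg3[of "i * s + r'" "l + 1" "i * s + k + 2" l] bdry[of l] bdry[of "i * s + r'"]
              B(2)[of r] b lr 2 r' by auto
        next
          case 3
          then show ?thesis
            using deg3[of "i * s" "i * s + 1" "l + 1" l] bdry[of l] B(2)[of 0] B(2)[of 1] b lr by auto
        next
          case 4
          have "l + 1 = Suc i * s" using 4 lr s by simp
          moreover have "Suc i * s \<le> t * s" using 4 by (intro mult_le_mono1) simp
          ultimately have "l < N" using N(1) s(1) unfolding mult_Suc by linarith
          then show ?thesis
            using deg3[of "i * s" "i * s + k + 2" "l + 1" l] bdry[of l] last[OF 4(1)] by auto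
        next
          case 5
          have lN: "l = N" using 5 lr s N(1) by simp
          have "0 < i * s" using 5 t s by simp
          then show ?thesis
            using deg3[of 0 "i * s" "i * s + k + 2" l] root last[OF 5(1)] lN by auto
        qed
        then show False using v l(2) by simp
      qed
      then show "v \<in> (\<lambda>i. pt (i * s + k + 1)) ` {..t}" using l(2) lr i by auto
    qed
  qed simp
  also have "\<dots> \<le> Suc t" using card_image_le[of "{..t}"] by simp
  finally have n2: "num_deg2 ?G \<le> Suc t" .
  obtain S where S: "isolating_set ?G (star (k + 1)) S" "card S = iota k ?G"
    using iota_attained by blast
  have SV: "S \<subseteq> V" using S(1) unfolding isolating_set_def verts by blast
  have finS: "finite S" using SV finite_subset unfolding V by blast
  \<comment> \<open>every block contains a guard\<close>
  have hit: "\<exists>a. pt a \<in> S \<and> a div s = i" if i: "i \<le> t" for i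
  proof (rule ccontr)
    assume no: "\<nexists>a. pt a \<in> S \<and> a div s = i"
    let ?u = "i * s"
    have notS: "pt (?u + r) \<notin> S" if "r < s" for r
    proof
      assume "pt (?u + r) \<in> S"
      moreover have "(?u + r) div s = i" using that s by simp
      ultimately show False using no by blast
    qed
    let ?X = "closed_nbhd ?G S"
    have B1: "(?u, ?u + k + 3) \<in> P" using block[OF i] block_pairs(1) by blast
    have far: "pt (?u + r) \<in> V - ?X" if r: "1 \<le> r" "r \<le> k + 2" for r
    proof -
      have rs: "r < s" using r s by simp
      have "pt (?u + r) \<notin> ?X"
      proof
        assume "pt (?u + r) \<in> ?X"
        then obtain x where x: "x \<in> S" "pt (?u + r) \<in> neighbors ?G x"
          using notS[OF rs] unfolding closed_nbhd_def by blast
        then obtain c where c: "x = pt c" using SV unfolding V by blast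
        have "{pt (?u + r), pt c} \<in> edges ?G" using x(2) unfolding c neighbors_def by simp
        then have "uncrossed (?u + r) c ?u (?u + k + 3) \<and> ?u + r < c \<or>
                   uncrossed c (?u + r) ?u (?u + k + 3) \<and> c < ?u + r"
          unfolding edge_iff using tri_pairs_uncrossed[OF T] tri_pairs_bounds[OF T] B1
          unfolding P_def by blast
        then have "?u \<le> c \<and> c \<le> ?u + k + 3" using r unfolding uncrossed_def by linarith
        then obtain q where "c = ?u + q" "q < s" using s by (auto simp: le_iff_add)
        then show False using notS x(1) c by blast
      qed
      then show ?thesis using in_block[OF i rs] unfolding V by auto
    qed
    have "contains_copy (delete_verts ?G ?X) (star (k + 1))"
    proof (rule star_copyI[where x = "pt (?u + (k + 2))" and Y = "(\<lambda>r. pt (?u + r)) ` {1..k + 1}"])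
      show "pt (?u + (k + 2)) \<in> verts ?G - ?X" unfolding verts by (rule far) auto
      show "(\<lambda>r. pt (?u + r)) ` {1..k + 1} \<subseteq> verts ?G - ?X" unfolding verts using far by auto
      show "card ((\<lambda>r. pt (?u + r)) ` {1..k + 1}) = k + 1"
        by (subst card_image) (auto simp: inj_on_def)
    next
      fix y assume "y \<in> (\<lambda>r. pt (?u + r)) ` {1..k + 1}"
      then obtain r where r: "y = pt (?u + r)" "r \<le> k + 1" by auto
      then have "(?u + r, ?u + k + 2) \<in> P" using block[OF i] block_pairs(2) by blast
      then show "{pt (?u + (k + 2)), y} \<in> edges ?G" unfolding r(1) edge_iff by (simp add: add.assoc)
    qed auto
    then show False using S(1) unfolding isolating_set_def by blast
  qed
  have "{..t} \<subseteq> (\<lambda>z. inv pt z div s) ` S"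
  proof
    fix i assume "i \<in> {..t}"
    then obtain a where a: "pt a \<in> S" "a div s = i" using hit by auto
    then have "inv pt (pt a) div s = i" using inv_f_f[OF inj_pt] by simp
    then show "i \<in> (\<lambda>z. inv pt z div s) ` S" using a(1) by (intro rev_image_eqI[of "pt a"]) auto
  qed
  then have "card {..t} \<le> card S" using finS surj_card_le by metis
  then have "Suc t \<le> iota k ?G" using S(2) by simp
  then show ?thesis using mop cardV n2 unfolding s_def by blast
qed

theorem theorem5:
  fixes k :: nat
  shows "(\<forall>V A. mop V A \<and> card V \<ge> k + 3 \<longrightarrow>
            real (iota k (graph_of V A))
              \<le> (real (card V) + real (num_deg2 (graph_of V A))) / (real k + 5)) \<and>
         infinite {n. \<exists>V A. mop V A \<and> card V = n \<and>
            real (iota k (graph_of V A))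
              = (real n + real (num_deg2 (graph_of V A))) / (real k + 5)}"
proof (intro conjI allI impI)
  fix V A assume VA: "mop V A \<and> card V \<ge> k + 3"
  then have "real ((k + 5) * iota k (graph_of V A)) \<le> real (card V + num_deg2 (graph_of V A))"
    using mop_iota_bound of_nat_le_iff by blast
  then show "real (iota k (graph_of V A))
      \<le> (real (card V) + real (num_deg2 (graph_of V A))) / (real k + 5)"
    by (simp add: pos_le_divide_eq algebra_simps)
next
  let ?N = "{n. \<exists>V A. mop V A \<and> card V = n \<and>
            real (iota k (graph_of V A))
              = (real n + real (num_deg2 (graph_of V A))) / (real k + 5)}"
  have "Suc (Suc t) * (k + 4) \<in> ?N" for t
  proof -
    obtain V A where VA: "mop V A" "card V = Suc (Suc t) * (k + 4)"
      "num_deg2 (graph_of V A) \<le> Suc (Suc t)" "Suc (Suc t) \<le> iota k (graph_of V A)"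
      using extremal_mop[of "Suc t" k] by auto
    have "(k + 5) * iota k (graph_of V A) \<le> card V + num_deg2 (graph_of V A)"
      using VA(2) by (intro mop_iota_bound[OF VA(1)]) simp
    moreover have "card V + num_deg2 (graph_of V A) \<le> (k + 5) * Suc (Suc t)"
      using VA(2,3) by (simp add: algebra_simps)
    moreover have "(k + 5) * Suc (Suc t) \<le> (k + 5) * iota k (graph_of V A)"
      using VA(4) by (rule mult_le_mono2)
    ultimately have "(k + 5) * iota k (graph_of V A) = card V + num_deg2 (graph_of V A)"
      by linarith
    then have "real ((k + 5) * iota k (graph_of V A)) = real (card V + num_deg2 (graph_of V A))"
      by (simp only:)
    then have "real (iota k (graph_of V A)) =
        (real (card V) + real (num_deg2 (graph_of V A))) / (real k + 5)"
      by (simp add: eq_divide_eq algebra_simps)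
    then show ?thesis using VA(1,2) by auto
  qed
  then have "range (\<lambda>t. Suc (Suc t) * (k + 4)) \<subseteq> ?N" by blast
  moreover have "infinite (range (\<lambda>t. Suc (Suc t) * (k + 4)))"
    by (intro range_inj_infinite injI) simp
  ultimately show "infinite ?N" using finite_subset by blast
qed

end
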